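(* For any fixed $r>0$, as $T\to\infty$, $$\frac{r}{T^{1/2}}\, I_W(T,r)\to\mathcal{C}\quad\text{almost surely},\qquad \frac{r}{T^{1/2}}\, I_W^0(T,r)\to\mathcal{C}\quad\text{almost surely},$$ where $\mathcal{C}\in(0,\infty)$ is the taut string energy constant defined in the context.
   Context: $W=(W(t))_{t\ge 0}$ is a standard one-dimensional Wiener process with $W(0)=0$ and continuous paths. For $T>0$, $\|h\|_T:=\sup_{0\le t\le T}|h(t)|$ for continuous $h$ on $[0,T]$; $AC[0,T]$ is the set of absolutely continuous real functions on $[0,T]$, and $|h|_T:=\left(\int_0^T h'(t)^2\,dt\right)^{1/2}$ (possibly $+\infty$) for $h\in AC[0,T]$. For $T,r>0$ define the random variables $$I_W(T,r):=\inf\{|h|_T:\ h\in AC[0,T],\ \|h-W\|_T\le r,\ h(0)=0\},$$ $$I_W^0(T,r):=\inf\{|h|_T:\ h\in AC[0,T],\ \|h-W\|_T\le r,\ h(0)=0,\ h(T)=W(T)\}.$$ The constant $\mathcal{C}\in(0,\infty)$ is the (unique) deterministic number such that, for every $q>0$, $\mathbb{E}\left|\frac{r}{T^{1/2}} I_W(T,r)-\mathcal{C}\right|^q\to 0$ and $\mathbb{E}\left|\frac{r}{T^{1/2}} I_W^0(T,r)-\mathcal{C}\right|^q\to 0$ as $r/\sqrt{T}\to 0$; the existence of such a constant is another theorem of the paper. *)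

theory Defs
  imports "HOL-Probability.Probability"
begin

section \<open>Wiener processes\<close>

text \<open>Continuity and the initial value are required on the whole sample space, not merely almost
  surely. Only times \<open>t \<ge> 0\<close> are constrained; the second argument of \<^const>\<open>normal_density\<close> is
  the standard deviation.\<close>

locale wiener_process = prob_space M for M :: "'a measure" +
  fixes W :: "real \<Rightarrow> 'a \<Rightarrow> real"
  assumes measurable_W: "0 \<le> t \<Longrightarrow> W t \<in> borel_measurable M"
    and start_zero: "\<omega> \<in> space M \<Longrightarrow> W 0 \<omega> = 0"
    and continuous_paths: "\<omega> \<in> space M \<Longrightarrow> continuous_on {0..} (\<lambda>t. W t \<omega>)"
    and normal_increments: "0 \<le> s \<Longrightarrow> s < t \<Longrightarrow>
      distributed M lborel (\<lambda>\<omega>. W t \<omega> - W s \<omega>) (normal_density 0 (sqrt (t - s)))"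
    and independent_increments: "0 \<le> u 0 \<Longrightarrow> (\<And>i. i < n \<Longrightarrow> u i < u (Suc i)) \<Longrightarrow>
      indep_vars (\<lambda>_. borel) (\<lambda>i \<omega>. W (u (Suc i)) \<omega> - W (u i) \<omega>) {..<n::nat}"

section \<open>Energy of absolutely continuous functions\<close>

definition absolutely_continuous_on :: "real \<Rightarrow> real \<Rightarrow> (real \<Rightarrow> real) \<Rightarrow> bool" where
  "absolutely_continuous_on lo hi h \<longleftrightarrow>
    (\<forall>\<epsilon>>0. \<exists>\<delta>>0. \<forall>(n::nat) a b.
       (\<forall>i<n. lo \<le> a i \<and> a i \<le> b i \<and> b i \<le> hi) \<and>
       disjoint_family_on (\<lambda>i. {a i<..<b i}) {..<n} \<and>
       (\<Sum>i<n. b i - a i) < \<delta>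
       \<longrightarrow> (\<Sum>i<n. \<bar>h (b i) - h (a i)\<bar>) < \<epsilon>)"

definition sup_norm :: "real \<Rightarrow> (real \<Rightarrow> real) \<Rightarrow> real" where
  "sup_norm T f = (SUP t\<in>{0..T}. \<bar>f t\<bar>)"

text \<open>Real powers \<open>x\<^sup>p\<close> with \<open>p > 0\<close> on \<open>[0, \<infinity>]\<close>, with \<open>\<infinity>\<^sup>p = \<infinity>\<close>.\<close>

definition ennreal_power :: "ennreal \<Rightarrow> real \<Rightarrow> ennreal" where
  "ennreal_power x p = (if x = \<top> then \<top> else ennreal (enn2real x powr p))"

text \<open>An absolutely continuous function is differentiable almost everywhere on the interval, so the
  unspecified values of \<^const>\<open>deriv\<close> elsewhere, and its dependence at the two endpoints on the
  values of \<open>h\<close> outside \<open>[0, T]\<close>, do not affect the integral.\<close>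

definition energy_norm :: "real \<Rightarrow> (real \<Rightarrow> real) \<Rightarrow> ennreal" where
  "energy_norm T h =
    ennreal_power (\<integral>\<^sup>+t\<in>{0..T}. ennreal ((deriv h t)\<^sup>2) \<partial>lebesgue) (1/2)"

section \<open>Taut strings\<close>

text \<open>\<open>I_free\<close> and \<open>I_fixed\<close> are \<open>I\<^sub>w\<close> and \<open>I\<^sub>w\<^sup>0\<close> for a single path \<open>w\<close>.\<close>

definition I_free :: "(real \<Rightarrow> real) \<Rightarrow> real \<Rightarrow> real \<Rightarrow> ennreal" where
  "I_free w T r = (INF h \<in> {h. absolutely_continuous_on 0 T h \<and>
     sup_norm T (\<lambda>t. h t - w t) \<le> r \<and> h 0 = 0}. energy_norm T h)"

definition I_fixed :: "(real \<Rightarrow> real) \<Rightarrow> real \<Rightarrow> real \<Rightarrow> ennreal" where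
  "I_fixed w T r = (INF h \<in> {h. absolutely_continuous_on 0 T h \<and>
     sup_norm T (\<lambda>t. h t - w t) \<le> r \<and> h 0 = 0 \<and> h T = w T}. energy_norm T h)"

definition abs_diff_power :: "ennreal \<Rightarrow> real \<Rightarrow> real \<Rightarrow> ennreal" where
  "abs_diff_power x c q = ennreal_power (e2ennreal \<bar>enn2ereal x - ereal c\<bar>) q"

text \<open>The regime \<open>r / \<surd>T \<rightarrow> 0\<close>, jointly in \<open>(T, r)\<close> with \<open>T, r > 0\<close>.\<close>

definition small_ratio :: "(real \<times> real) filter" where
  "small_ratio = inf (filtercomap (\<lambda>(T, r). r / sqrt T) (nhds 0)) (principal ({0<..} \<times> {0<..}))"

text \<open>\<open>c\<close> is the taut string energy constant: the deterministic limit, in every \<open>L\<^sup>q\<close>, of the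
  normalized minimal energies. Expectations of nonnegative variables are taken in \<open>[0, \<infinity>]\<close>.\<close>

definition taut_string_constant :: "'a measure \<Rightarrow> (real \<Rightarrow> 'a \<Rightarrow> real) \<Rightarrow> real \<Rightarrow> bool" where
  "taut_string_constant M W c \<longleftrightarrow> 0 < c \<and>
    (\<forall>q>0.
      ((\<lambda>(T, r). \<integral>\<^sup>+\<omega>. abs_diff_power (ennreal (r / sqrt T) * I_free (\<lambda>t. W t \<omega>) T r) c q \<partial>M)
         \<longlongrightarrow> 0) small_ratio \<and>
      ((\<lambda>(T, r). \<integral>\<^sup>+\<omega>. abs_diff_power (ennreal (r / sqrt T) * I_fixed (\<lambda>t. W t \<omega>) T r) c q \<partial>M)
         \<longlongrightarrow> 0) small_ratio)"

end

theory Submission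
  imports Defs "HOL-Real_Asymp.Real_Asymp"
begin

text \<open>
  Write \<open>Q(T)\<close> for the squared minimal energy \<open>I\<^sub>W(T, r)\<^sup>2\<close>. The claim is that \<open>Q(T) / T\<close> tends to
  \<open>\<C>\<^sup>2 / r\<^sup>2\<close> almost surely, and likewise for strings that end on the path. The assumed convergence in
  every \<open>L\<^sup>q\<close> enters in two ways: it yields \<open>\<E> Q(T) / T \<rightarrow> \<C>\<^sup>2 / r\<^sup>2\<close>, and it makes \<open>Q(T)\<close> square
  integrable for large \<open>T\<close>.

  Cut the time axis into blocks of a fixed length \<open>L\<close>. The energies of the increments of the path over
  the blocks are pairwise independent copies of \<open>Q(L)\<close>, so their averages converge to \<open>\<E> Q(L)\<close> by a strong law
  of large numbers. The energy \<open>Q(n L)\<close> is nearly the sum of the block energies. A string on \<open>[0, n L]\<close>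
  restricts to strings on the blocks, which only fail to start on the path; conversely, strings on
  the blocks can be glued once they end on the path. Both defects are repaired by crossfading: within a
  time span of length \<open>S\<close> one passes, with an affine weight, from one string in the tube to another one.
  The tube is convex, so the mixture stays inside. Its energy is at most \<open>1 + \<eta>\<close> times the sum of
  the two energies plus a constant that depends on \<open>r\<close>, \<open>S\<close> and \<open>\<eta>\<close>
  (\<open>has_energy_crossfade\<close>). The repair cost per block does not grow with \<open>L\<close>
  (\<open>sum_blocks_le_min_energy\<close>, \<open>min_energy_le_sum_blocks\<close>). Letting \<open>n \<rightarrow> \<infinity>\<close>, then \<open>L \<rightarrow> \<infinity>\<close>, then \<open>\<eta> \<rightarrow> 0\<close>
  identifies the limit along multiples of \<open>L\<close>, and monotonicity of \<open>Q\<close> in \<open>T\<close> gives all times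
  (\<open>AE_min_energy_average\<close>). One more crossfade near the time \<open>T\<close> transfers the result to strings with a
  prescribed end value (\<open>AE_min_energy_fixed_average\<close>).

  Two analytic facts support this argument. Crossfading differentiates a combination of two absolutely continuous
  functions, and the energy is defined through \<^const>\<open>deriv\<close>; hence one needs that absolutely continuous
  functions are differentiable almost everywhere. Probabilistic statements about \<open>Q\<close> need its measurability:
  the minimal energy depends continuously on the path in the supremum norm (\<open>tendsto_min_energy\<close>), so it is a limit of the energies of
  Bernstein polynomials, which are continuous functions of finitely many increments of the path.
\<close>

section \<open>Almost everywhere differentiability of absolutely continuous functions\<close>

lemma sum_increments_le_of_mono:
  fixes \<psi> :: "real \<Rightarrow> real" and l r :: "'i \<Rightarrow> real"
  assumes "finite C" "mono_on {u..v} \<psi>" "u \<le> v"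
    and "\<And>i. i \<in> C \<Longrightarrow> u \<le> l i \<and> l i < r i \<and> r i \<le> v"
    and "pairwise (\<lambda>i j. disjnt {l i..r i} {l j..r j}) C"
  shows "(\<Sum>i\<in>C. \<psi> (r i) - \<psi> (l i)) \<le> \<psi> v - \<psi> u"
  using assms
proof (induction "card C" arbitrary: C v)
  case 0
  then have "C = {}" by simp
  then show ?case using 0 by (auto intro: mono_onD)
next
  case (Suc n)
  have ne: "C \<noteq> {}" using Suc by auto
  have "Max (l ` C) \<in> l ` C" using ne Suc.prems(1) by (intro Max_in) auto
  then obtain i where "i \<in> C" "l i = Max (l ` C)" by auto
  then have i: "i \<in> C" "\<And>j. j \<in> C \<Longrightarrow> l j \<le> l i" using Suc.prems(1) by auto
  have ui: "u \<le> l i" "l i < r i" "r i \<le> v" using Suc.prems(4) i by auto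
  have rj: "r j < l i" if "j \<in> C - {i}" for j
  proof (rule ccontr)
    assume "\<not> r j < l i"
    moreover have "disjnt {l i..r i} {l j..r j}" using Suc.prems(5) that i(1) unfolding pairwise_def by auto
    moreover have "l j \<le> l i" using i that by auto
    ultimately have "l i \<in> {l i..r i} \<inter> {l j..r j}" using ui by auto
    then show False using \<open>disjnt {l i..r i} {l j..r j}\<close> unfolding disjnt_def by blast
  qed
  have "(\<Sum>j\<in>C - {i}. \<psi> (r j) - \<psi> (l j)) \<le> \<psi> (l i) - \<psi> u"
  proof (rule Suc.hyps(1))
    show "n = card (C - {i})" using Suc i by simp
    show "mono_on {u..l i} \<psi>" using Suc.prems(2) by (rule mono_on_subset) (use ui in auto)
    show "u \<le> l j \<and> l j < r j \<and> r j \<le> l i" if "j \<in> C - {i}" for j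
      using rj[OF that] Suc.prems(4)[of j] that by auto
    show "pairwise (\<lambda>i j. disjnt {l i..r i} {l j..r j}) (C - {i})"
      using Suc.prems(5) by (rule pairwise_subset) auto
  qed (use Suc.prems ui in auto)
  moreover have "\<psi> (r i) \<le> \<psi> v" using mono_onD[OF Suc.prems(2), of "r i" v] ui by auto
  ultimately show ?case
    using Suc.prems(1) i by (subst sum.remove[of _ i]) auto
qed

text \<open>The Vitali covering theorem extracts from the given intervals a disjoint family that covers
  \<open>E\<close> up to a null set. Along a disjoint family a monotone function cannot grow by more than its total
  increment, and on each interval it grows at least \<open>K\<close> times the length.\<close>

lemma Vitali_bound_by_monotone_increment:
  fixes \<psi> :: "real \<Rightarrow> real"
  assumes mono: "mono_on {u..v} \<psi>" and uv: "u \<le> v" and K: "0 < K"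
    and small: "\<And>x d. x \<in> E \<Longrightarrow> 0 < d \<Longrightarrow>
      \<exists>l r. l < r \<and> u \<le> l \<and> r \<le> v \<and> x \<in> {l..r} \<and> r - l < d \<and> K * (r - l) \<le> \<psi> r - \<psi> l"
  obtains T where "E \<subseteq> T" "T \<in> lmeasurable" "measure lebesgue T \<le> (\<psi> v - \<psi> u) / K"
proof -
  define I where "I = {(l, r). l < r \<and> u \<le> l \<and> r \<le> v \<and> K * (r - l) \<le> \<psi> r - \<psi> l}"
  define ce where "ce = (\<lambda>(l::real, r). (l + r) / 2)"
  define ra where "ra = (\<lambda>(l::real, r). (r - l) / 2)"
  have cb: "cball (ce i) (ra i) = {fst i..snd i}" for i
    by (cases i) (auto simp: ce_def ra_def cball_eq_atLeastAtMost field_simps)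
  have ex: "\<exists>i. i \<in> I \<and> x \<in> cball (ce i) (ra i) \<and> ra i < d" if x: "x \<in> E" and d: "0 < d" for x d
  proof -
    obtain l r where "l < r" "u \<le> l" "r \<le> v" "x \<in> {l..r}" "r - l < d" "K * (r - l) \<le> \<psi> r - \<psi> l"
      using small[OF x d] by blast
    then show ?thesis unfolding cb by (intro exI[of _ "(l, r)"]) (auto simp: I_def ra_def)
  qed
  have pos: "0 < ra i" if "i \<in> I" for i using that by (auto simp: I_def ra_def)
  obtain C where C: "countable C" "C \<subseteq> I"
    "pairwise (\<lambda>i j. disjnt (cball (ce i) (ra i)) (cball (ce j) (ra j))) C"
    "negligible (E - (\<Union>i\<in>C. cball (ce i) (ra i)))"
    by (rule Vitali_covering_theorem_cballs[OF pos ex]) blast+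
  define B where "B = (\<psi> v - \<psi> u) / K"
  have bound: "measure lebesgue (\<Union>i\<in>D. cball (ce i) (ra i)) \<le> B" if D: "D \<subseteq> C" "finite D" for D
  proof -
    have "measure lebesgue (\<Union>i\<in>D. cball (ce i) (ra i)) \<le> (\<Sum>i\<in>D. measure lebesgue (cball (ce i) (ra i)))"
      by (rule measure_UNION_le) (use D in auto)
    also have "\<dots> \<le> (\<Sum>i\<in>D. (\<psi> (snd i) - \<psi> (fst i)) / K)"
    proof (rule sum_mono)
      fix i assume "i \<in> D"
      then have "i \<in> I" using D C by auto
      then show "measure lebesgue (cball (ce i) (ra i)) \<le> (\<psi> (snd i) - \<psi> (fst i)) / K"
        unfolding cb using K by (auto simp: I_def field_simps)
    qed
    also have "\<dots> = (\<Sum>i\<in>D. \<psi> (snd i) - \<psi> (fst i)) / K" by (simp add: sum_divide_distrib)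
    also have "\<dots> \<le> (\<psi> v - \<psi> u) / K"
    proof (rule divide_right_mono)
      show "(\<Sum>i\<in>D. \<psi> (snd i) - \<psi> (fst i)) \<le> \<psi> v - \<psi> u"
      proof (rule sum_increments_le_of_mono[where \<psi> = \<psi> and l = fst and r = snd])
        show "u \<le> fst i \<and> fst i < snd i \<and> snd i \<le> v" if "i \<in> D" for i
          using that D C by (auto simp: I_def)
        show "pairwise (\<lambda>i j. disjnt {fst i..snd i} {fst j..snd j}) D"
          using pairwise_subset[OF C(3) D(1)] by (simp add: cb)
      qed (use mono uv D in auto)
    qed (use K in auto)
    finally show ?thesis by (simp add: B_def)
  qed
  define U where "U = (\<Union>i\<in>C. cball (ce i) (ra i))"
  have U: "U \<in> lmeasurable" "measure lebesgue U \<le> B"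
    unfolding U_def
    using fmeasurable_UN_bound[of C "\<lambda>i. cball (ce i) (ra i)" lebesgue B]
      measure_UN_bound[of C "\<lambda>i. cball (ce i) (ra i)" lebesgue B] C bound by auto
  define N where "N = E - U"
  have N: "negligible N" using C(4) by (simp add: N_def U_def)
  show ?thesis
  proof
    show "E \<subseteq> U \<union> N" by (auto simp: N_def)
    show "U \<union> N \<in> lmeasurable" using U N by (simp add: fmeasurable.Un negligible_imp_measurable)
    have "measure lebesgue (U \<union> N) \<le> measure lebesgue U + measure lebesgue N"
      by (rule measure_Un_le) (use U N negligible_imp_measurable in \<open>auto simp: fmeasurableD\<close>)
    then show "measure lebesgue (U \<union> N) \<le> (\<psi> v - \<psi> u) / K"
      using U N by (simp add: B_def negligible_imp_measure0)
  qed
qed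

text \<open>Partitions are weakly increasing finite sequences: allowing repeated points covers
  degenerate intervals and lets two partitions be concatenated without a case distinction.\<close>

definition partitions :: "real \<Rightarrow> real \<Rightarrow> (nat \<times> (nat \<Rightarrow> real)) set" where
  "partitions u v = {(n, t). t 0 = u \<and> t n = v \<and> (\<forall>i<n. t i \<le> t (Suc i))}"

definition increment_sum :: "(real \<Rightarrow> real) \<Rightarrow> nat \<times> (nat \<Rightarrow> real) \<Rightarrow> real" where
  "increment_sum f = (\<lambda>(n, t). \<Sum>i<n. \<bar>f (t (Suc i)) - f (t i)\<bar>)"

definition variation :: "(real \<Rightarrow> real) \<Rightarrow> real \<Rightarrow> real \<Rightarrow> real" where
  "variation f u v = (SUP p\<in>partitions u v. increment_sum f p)"

lemma trivial_partition: "u \<le> v \<Longrightarrow> (1, \<lambda>i. if i = 0 then u else v) \<in> partitions u v"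
  by (simp add: partitions_def)

lemma partition_mono:
  assumes "(n, t) \<in> partitions u v" "i \<le> j" "j \<le> n"
  shows "t i \<le> t j"
proof -
  have "j \<le> n \<longrightarrow> t i \<le> t j" using assms(2)
    by (induction j rule: dec_induct) (use assms(1) in \<open>auto simp: partitions_def intro: order_trans\<close>)
  then show ?thesis using assms by auto
qed

lemma partition_append:
  assumes p: "(n, s) \<in> partitions u m" and q: "(k, t) \<in> partitions m v"
  defines "st \<equiv> (\<lambda>i. if i \<le> n then s i else t (i - n))"
  shows "(n + k, st) \<in> partitions u v"
    and "increment_sum f (n + k, st) = increment_sum f (n, s) + increment_sum f (k, t)"
proof -
  have eq: "st (n + i) = t i" for i
    using p q by (cases i) (auto simp: st_def partitions_def)
  have le: "st i \<le> st (Suc i)" if "i < n + k" for i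
  proof (cases "i < n")
    case True
    then show ?thesis using p by (auto simp: st_def partitions_def)
  next
    case False
    then have j: "i = n + (i - n)" "i - n < k" using that by auto
    define j where "j = i - n"
    note j = j[folded j_def]
    then show ?thesis using q eq[of j] eq[of "Suc j"] by (auto simp: partitions_def)
  qed
  show "(n + k, st) \<in> partitions u v"
    using le eq[of k] p q by (auto simp: partitions_def st_def)
  have "(\<Sum>i<n + k. \<bar>f (st (Suc i)) - f (st i)\<bar>) =
      (\<Sum>i<n. \<bar>f (st (Suc i)) - f (st i)\<bar>) + (\<Sum>i<k. \<bar>f (st (Suc (n + i))) - f (st (n + i))\<bar>)"
    by (induction k) auto
  also have "(\<Sum>i<n. \<bar>f (st (Suc i)) - f (st i)\<bar>) = (\<Sum>i<n. \<bar>f (s (Suc i)) - f (s i)\<bar>)"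
    by (rule sum.cong) (auto simp: st_def)
  also have "(\<Sum>i<k. \<bar>f (st (Suc (n + i))) - f (st (n + i))\<bar>) = (\<Sum>i<k. \<bar>f (t (Suc i)) - f (t i)\<bar>)"
    using eq by (intro sum.cong) (auto simp flip: add_Suc_right)
  finally show "increment_sum f (n + k, st) = increment_sum f (n, s) + increment_sum f (k, t)"
    by (simp add: increment_sum_def)
qed

definition bounded_variation :: "(real \<Rightarrow> real) \<Rightarrow> real \<Rightarrow> real \<Rightarrow> bool" where
  "bounded_variation f u v \<longleftrightarrow> bdd_above (increment_sum f ` partitions u v)"

lemma increment_sum_nonneg: "0 \<le> increment_sum f p"
  by (auto simp: increment_sum_def sum_nonneg split: prod.split)

lemma bounded_variation_subinterval:
  assumes "bounded_variation f u v" "u \<le> l" "l \<le> r" "r \<le> v"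
  shows "bounded_variation f l r"
proof -
  obtain B where B: "\<And>p. p \<in> partitions u v \<Longrightarrow> increment_sum f p \<le> B"
    using assms unfolding bounded_variation_def bdd_above_def by auto
  have "increment_sum f p \<le> B" if "p \<in> partitions l r" for p
  proof -
    obtain n t where p: "p = (n, t)" by (cases p)
    define a where "a = (\<lambda>i::nat. if i = 0 then u else l)"
    define b where "b = (\<lambda>i::nat. if i = 0 then r else v)"
    have 1: "(1, a) \<in> partitions u l" "(1, b) \<in> partitions r v"
      using trivial_partition assms unfolding a_def b_def by auto
    note 2 = partition_append[OF 1(1) that[unfolded p]]
    note 3 = partition_append[OF 2(1) 1(2)]
    show ?thesis
      using B[OF 3(1)] 2(2)[of f] 3(2)[of f] increment_sum_nonneg[of f "(1, a)"] increment_sum_nonneg[of f "(1, b)"]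
      by (simp add: p)
  qed
  then show ?thesis unfolding bounded_variation_def by (rule bdd_aboveI2)
qed

lemma increment_le_variation:
  assumes "bounded_variation f u v" "u \<le> v"
  shows "\<bar>f v - f u\<bar> \<le> variation f u v"
  unfolding variation_def
  by (rule cSUP_upper2[OF _ trivial_partition[OF assms(2)]])
    (use assms in \<open>auto simp: bounded_variation_def increment_sum_def\<close>)

lemma variation_superadditive:
  assumes bv: "bounded_variation f u v" and "u \<le> m" "m \<le> v"
  shows "variation f u m + variation f m v \<le> variation f u v"
proof -
  have ne: "partitions u m \<noteq> {}" "partitions m v \<noteq> {}" using trivial_partition assms by blast+
  have "increment_sum f p \<le> variation f u v - variation f m v" if p: "p \<in> partitions u m" for p
  proof -
    have "increment_sum f q \<le> variation f u v - increment_sum f p" if q: "q \<in> partitions m v" for q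
    proof -
      obtain n s k t where pq: "p = (n, s)" "q = (k, t)" by (cases p, cases q)
      note a = partition_append[OF p[unfolded pq] q[unfolded pq]]
      have "increment_sum f p + increment_sum f q \<le> variation f u v"
        unfolding variation_def pq a(2)[symmetric]
        by (rule cSUP_upper[OF a(1)]) (use bv in \<open>simp add: bounded_variation_def\<close>)
      then show ?thesis by simp
    qed
    then have "variation f m v \<le> variation f u v - increment_sum f p"
      unfolding variation_def[of f m v] by (intro cSUP_least ne)
    then show ?thesis by simp
  qed
  then have "variation f u m \<le> variation f u v - variation f m v"
    unfolding variation_def[of f u m] by (intro cSUP_least ne)
  then show ?thesis by simp
qed

lemma increment_le_variation_function:
  assumes bv: "bounded_variation f u v" and "u \<le> l" "l \<le> r" "r \<le> v"
  shows "\<bar>f r - f l\<bar> \<le> variation f u r - variation f u l"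
proof -
  have "bounded_variation f u r" "bounded_variation f l r"
    using bounded_variation_subinterval[OF bv] assms by auto
  then show ?thesis
    using variation_superadditive[of f u r l] increment_le_variation[of f l r] assms by simp
qed

text \<open>Applied to \<open>f\<close> and to \<open>- f\<close>, after subtracting linear functions, this compares the upper and lower
  derivates of \<open>f\<close> at \<open>x\<close> with \<open>K\<close>. Intervals around \<open>x\<close>, not only with end point \<open>x\<close>, are admitted,
  which is the form that a Vitali cover uses.\<close>

definition steep_at :: "(real \<Rightarrow> real) \<Rightarrow> real \<Rightarrow> real \<Rightarrow> bool" where
  "steep_at g x K \<longleftrightarrow> (\<forall>d>0. \<exists>l r. l < r \<and> x \<in> {l..r} \<and> r - l < d \<and> K * (r - l) \<le> g r - g l)"

lemma steep_at_inside:
  assumes "steep_at g x K" "u < x" "x < v" "0 < d"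
  shows "\<exists>l r. l < r \<and> u \<le> l \<and> r \<le> v \<and> x \<in> {l..r} \<and> r - l < d \<and> K * (r - l) \<le> g r - g l"
proof -
  have "0 < min d (min (x - u) (v - x))" using assms by auto
  then obtain l r where "l < r" "x \<in> {l..r}" "r - l < min d (min (x - u) (v - x))" "K * (r - l) \<le> g r - g l"
    using assms(1) unfolding steep_at_def by blast
  then show ?thesis by (intro exI[of _ l] exI[of _ r]) auto
qed

text \<open>Let \<open>\<phi>\<close> be the variation function, and take a partition whose increment sum falls short of the total
  variation by less than \<open>2 * d * e\<close>. Let \<open>s = \<plusminus>1\<close> be the sign of the increment of \<open>f\<close> over a cell. There
  \<open>\<phi> - s * f\<close> is monotone, and its increments over all cells add up to less than \<open>2 * d * e\<close>. A chord that is
  steep against the sign \<open>s\<close> raises \<open>\<phi> - s * f\<close> by \<open>2 * d\<close> per unit length: once through the variation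
  and once through \<open>f\<close>. The Vitali bound leaves measure at most \<open>e\<close>.\<close>

lemma negligible_steep_in_both_directions:
  assumes bv: "bounded_variation f u v" and uv: "u \<le> v" and d: "0 < d"
  shows "negligible {x \<in> {u<..<v}. steep_at f x d \<and> steep_at (\<lambda>t. - f t) x d}"
    (is "negligible ?E")
  unfolding negligible_outer_le
proof (intro allI impI)
  fix e :: real assume e: "0 < e"
  define \<phi> where "\<phi> = variation f u"
  have ne: "partitions u v \<noteq> {}" using trivial_partition uv by blast
  have "\<exists>p\<in>partitions u v. variation f u v - 2 * d * e < increment_sum f p"
    using less_cSUP_iff[OF ne bv[unfolded bounded_variation_def], of "variation f u v - 2 * d * e"] e d
    by (simp add: variation_def)
  then obtain n t where nt: "(n, t) \<in> partitions u v" "variation f u v - 2 * d * e < increment_sum f (n, t)"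
    by auto
  define s where "s i = (if f (t i) \<le> f (t (Suc i)) then 1 else -1 :: real)" for i
  define \<psi> where "\<psi> i x = \<phi> x - s i * f x" for i x
  have t0: "t 0 = u" "t n = v" using nt by (auto simp: partitions_def)
  have tin: "u \<le> t i" "t i \<le> v" if "i \<le> n" for i
    using partition_mono[OF nt(1), of 0 i] partition_mono[OF nt(1), of i n] that t0 by auto
  have tmono: "t i \<le> t (Suc i)" if "i < n" for i using nt that by (auto simp: partitions_def)
  define covers where "covers i T \<longleftrightarrow> ?E \<inter> {t i<..<t (Suc i)} \<subseteq> T \<and> T \<in> lmeasurable \<and>
      measure lebesgue T \<le> (\<psi> i (t (Suc i)) - \<psi> i (t i)) / (2 * d)" for i T
  have "\<exists>T. covers i T" if i: "i < n" for i
  proof -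
    have cell: "u \<le> t i" "t (Suc i) \<le> v" using tin i by auto
    have mono: "mono_on {t i..t (Suc i)} (\<psi> i)"
    proof (rule mono_onI)
      fix x y assume xy: "x \<in> {t i..t (Suc i)}" "y \<in> {t i..t (Suc i)}" "x \<le> y"
      then have "\<bar>f y - f x\<bar> \<le> \<phi> y - \<phi> x"
        unfolding \<phi>_def using cell by (intro increment_le_variation_function[OF bv]) auto
      then show "\<psi> i x \<le> \<psi> i y" by (auto simp: \<psi>_def s_def)
    qed
    have small: "\<exists>l r. l < r \<and> t i \<le> l \<and> r \<le> t (Suc i) \<and> x \<in> {l..r} \<and> r - l < h \<and>
        2 * d * (r - l) \<le> \<psi> i r - \<psi> i l"
      if x: "x \<in> ?E \<inter> {t i<..<t (Suc i)}" and h: "0 < h" for x h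
    proof -
      have "steep_at (\<lambda>t. - (s i * f t)) x d" using x by (auto simp: s_def)
      from steep_at_inside[OF this, of "t i" "t (Suc i)" h]
      obtain l r where lr: "l < r" "t i \<le> l" "r \<le> t (Suc i)" "x \<in> {l..r}" "r - l < h"
        "d * (r - l) \<le> - (s i * f r) + s i * f l" using x h by auto
      have "\<bar>f r - f l\<bar> \<le> \<phi> r - \<phi> l"
        unfolding \<phi>_def using cell lr by (intro increment_le_variation_function[OF bv]) auto
      moreover have "- (s i * f r) + s i * f l \<le> \<bar>f r - f l\<bar>" by (auto simp: s_def)
      ultimately have "2 * d * (r - l) \<le> \<psi> i r - \<psi> i l" using lr(6) by (simp add: \<psi>_def)
      then show ?thesis using lr by blast
    qed
    have "0 < 2 * d" using d by simp
    obtain T where "?E \<inter> {t i<..<t (Suc i)} \<subseteq> T" "T \<in> lmeasurable"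
      "measure lebesgue T \<le> (\<psi> i (t (Suc i)) - \<psi> i (t i)) / (2 * d)"
      by (rule Vitali_bound_by_monotone_increment[OF mono tmono[OF i] \<open>0 < 2 * d\<close> small])
    then show ?thesis unfolding covers_def by blast
  qed
  then have "\<forall>i. \<exists>T. i < n \<longrightarrow> covers i T" by blast
  from choice[OF this] obtain T where "\<And>i. i < n \<Longrightarrow> covers i (T i)" by blast
  then have T: "\<And>i. i < n \<Longrightarrow> ?E \<inter> {t i<..<t (Suc i)} \<subseteq> T i"
    "\<And>i. i < n \<Longrightarrow> T i \<in> lmeasurable"
    "\<And>i. i < n \<Longrightarrow> measure lebesgue (T i) \<le> (\<psi> i (t (Suc i)) - \<psi> i (t i)) / (2 * d)"
    unfolding covers_def by blast+
  have cover: "\<exists>i<n. x \<in> {t i..t (Suc i)}" if "x \<in> {u..v}" "u < v" for x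
  proof -
    define i where "i = (LEAST j. x \<le> t j)"
    have ex: "x \<le> t n" using that t0 by simp
    have i: "x \<le> t i" unfolding i_def by (rule LeastI[of _ n]) (fact ex)
    have "i \<le> n" unfolding i_def by (rule Least_le) (fact ex)
    show ?thesis
    proof (cases i)
      case 0
      then have "x = u" using i t0 that by auto
      moreover have "0 < n" using t0 that by (cases n) auto
      ultimately show ?thesis using t0 tmono[of 0] by (intro exI[of _ 0]) auto
    next
      case (Suc j)
      then have "\<not> x \<le> t j" using not_less_Least[of j "\<lambda>j. x \<le> t j"] by (simp add: i_def)
      then show ?thesis using Suc i \<open>i \<le> n\<close> by (intro exI[of _ j]) auto
    qed
  qed
  let ?U = "(\<Union>i<n. T i)" and ?F = "t ` {..n}"
  have UF: "?F \<in> lmeasurable" "measure lebesgue ?F = 0"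
    by (auto intro: negligible_imp_measurable negligible_imp_measure0)
  have Um: "?U \<in> lmeasurable" using T by (intro fmeasurable.finite_UN) auto
  show "\<exists>T. ?E \<subseteq> T \<and> T \<in> lmeasurable \<and> measure lebesgue T \<le> e"
  proof (intro exI conjI)
    show "?E \<subseteq> ?U \<union> ?F"
    proof
      fix x assume x: "x \<in> ?E"
      then obtain i where i: "i < n" "x \<in> {t i..t (Suc i)}" using cover[of x] by auto
      show "x \<in> ?U \<union> ?F"
      proof (cases "x = t i \<or> x = t (Suc i)")
        case True
        then show ?thesis using i by auto
      next
        case False
        then show ?thesis using i T(1)[OF i(1)] x by auto
      qed
    qed
    show "?U \<union> ?F \<in> lmeasurable" using Um UF by (intro fmeasurable.Un)
    have "measure lebesgue (?U \<union> ?F) \<le> measure lebesgue ?U + measure lebesgue ?F"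
      by (rule measure_Un_le) (use Um UF in \<open>auto simp: fmeasurableD\<close>)
    also have "\<dots> \<le> (\<Sum>i<n. measure lebesgue (T i))"
      using UF by (simp, intro measure_UNION_le) (use T in \<open>auto simp: fmeasurableD\<close>)
    also have "\<dots> \<le> (\<Sum>i<n. (\<psi> i (t (Suc i)) - \<psi> i (t i)) / (2 * d))"
      by (rule sum_mono) (use T in auto)
    also have "\<dots> = (\<Sum>i<n. (\<phi> (t (Suc i)) - \<phi> (t i)) - \<bar>f (t (Suc i)) - f (t i)\<bar>) / (2 * d)"
      unfolding sum_divide_distrib by (intro sum.cong) (auto simp: \<psi>_def s_def)
    also have "\<dots> = (\<phi> v - \<phi> u - increment_sum f (n, t)) / (2 * d)"
      using sum_lessThan_telescope[of "\<lambda>i. \<phi> (t i)" n] by (simp add: sum_subtractf increment_sum_def t0)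
    also have "\<dots> \<le> e"
    proof -
      have "0 \<le> \<phi> u" unfolding \<phi>_def using increment_le_variation[of f u u]
        bounded_variation_subinterval[OF bv, of u u] uv by simp
      then show ?thesis using nt(2) d by (simp add: \<phi>_def field_simps)
    qed
    finally show "measure lebesgue (?U \<union> ?F) \<le> e" .
  qed
qed

text \<open>Chords of slope beyond \<open>K\<close>, of either sign, are dominated by increments of the variation function, so
  the Vitali bound gives a set of measure of order \<open>1 / K\<close>.\<close>

lemma negligible_infinitely_steep:
  assumes bv: "bounded_variation f u v" and uv: "u \<le> v"
  shows "negligible {x \<in> {u<..<v}. \<forall>K>0. steep_at f x K \<or> steep_at (\<lambda>t. - f t) x K}"
    (is "negligible ?E")
  unfolding negligible_outer_le
proof (intro allI impI)
  fix e :: real assume e: "0 < e"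
  define \<phi> where "\<phi> = variation f u"
  define K where "K = (\<phi> v - \<phi> u + 1) / e"
  have inc: "\<bar>f r - f l\<bar> \<le> \<phi> r - \<phi> l" if "u \<le> l" "l \<le> r" "r \<le> v" for l r
    unfolding \<phi>_def by (rule increment_le_variation_function[OF bv that])
  have tot: "0 \<le> \<phi> v - \<phi> u" using inc[of u v] uv by simp
  have K: "0 < K" using tot e by (simp add: K_def)
  have mono: "mono_on {u..v} \<phi>"
  proof (rule mono_onI)
    fix x y assume "x \<in> {u..v}" "y \<in> {u..v}" "x \<le> y"
    then show "\<phi> x \<le> \<phi> y" using inc[of x y] by simp
  qed
  have small: "\<exists>l r. l < r \<and> u \<le> l \<and> r \<le> v \<and> x \<in> {l..r} \<and> r - l < h \<and> K * (r - l) \<le> \<phi> r - \<phi> l"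
    if x: "x \<in> ?E" and h: "0 < h" for x h
  proof -
    have "steep_at f x K \<or> steep_at (\<lambda>t. - f t) x K" using x K by blast
    then obtain l r where lr: "l < r" "u \<le> l" "r \<le> v" "x \<in> {l..r}" "r - l < h" "K * (r - l) \<le> \<bar>f r - f l\<bar>"
    proof
      assume "steep_at f x K"
      from steep_at_inside[OF this, of u v h] x h that show ?thesis by fastforce
    next
      assume "steep_at (\<lambda>t. - f t) x K"
      from steep_at_inside[OF this, of u v h] x h that show ?thesis by fastforce
    qed
    then have "K * (r - l) \<le> \<phi> r - \<phi> l" using inc[of l r] by linarith
    then show ?thesis using lr by blast
  qed
  obtain T where T: "?E \<subseteq> T" "T \<in> lmeasurable" "measure lebesgue T \<le> (\<phi> v - \<phi> u) / K"
    by (rule Vitali_bound_by_monotone_increment[OF mono uv K small])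
  have "(\<phi> v - \<phi> u) / K \<le> e" using tot e by (simp add: K_def field_simps)
  then show "\<exists>T. ?E \<subseteq> T \<and> T \<in> lmeasurable \<and> measure lebesgue T \<le> e"
    using T by (intro exI[of _ T]) auto
qed

lemma bounded_variation_diff_linear:
  assumes "bounded_variation f u v"
  shows "bounded_variation (\<lambda>t. f t - m * t) u v"
proof -
  obtain B where B: "\<And>p. p \<in> partitions u v \<Longrightarrow> increment_sum f p \<le> B"
    using assms unfolding bounded_variation_def bdd_above_def by auto
  have "increment_sum (\<lambda>t. f t - m * t) p \<le> B + \<bar>m\<bar> * (v - u)" if p: "p \<in> partitions u v" for p
  proof -
    obtain n t where nt: "p = (n, t)" by (cases p)
    have "increment_sum (\<lambda>t. f t - m * t) p \<le> (\<Sum>i<n. \<bar>f (t (Suc i)) - f (t i)\<bar> + \<bar>m\<bar> * (t (Suc i) - t i))"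
      unfolding increment_sum_def nt prod.case
    proof (rule sum_mono)
      fix i assume "i \<in> {..<n}"
      then have "t i \<le> t (Suc i)" using p nt by (auto simp: partitions_def)
      then have "\<bar>m * (t (Suc i) - t i)\<bar> = \<bar>m\<bar> * (t (Suc i) - t i)" by (simp add: abs_mult)
      then show "\<bar>f (t (Suc i)) - m * t (Suc i) - (f (t i) - m * t i)\<bar>
          \<le> \<bar>f (t (Suc i)) - f (t i)\<bar> + \<bar>m\<bar> * (t (Suc i) - t i)"
        by (simp add: right_diff_distrib)
    qed
    also have "\<dots> = increment_sum f p + \<bar>m\<bar> * (t n - t 0)"
      using sum_lessThan_telescope[of t n]
      by (simp add: sum.distrib increment_sum_def nt sum_distrib_left[symmetric])
    also have "\<dots> \<le> B + \<bar>m\<bar> * (v - u)" using B[OF p] p by (simp add: nt partitions_def)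
    finally show ?thesis .
  qed
  then show ?thesis unfolding bounded_variation_def by (rule bdd_aboveI2)
qed

lemma steep_at_of_frequently:
  fixes f :: "real \<Rightarrow> real"
  assumes "\<exists>\<^sub>F y in at x. K \<le> (f y - f x) / (y - x)"
  shows "steep_at f x K"
  unfolding steep_at_def
proof (intro allI impI)
  fix d :: real assume d: "0 < d"
  have "\<forall>\<^sub>F y in at x. y \<noteq> x \<and> dist y x < d"
    using d by (auto simp: eventually_at)
  from frequently_ex[OF frequently_eventually_frequently[OF assms this]]
  obtain y where y: "K \<le> (f y - f x) / (y - x)" "y \<noteq> x" "\<bar>y - x\<bar> < d"
    by (auto simp: dist_real_def)
  show "\<exists>l r. l < r \<and> x \<in> {l..r} \<and> r - l < d \<and> K * (r - l) \<le> f r - f l"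
  proof (cases "x < y")
    case True
    then show ?thesis using y by (intro exI[of _ x] exI[of _ y]) (auto simp: field_simps)
  next
    case False
    then show ?thesis using y by (intro exI[of _ y] exI[of _ x]) (auto simp: field_simps)
  qed
qed

text \<open>If the lower and upper limit of the difference quotient differ, rational numbers \<open>p < q\<close> separate
  them, and after subtracting the linear function of slope \<open>(p + q) / 2\<close> there are steep chords in both
  directions. The bound \<open>K\<close> keeps the common limit finite.\<close>

lemma differentiable_of_not_steep:
  fixes f :: "real \<Rightarrow> real"
  assumes fin: "0 < K" "\<not> steep_at f x K" "\<not> steep_at (\<lambda>t. - f t) x K"
    and osc: "\<And>p q. p \<in> \<rat> \<Longrightarrow> q \<in> \<rat> \<Longrightarrow> p < q \<Longrightarrow>
      \<not> (steep_at (\<lambda>t. f t - (p + q) / 2 * t) x ((q - p) / 2) \<and>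
         steep_at (\<lambda>t. - (f t - (p + q) / 2 * t)) x ((q - p) / 2))"
  shows "\<exists>D. (f has_real_derivative D) (at x)"
proof -
  define g where "g y = (f y - f x) / (y - x)" for y
  have up: "steep_at (\<lambda>t. f t - m * t) x (k - m)" if "\<exists>\<^sub>F y in at x. k \<le> g y" for k m
  proof (rule steep_at_of_frequently)
    have "\<forall>\<^sub>F y in at x. y \<noteq> x" by (auto simp: eventually_at_filter)
    from frequently_eventually_frequently[OF that this]
    show "\<exists>\<^sub>F y in at x. k - m \<le> (f y - m * y - (f x - m * x)) / (y - x)"
    proof (rule frequently_elim1, elim conjE)
      fix y assume "y \<noteq> x" "k \<le> g y"
      then show "k - m \<le> (f y - m * y - (f x - m * x)) / (y - x)"
        by (cases "y > x") (auto simp: g_def field_simps)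
    qed
  qed
  have down: "steep_at (\<lambda>t. - (f t - m * t)) x (m - k)" if "\<exists>\<^sub>F y in at x. g y \<le> k" for k m
  proof (rule steep_at_of_frequently)
    have "\<forall>\<^sub>F y in at x. y \<noteq> x" by (auto simp: eventually_at_filter)
    from frequently_eventually_frequently[OF that this]
    show "\<exists>\<^sub>F y in at x. m - k \<le> (- (f y - m * y) - - (f x - m * x)) / (y - x)"
    proof (rule frequently_elim1, elim conjE)
      fix y assume "y \<noteq> x" "g y \<le> k"
      then show "m - k \<le> (- (f y - m * y) - - (f x - m * x)) / (y - x)"
        by (cases "y > x") (auto simp: g_def field_simps)
    qed
  qed
  have bdd: "\<forall>\<^sub>F y in at x. g y \<le> K" "\<forall>\<^sub>F y in at x. - K \<le> g y"
  proof -
    have "\<not> (\<exists>\<^sub>F y in at x. K \<le> g y)" using up[of K 0] fin by auto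
    then show "\<forall>\<^sub>F y in at x. g y \<le> K" unfolding not_frequently by eventually_elim auto
    have "\<not> (\<exists>\<^sub>F y in at x. g y \<le> - K)" using down[of "- K" 0] fin by auto
    then show "\<forall>\<^sub>F y in at x. - K \<le> g y" unfolding not_frequently by eventually_elim auto
  qed
  define L where "L = Liminf (at x) (\<lambda>y. ereal (g y))"
  define U where "U = Limsup (at x) (\<lambda>y. ereal (g y))"
  have "L \<le> U" unfolding L_def U_def by (rule Liminf_le_Limsup) auto
  have "\<not> L < U"
  proof
    assume "L < U"
    then obtain p' where p': "L < ereal p'" "ereal p' < U" using ereal_dense2 by blast
    obtain q' where q': "ereal p' < ereal q'" "ereal q' < U" using ereal_dense2[OF p'(2)] by blast
    have "p' < q'" using q' by simp
    obtain q where q: "q \<in> \<rat>" "p' < q" "q < q'" using Rats_dense_in_real[OF \<open>p' < q'\<close>] by auto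
    obtain p where p: "p \<in> \<rat>" "p' < p" "p < q" using Rats_dense_in_real[OF \<open>p' < q\<close>] by auto
    have Lp: "L < ereal p" by (rule less_trans[OF p'(1)]) (use p in simp)
    have Uq: "ereal q < U" by (rule less_trans[OF _ q'(2)]) (use q in simp)
    have below: "\<exists>\<^sub>F y in at x. g y \<le> p"
    proof (rule ccontr)
      assume "\<not> ?thesis"
      then have "\<forall>\<^sub>F y in at x. ereal p \<le> ereal (g y)" unfolding not_frequently by eventually_elim auto
      then have "ereal p \<le> L" unfolding L_def by (rule Liminf_bounded)
      then show False using Lp by simp
    qed
    have above: "\<exists>\<^sub>F y in at x. q \<le> g y"
    proof (rule ccontr)
      assume "\<not> ?thesis"
      then have "\<forall>\<^sub>F y in at x. ereal (g y) \<le> ereal q" unfolding not_frequently by eventually_elim auto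
      then have "U \<le> ereal q" unfolding U_def by (rule Limsup_bounded)
      then show False using Uq by simp
    qed
    have mid: "q - (p + q) / 2 = (q - p) / 2" "(p + q) / 2 - p = (q - p) / 2" by (auto simp: field_simps)
    have "steep_at (\<lambda>t. f t - (p + q) / 2 * t) x ((q - p) / 2)"
      using up[OF above, of "(p + q) / 2"] unfolding mid .
    moreover have "steep_at (\<lambda>t. - (f t - (p + q) / 2 * t)) x ((q - p) / 2)"
      using down[OF below, of "(p + q) / 2"] unfolding mid .
    ultimately show False using osc[OF p(1) q(1) p(3)] by blast
  qed
  then have LU: "L = U" using \<open>L \<le> U\<close> by auto
  have "L \<le> ereal K" unfolding LU U_def by (rule Limsup_bounded) (use bdd in auto)
  moreover have "ereal (- K) \<le> L" unfolding L_def
    by (rule Liminf_bounded) (use bdd(2) in \<open>auto elim: eventually_mono\<close>)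
  ultimately obtain D where D: "L = ereal D" by (cases L) auto
  have "((\<lambda>y. ereal (g y)) \<longlongrightarrow> ereal D) (at x)"
    using Liminf_eq_Limsup[of "at x" "\<lambda>y. ereal (g y)" "ereal D"] D LU L_def U_def by auto
  then have "(g \<longlongrightarrow> D) (at x)" by simp
  then show ?thesis unfolding has_field_derivative_iff g_def by blast
qed

lemma bounded_variation_ae_differentiable:
  fixes f :: "real \<Rightarrow> real"
  assumes bv: "bounded_variation f u v" and uv: "u \<le> v"
  shows "\<exists>N. negligible N \<and> (\<forall>x\<in>{u<..<v} - N. \<exists>D. (f has_real_derivative D) (at x))"
proof (rule exI, intro conjI ballI)
  define E where "E = {x \<in> {u<..<v}. \<forall>K>0. steep_at f x K \<or> steep_at (\<lambda>t. - f t) x K}"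
  define F where "F = (\<lambda>(p, q). {x \<in> {u<..<v}. steep_at (\<lambda>t. f t - (p + q) / 2 * t) x ((q - p) / 2) \<and>
         steep_at (\<lambda>t. - (f t - (p + q) / 2 * t)) x ((q - p) / 2)})"
  define PQ where "PQ = {(p, q). p \<in> \<rat> \<and> q \<in> \<rat> \<and> p < (q :: real)}"
  let ?N = "E \<union> (\<Union>pq\<in>PQ. F pq)"
  have "countable PQ"
    by (rule countable_subset[of _ "\<rat> \<times> \<rat>"]) (auto simp: PQ_def countable_rat)
  moreover have "negligible (F pq)" if "pq \<in> PQ" for pq
  proof -
    obtain p q where pq: "pq = (p, q)" "p < q" using \<open>pq \<in> PQ\<close> by (auto simp: PQ_def)
    show ?thesis unfolding pq F_def prod.case
      by (rule negligible_steep_in_both_directions[OF bounded_variation_diff_linear[OF bv] uv]) (use pq in simp)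
  qed
  moreover have "negligible E" unfolding E_def by (rule negligible_infinitely_steep[OF bv uv])
  ultimately show "negligible ?N"
    by (intro negligible_Un negligible_countable_Union) auto
  fix x assume x: "x \<in> {u<..<v} - ?N"
  then obtain K where K: "0 < K" "\<not> steep_at f x K" "\<not> steep_at (\<lambda>t. - f t) x K"
    by (auto simp: E_def)
  show "\<exists>D. (f has_real_derivative D) (at x)"
  proof (rule differentiable_of_not_steep[OF K])
    fix p q :: real assume "p \<in> \<rat>" "q \<in> \<rat>" "p < q"
    then have "(p, q) \<in> PQ" by (simp add: PQ_def)
    then have "x \<notin> F (p, q)" using x by blast
    then show "\<not> (steep_at (\<lambda>t. f t - (p + q) / 2 * t) x ((q - p) / 2) \<and>
         steep_at (\<lambda>t. - (f t - (p + q) / 2 * t)) x ((q - p) / 2))"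
      using x unfolding F_def by simp
  qed
qed

lemma absolutely_continuous_onE:
  assumes "absolutely_continuous_on a b h" "0 < e"
  obtains \<delta> where "0 < \<delta>" "\<And>n x y. \<forall>i<n. a \<le> x i \<and> x i \<le> y i \<and> y i \<le> b \<Longrightarrow>
      disjoint_family_on (\<lambda>i. {x i<..<y i}) {..<n::nat} \<Longrightarrow> (\<Sum>i<n. y i - x i) < \<delta> \<Longrightarrow>
      (\<Sum>i<n. \<bar>h (y i) - h (x i)\<bar>) < e"
proof -
  obtain \<delta> where "0 < \<delta>" and \<delta>: "\<forall>(n::nat) x y. (\<forall>i<n. a \<le> x i \<and> x i \<le> y i \<and> y i \<le> b) \<and>
      disjoint_family_on (\<lambda>i. {x i<..<y i}) {..<n} \<and> (\<Sum>i<n. y i - x i) < \<delta> \<longrightarrow>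
      (\<Sum>i<n. \<bar>h (y i) - h (x i)\<bar>) < e"
    using assms unfolding absolutely_continuous_on_def by auto
  show ?thesis by (rule that[OF \<open>0 < \<delta>\<close>]) (use \<delta> in simp)
qed

text \<open>The bound for \<open>\<epsilon> = 1\<close> controls the variation on every short interval, which is enough because
  differentiability is local.\<close>

lemma absolutely_continuous_on_locally_bounded_variation:
  assumes ac: "absolutely_continuous_on a b h"
  shows "\<exists>\<delta>>0. \<forall>u v. a \<le> u \<and> v \<le> b \<and> v - u < \<delta> \<longrightarrow> bounded_variation h u v"
proof -
  obtain \<delta> where \<delta>: "0 < \<delta>" "\<And>n x y. \<forall>i<n. a \<le> x i \<and> x i \<le> y i \<and> y i \<le> b \<Longrightarrow>
      disjoint_family_on (\<lambda>i. {x i<..<y i}) {..<n::nat} \<Longrightarrow> (\<Sum>i<n. y i - x i) < \<delta> \<Longrightarrow>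
      (\<Sum>i<n. \<bar>h (y i) - h (x i)\<bar>) < 1"
    by (rule absolutely_continuous_onE[OF ac zero_less_one]) blast
  have "bounded_variation h u v" if uv: "a \<le> u" "v \<le> b" "v - u < \<delta>" for u v
    unfolding bounded_variation_def
  proof (rule bdd_aboveI2)
    fix p assume p: "p \<in> partitions u v"
    obtain n t where nt: "p = (n, t)" by (cases p)
    note mono = partition_mono[OF p[unfolded nt]]
    have ends: "t 0 = u" "t n = v" using p nt by (auto simp: partitions_def)
    have "(\<Sum>i<n. \<bar>h (t (Suc i)) - h (t i)\<bar>) < 1"
    proof (rule \<delta>(2))
      show "\<forall>i<n. a \<le> t i \<and> t i \<le> t (Suc i) \<and> t (Suc i) \<le> b"
      proof (intro allI impI)
        fix i assume "i < n"
        then show "a \<le> t i \<and> t i \<le> t (Suc i) \<and> t (Suc i) \<le> b"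
          using mono[of 0 i] mono[of i "Suc i"] mono[of "Suc i" n] uv ends by auto
      qed
      have dis: "{t i<..<t (Suc i)} \<inter> {t j<..<t (Suc j)} = {}" if "i < j" "j < n" for i j
        using mono[of "Suc i" j] that by auto
      show "disjoint_family_on (\<lambda>i. {t i<..<t (Suc i)}) {..<n}"
        unfolding disjoint_family_on_def
      proof (intro ballI impI)
        fix i j assume "i \<in> {..<n}" "j \<in> {..<n}" "i \<noteq> j"
        then show "{t i<..<t (Suc i)} \<inter> {t j<..<t (Suc j)} = {}"
          using dis[of i j] dis[of j i] by (cases "i < j") auto
      qed
      show "(\<Sum>i<n. t (Suc i) - t i) < \<delta>" using sum_lessThan_telescope[of t n] ends uv by simp
    qed
    then show "increment_sum h p \<le> 1" by (simp add: increment_sum_def nt)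
  qed
  then show ?thesis using \<delta>(1) by blast
qed

lemma absolutely_continuous_on_imp_continuous_on:
  assumes ac: "absolutely_continuous_on a b h"
  shows "continuous_on {a..b} h"
  unfolding continuous_on_iff
proof (intro ballI allI impI)
  fix x and e :: real assume x: "x \<in> {a..b}" and e: "0 < e"
  obtain \<delta> where \<delta>: "0 < \<delta>" "\<And>n x y. \<forall>i<n. a \<le> x i \<and> x i \<le> y i \<and> y i \<le> b \<Longrightarrow>
      disjoint_family_on (\<lambda>i. {x i<..<y i}) {..<n::nat} \<Longrightarrow> (\<Sum>i<n. y i - x i) < \<delta> \<Longrightarrow>
      (\<Sum>i<n. \<bar>h (y i) - h (x i)\<bar>) < e"
    by (rule absolutely_continuous_onE[OF ac e]) blast
  have *: "\<bar>h q - h p\<bar> < e" if "a \<le> p" "p \<le> q" "q \<le> b" "q - p < \<delta>" for p q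
    using \<delta>(2)[of 1 "\<lambda>_. p" "\<lambda>_. q"] that by (auto simp: disjoint_family_on_def)
  show "\<exists>d>0. \<forall>x'\<in>{a..b}. dist x' x < d \<longrightarrow> dist (h x') (h x) < e"
  proof (intro exI conjI ballI impI)
    fix y assume y: "y \<in> {a..b}" "dist y x < \<delta>"
    show "dist (h y) (h x) < e"
      using *[of x y] *[of y x] x y by (cases "x \<le> y") (auto simp: dist_real_def)
  qed fact
qed

lemma absolutely_continuous_on_ae_differentiable:
  assumes ac: "absolutely_continuous_on a b h"
  shows "\<exists>N. negligible N \<and> (\<forall>x\<in>{a<..<b} - N. \<exists>D. (h has_real_derivative D) (at x))"
proof -
  obtain \<delta> where \<delta>: "0 < \<delta>" "\<And>u v. a \<le> u \<Longrightarrow> v \<le> b \<Longrightarrow> v - u < \<delta> \<Longrightarrow> bounded_variation h u v"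
    using absolutely_continuous_on_locally_bounded_variation[OF ac] by blast
  define PQ where "PQ = {(p, q). p \<in> \<rat> \<and> q \<in> \<rat> \<and> p \<le> (q :: real) \<and> a \<le> p \<and> q \<le> b \<and> q - p < \<delta>}"
  have "countable PQ"
    by (rule countable_subset[of _ "\<rat> \<times> \<rat>"]) (auto simp: PQ_def countable_rat)
  have "\<forall>pq. \<exists>N. pq \<in> PQ \<longrightarrow>
      negligible N \<and> (\<forall>x\<in>{fst pq<..<snd pq} - N. \<exists>D. (h has_real_derivative D) (at x))"
    using bounded_variation_ae_differentiable \<delta>(2) by (fastforce simp: PQ_def)
  from choice[OF this] obtain N where N: "\<And>pq. pq \<in> PQ \<Longrightarrow> negligible (N pq)"
    "\<And>pq x. pq \<in> PQ \<Longrightarrow> x \<in> {fst pq<..<snd pq} - N pq \<Longrightarrow> \<exists>D. (h has_real_derivative D) (at x)"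
    by blast
  show ?thesis
  proof (rule exI, intro conjI ballI)
    show "negligible (\<Union>pq\<in>PQ. N pq)"
      using N(1) \<open>countable PQ\<close> by (intro negligible_countable_Union) auto
    fix x assume x: "x \<in> {a<..<b} - (\<Union>pq\<in>PQ. N pq)"
    have "max a (x - \<delta> / 2) < x" "x < min b (x + \<delta> / 2)" using x \<delta>(1) by auto
    then obtain p q where pq: "p \<in> \<rat>" "q \<in> \<rat>" "max a (x - \<delta> / 2) < p" "p < x" "x < q" "q < min b (x + \<delta> / 2)"
      using Rats_dense_in_real by metis
    then have "(p, q) \<in> PQ" by (auto simp: PQ_def)
    then show "\<exists>D. (h has_real_derivative D) (at x)"
      using N(2)[of "(p, q)" x] pq x by auto
  qed
qed

text \<open>The derivative is a limit of difference quotients. Extending \<open>h\<close> by its boundary values makes these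
  measurable on the whole line, and setting \<open>u\<close> to \<open>0\<close> off the set of differentiability makes the limit
  exist everywhere.\<close>

lemma absolutely_continuous_on_measurable_derivative:
  assumes ac: "absolutely_continuous_on a b h"
  obtains N u where "negligible N" "u \<in> borel_measurable lebesgue"
    "\<And>t. t \<in> {a<..<b} - N \<Longrightarrow> (h has_real_derivative u t) (at t)"
proof -
  obtain N where N: "negligible N" "\<And>x. x \<in> {a<..<b} - N \<Longrightarrow> \<exists>D. (h has_real_derivative D) (at x)"
    using absolutely_continuous_on_ae_differentiable[OF ac] by blast
  define S where "S = {a<..<b} - N"
  define u where "u t = (if t \<in> S then deriv h t else 0)" for t
  have der: "(h has_real_derivative u t) (at t)" if "t \<in> S" for t
    using N(2)[of t] that by (auto simp: S_def u_def DERIV_imp_deriv)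
  define H where "H t = h (max a (min b t))" for t
  define v where "v n t = indicator S t * ((H (t + 1 / real (Suc n)) - H t) * real (Suc n))" for n t
  have S: "S \<in> sets lebesgue"
    unfolding S_def using N(1) by (intro sets.Diff) (auto simp: negligible_iff_null_sets)
  have "continuous_on UNIV H" if "a \<le> b"
    unfolding H_def using that
    by (intro continuous_on_compose2[OF absolutely_continuous_on_imp_continuous_on[OF ac]] continuous_intros) auto
  moreover have "continuous_on UNIV H" if "\<not> a \<le> b"
    using that by (simp add: H_def)
  ultimately have "H \<in> borel_measurable borel" by (intro borel_measurable_continuous_onI) blast
  then have [measurable]: "H \<in> borel_measurable borel" .
  have vm: "v n \<in> borel_measurable lebesgue" for n
    unfolding v_def
  proof (rule borel_measurable_times)
    have "(\<lambda>t. (H (t + 1 / real (Suc n)) - H t) * real (Suc n)) \<in> borel_measurable lborel" by measurable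
    then show "(\<lambda>t. (H (t + 1 / real (Suc n)) - H t) * real (Suc n)) \<in> borel_measurable lebesgue"
      by (rule measurable_completion)
  qed (use S in simp)
  have "(\<lambda>n. v n t) \<longlonglongrightarrow> u t" for t
  proof (cases "t \<in> S")
    case False
    then show ?thesis by (simp add: v_def u_def)
  next
    case True
    have "((\<lambda>k. (h (t + k) - h t) / k) \<longlongrightarrow> u t) (at 0)" using der[OF True] by (simp add: DERIV_def)
    moreover have "filterlim (\<lambda>n. 1 / real (Suc n)) (at 0) sequentially"
      unfolding filterlim_at using LIMSEQ_Suc[OF lim_1_over_n] by auto
    ultimately have lim: "(\<lambda>n. (h (t + 1 / real (Suc n)) - h t) / (1 / real (Suc n))) \<longlonglongrightarrow> u t"
      by (rule filterlim_compose)
    have tab: "a < t" "t < b" using True by (auto simp: S_def)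
    have "(\<lambda>n. t + 1 / real (Suc n)) \<longlonglongrightarrow> t + 0"
      using LIMSEQ_Suc[OF lim_1_over_n[where 'a = real]] by (intro tendsto_add) auto
    then have "\<forall>\<^sub>F n in sequentially. t + 1 / real (Suc n) < b"
      using tab by (intro order_tendstoD) auto
    then have "\<forall>\<^sub>F n in sequentially. (h (t + 1 / real (Suc n)) - h t) / (1 / real (Suc n)) = v n t"
    proof eventually_elim
      case (elim n)
      have "0 < 1 / real (Suc n)" by simp
      then have "a < t + 1 / real (Suc n)" using tab by linarith
      then show ?case using elim tab True by (simp add: v_def H_def)
    qed
    then show ?thesis using lim by (rule Lim_transform_eventually[rotated])
  qed
  then have "u \<in> borel_measurable lebesgue"
    by (rule borel_measurable_LIMSEQ_real[OF _ vm])
  then show ?thesis using N(1) der that by (auto simp: S_def)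
qed

section \<open>Strings of finite energy\<close>

lemma absolutely_continuous_onI:
  assumes "\<And>e. 0 < e \<Longrightarrow> \<exists>\<delta>>0. \<forall>(n::nat) x y. (\<forall>i<n. a \<le> x i \<and> x i \<le> y i \<and> y i \<le> b) \<longrightarrow>
      disjoint_family_on (\<lambda>i. {x i<..<y i}) {..<n} \<longrightarrow> (\<Sum>i<n. y i - x i) < \<delta> \<longrightarrow>
      (\<Sum>i<n. \<bar>h (y i) - h (x i)\<bar>) < e"
  shows "absolutely_continuous_on a b h"
  unfolding absolutely_continuous_on_def
proof (intro allI impI)
  fix e :: real assume "0 < e"
  from assms[OF this] show "\<exists>\<delta>>0. \<forall>(n::nat) x y. (\<forall>i<n. a \<le> x i \<and> x i \<le> y i \<and> y i \<le> b) \<and>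
      disjoint_family_on (\<lambda>i. {x i<..<y i}) {..<n} \<and> (\<Sum>i<n. y i - x i) < \<delta> \<longrightarrow>
      (\<Sum>i<n. \<bar>h (y i) - h (x i)\<bar>) < e"
    by (simp only: imp_conjL)
qed

lemma absolutely_continuous_on_const: "absolutely_continuous_on a b (\<lambda>_. c)"
  by (rule absolutely_continuous_onI) (auto intro: exI[of _ 1])

text \<open>A single source for the closure of absolute continuity under translation, Lipschitz perturbation, gluing and mixing:
  only the increments of the new function have to be estimated.\<close>

lemma absolutely_continuous_on_dominated:
  assumes h: "absolutely_continuous_on a b h" and g: "absolutely_continuous_on a b g" and K: "0 \<le> K"
    and m: "\<And>x y. a \<le> x \<Longrightarrow> x \<le> y \<Longrightarrow> y \<le> b \<Longrightarrow>
      \<bar>m y - m x\<bar> \<le> K * (\<bar>h y - h x\<bar> + \<bar>g y - g x\<bar> + (y - x))"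
  shows "absolutely_continuous_on a b m"
proof (rule absolutely_continuous_onI)
  fix e :: real assume e: "0 < e"
  define e' where "e' = e / (K + 1) / 3"
  have e': "0 < e'" using e K by (simp add: e'_def)
  obtain d1 where d1: "0 < d1" "\<And>n x y. \<forall>i<n. a \<le> x i \<and> x i \<le> y i \<and> y i \<le> b \<Longrightarrow>
      disjoint_family_on (\<lambda>i. {x i<..<y i}) {..<n::nat} \<Longrightarrow> (\<Sum>i<n. y i - x i) < d1 \<Longrightarrow>
      (\<Sum>i<n. \<bar>h (y i) - h (x i)\<bar>) < e'"
    by (rule absolutely_continuous_onE[OF h e']) blast
  obtain d2 where d2: "0 < d2" "\<And>n x y. \<forall>i<n. a \<le> x i \<and> x i \<le> y i \<and> y i \<le> b \<Longrightarrow>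
      disjoint_family_on (\<lambda>i. {x i<..<y i}) {..<n::nat} \<Longrightarrow> (\<Sum>i<n. y i - x i) < d2 \<Longrightarrow>
      (\<Sum>i<n. \<bar>g (y i) - g (x i)\<bar>) < e'"
    by (rule absolutely_continuous_onE[OF g e']) blast
  have "(\<Sum>i<n. \<bar>m (y i) - m (x i)\<bar>) < e"
    if xy: "\<forall>i<n. a \<le> x i \<and> x i \<le> y i \<and> y i \<le> b"
      and dis: "disjoint_family_on (\<lambda>i. {x i<..<y i}) {..<n}"
      and small: "(\<Sum>i<n. y i - x i) < min e' (min d1 d2)" for n :: nat and x y
  proof -
    have "(\<Sum>i<n. \<bar>m (y i) - m (x i)\<bar>)
        \<le> (\<Sum>i<n. K * (\<bar>h (y i) - h (x i)\<bar> + \<bar>g (y i) - g (x i)\<bar> + (y i - x i)))"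
      by (rule sum_mono) (use m xy in auto)
    also have "\<dots> = K * ((\<Sum>i<n. \<bar>h (y i) - h (x i)\<bar>) + (\<Sum>i<n. \<bar>g (y i) - g (x i)\<bar>) + (\<Sum>i<n. y i - x i))"
      by (simp add: sum_distrib_left[symmetric] sum.distrib)
    also have "\<dots> \<le> K * (e' + e' + e')"
      using d1(2)[OF xy dis] d2(2)[OF xy dis] small K by (intro mult_left_mono add_mono) auto
    also have "\<dots> < e' * 3 * (K + 1)" using e' by (simp add: algebra_simps)
    also have "\<dots> = e" using K by (simp add: e'_def field_simps)
    finally show ?thesis .
  qed
  then show "\<exists>\<delta>>0. \<forall>(n::nat) x y. (\<forall>i<n. a \<le> x i \<and> x i \<le> y i \<and> y i \<le> b) \<longrightarrow>
      disjoint_family_on (\<lambda>i. {x i<..<y i}) {..<n} \<longrightarrow> (\<Sum>i<n. y i - x i) < \<delta> \<longrightarrow>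
      (\<Sum>i<n. \<bar>m (y i) - m (x i)\<bar>) < e"
    using e' d1(1) d2(1) by (intro exI[of _ "min e' (min d1 d2)"]) simp
qed

text \<open>The map \<open>\<tau>\<close> is monotone and expands no distance, so it sends disjoint intervals to disjoint intervals
  that are no longer. Translations, restrictions and extensions by boundary values are of this form.\<close>

lemma absolutely_continuous_on_reparametrize:
  assumes h: "absolutely_continuous_on lo hi h"
    and \<tau>: "\<And>x. a \<le> x \<Longrightarrow> x \<le> b \<Longrightarrow> lo \<le> \<tau> x \<and> \<tau> x \<le> hi"
    and mono: "\<And>x y. a \<le> x \<Longrightarrow> x \<le> y \<Longrightarrow> y \<le> b \<Longrightarrow> \<tau> x \<le> \<tau> y \<and> \<tau> y - \<tau> x \<le> y - x"
  shows "absolutely_continuous_on a b (\<lambda>t. h (\<tau> t))"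
proof (rule absolutely_continuous_onI)
  fix e :: real assume e: "0 < e"
  obtain d where d: "0 < d" "\<And>n x y. \<forall>i<n. lo \<le> x i \<and> x i \<le> y i \<and> y i \<le> hi \<Longrightarrow>
      disjoint_family_on (\<lambda>i. {x i<..<y i}) {..<n::nat} \<Longrightarrow> (\<Sum>i<n. y i - x i) < d \<Longrightarrow>
      (\<Sum>i<n. \<bar>h (y i) - h (x i)\<bar>) < e"
    by (rule absolutely_continuous_onE[OF h e]) blast
  have "(\<Sum>i<n. \<bar>h (\<tau> (y i)) - h (\<tau> (x i))\<bar>) < e"
    if xy: "\<forall>i<n. a \<le> x i \<and> x i \<le> y i \<and> y i \<le> b"
      and dis: "disjoint_family_on (\<lambda>i. {x i<..<y i}) {..<n}"
      and small: "(\<Sum>i<n. y i - x i) < d" for n :: nat and x y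
  proof (rule d(2)[of n "\<lambda>i. \<tau> (x i)" "\<lambda>i. \<tau> (y i)"])
    show "\<forall>i<n. lo \<le> \<tau> (x i) \<and> \<tau> (x i) \<le> \<tau> (y i) \<and> \<tau> (y i) \<le> hi"
      using xy \<tau> mono by (meson order_trans)
    have "(\<Sum>i<n. \<tau> (y i) - \<tau> (x i)) \<le> (\<Sum>i<n. y i - x i)"
      by (rule sum_mono) (use xy mono in auto)
    then show "(\<Sum>i<n. \<tau> (y i) - \<tau> (x i)) < d" using small by simp
    \<comment> \<open>Two overlapping open intervals overlap in one whose endpoints are endpoints of theirs.\<close>
    show "disjoint_family_on (\<lambda>i. {\<tau> (x i)<..<\<tau> (y i)}) {..<n}"
      unfolding disjoint_family_on_def
    proof (intro ballI impI)
      fix i j assume ij: "i \<in> {..<n}" "j \<in> {..<n}" "i \<noteq> j"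
      then have "{x i<..<y i} \<inter> {x j<..<y j} = {}" using dis by (auto simp: disjoint_family_on_def)
      then have "{max (x i) (x j)<..<min (y i) (y j)} = {}" by auto
      then have "min (y i) (y j) \<le> max (x i) (x j)" by (simp add: greaterThanLessThan_empty_iff)
      moreover have "a \<le> x i" "x i \<le> y i" "y i \<le> b" "a \<le> x j" "x j \<le> y j" "y j \<le> b" using xy ij by auto
      ultimately have "y i \<le> x i \<or> y i \<le> x j \<or> y j \<le> x i \<or> y j \<le> x j" by linarith
      then have "\<tau> (y i) \<le> \<tau> (x i) \<or> \<tau> (y i) \<le> \<tau> (x j) \<or> \<tau> (y j) \<le> \<tau> (x i) \<or> \<tau> (y j) \<le> \<tau> (x j)"
        using mono \<open>a \<le> x i\<close> \<open>x i \<le> y i\<close> \<open>y i \<le> b\<close> \<open>a \<le> x j\<close> \<open>x j \<le> y j\<close> \<open>y j \<le> b\<close>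
        by (meson order_trans)
      then show "{\<tau> (x i)<..<\<tau> (y i)} \<inter> {\<tau> (x j)<..<\<tau> (y j)} = {}" by auto
    qed
  qed
  then show "\<exists>\<delta>>0. \<forall>(n::nat) x y. (\<forall>i<n. a \<le> x i \<and> x i \<le> y i \<and> y i \<le> b) \<longrightarrow>
      disjoint_family_on (\<lambda>i. {x i<..<y i}) {..<n} \<longrightarrow> (\<Sum>i<n. y i - x i) < \<delta> \<longrightarrow>
      (\<Sum>i<n. \<bar>h (\<tau> (y i)) - h (\<tau> (x i))\<bar>) < e"
    using d(1) by blast
qed

lemma absolutely_continuous_on_subinterval:
  assumes "absolutely_continuous_on a b h" "a \<le> c" "d \<le> b"
  shows "absolutely_continuous_on c d h"
  using absolutely_continuous_on_reparametrize[OF assms(1), of c d "\<lambda>t. t"] assms by simp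

lemma absolutely_continuous_on_glue:
  assumes h: "absolutely_continuous_on a c h" and g: "absolutely_continuous_on c b g"
    and eq: "h c = g c" and ac: "a \<le> c" "c \<le> b"
  shows "absolutely_continuous_on a b (\<lambda>t. if t \<le> c then h t else g t)"
proof (rule absolutely_continuous_on_dominated)
  show "absolutely_continuous_on a b (\<lambda>t. h (min t c))"
    by (rule absolutely_continuous_on_reparametrize[OF h]) (use ac in auto)
  show "absolutely_continuous_on a b (\<lambda>t. g (max t c))"
    by (rule absolutely_continuous_on_reparametrize[OF g]) (use ac in auto)
  fix x y assume xy: "a \<le> x" "x \<le> y" "y \<le> b"
  consider "y \<le> c" | "x \<le> c" "c < y" | "c < x" using xy by linarith
  then show "\<bar>(if y \<le> c then h y else g y) - (if x \<le> c then h x else g x)\<bar>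
      \<le> 1 * (\<bar>h (min y c) - h (min x c)\<bar> + \<bar>g (max y c) - g (max x c)\<bar> + (y - x))"
  proof cases
    case 1
    then show ?thesis using xy by (simp add: min_def)
  next
    case 2
    then have "g y - h x = (g y - g c) + (h c - h x)" using eq by simp
    then show ?thesis using 2 xy by (simp add: min_def max_def)
  next
    case 3
    then show ?thesis using xy by (simp add: max_def)
  qed
qed simp

text \<open>The derivative is represented by an everywhere defined measurable function \<open>u\<close>, so that sums of derivatives
  can be formed without regard to points of non-differentiability. Derivatives are required at
  interior points, where they depend on the values of \<open>h\<close> in \<open>[a, b]\<close> alone.\<close>

definition has_energy :: "real \<Rightarrow> real \<Rightarrow> (real \<Rightarrow> real) \<Rightarrow> real \<Rightarrow> bool" where
  "has_energy a b h e \<longleftrightarrow> absolutely_continuous_on a b h \<and>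
    (\<exists>u N. u \<in> borel_measurable lebesgue \<and> negligible N \<and>
       (\<forall>t\<in>{a<..<b} - N. (h has_real_derivative u t) (at t)) \<and>
       ((\<lambda>t. (u t)\<^sup>2) has_integral e) {a..b})"

lemma has_energyI:
  assumes "absolutely_continuous_on a b h" "u \<in> borel_measurable lebesgue" "negligible N"
    and "\<And>t. t \<in> {a<..<b} - N \<Longrightarrow> (h has_real_derivative u t) (at t)"
    and "((\<lambda>t. (u t)\<^sup>2) has_integral e) {a..b}"
  shows "has_energy a b h e"
  using assms unfolding has_energy_def by blast

lemma has_energyE:
  assumes "has_energy a b h e"
  obtains u N where "absolutely_continuous_on a b h" "u \<in> borel_measurable lebesgue" "negligible N"
    "\<And>t. t \<in> {a<..<b} - N \<Longrightarrow> (h has_real_derivative u t) (at t)"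
    "((\<lambda>t. (u t)\<^sup>2) has_integral e) {a..b}"
  using assms unfolding has_energy_def by blast

lemma has_energy_nonneg: "has_energy a b h e \<Longrightarrow> 0 \<le> e"
  by (erule has_energyE, rule has_integral_nonneg) auto


lemma has_energy_split:
  assumes h: "has_energy a b h e" and c: "a \<le> c" "c \<le> b"
  obtains e1 e2 where "has_energy a c h e1" "has_energy c b h e2" "e = e1 + e2"
proof -
  obtain u N where u: "absolutely_continuous_on a b h" "u \<in> borel_measurable lebesgue" "negligible N"
    "\<And>t. t \<in> {a<..<b} - N \<Longrightarrow> (h has_real_derivative u t) (at t)"
    "((\<lambda>t. (u t)\<^sup>2) has_integral e) {a..b}" by (rule has_energyE[OF h]) (rule that)
  have int: "(\<lambda>t. (u t)\<^sup>2) integrable_on {a..b}" using u(5) by auto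
  have ac: "((\<lambda>t. (u t)\<^sup>2) has_integral integral {a..c} (\<lambda>t. (u t)\<^sup>2)) {a..c}"
    and cb: "((\<lambda>t. (u t)\<^sup>2) has_integral integral {c..b} (\<lambda>t. (u t)\<^sup>2)) {c..b}"
    using integrable_subinterval_real[OF int] c by auto
  show ?thesis
  proof
    show "has_energy a c h (integral {a..c} (\<lambda>t. (u t)\<^sup>2))"
      by (rule has_energyI[OF absolutely_continuous_on_subinterval[OF u(1)] u(2,3) _ ac]) (use c u(4) in auto)
    show "has_energy c b h (integral {c..b} (\<lambda>t. (u t)\<^sup>2))"
      by (rule has_energyI[OF absolutely_continuous_on_subinterval[OF u(1)] u(2,3) _ cb]) (use c u(4) in auto)
    show "e = integral {a..c} (\<lambda>t. (u t)\<^sup>2) + integral {c..b} (\<lambda>t. (u t)\<^sup>2)"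
      using Henstock_Kurzweil_Integration.integral_combine[OF c int] u(5) by (simp add: integral_unique)
  qed
qed

lemma has_energy_glue:
  assumes h: "has_energy a c h e1" and g: "has_energy c b g e2" and eq: "h c = g c" and c: "a \<le> c" "c \<le> b"
  shows "has_energy a b (\<lambda>t. if t \<le> c then h t else g t) (e1 + e2)"
proof -
  obtain u N where u: "absolutely_continuous_on a c h" "u \<in> borel_measurable lebesgue" "negligible N"
    "\<And>t. t \<in> {a<..<c} - N \<Longrightarrow> (h has_real_derivative u t) (at t)"
    "((\<lambda>t. (u t)\<^sup>2) has_integral e1) {a..c}" by (rule has_energyE[OF h]) (rule that)
  obtain v N' where v: "absolutely_continuous_on c b g" "v \<in> borel_measurable lebesgue" "negligible N'"
    "\<And>t. t \<in> {c<..<b} - N' \<Longrightarrow> (g has_real_derivative v t) (at t)"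
    "((\<lambda>t. (v t)\<^sup>2) has_integral e2) {c..b}" by (rule has_energyE[OF g]) (rule that)
  let ?u = "\<lambda>t. if t \<le> c then u t else v t"
  show ?thesis
  proof (rule has_energyI[where u = ?u and N = "insert c (N \<union> N')"])
    show "absolutely_continuous_on a b (\<lambda>t. if t \<le> c then h t else g t)"
      by (rule absolutely_continuous_on_glue[OF u(1) v(1) eq c])
    show "?u \<in> borel_measurable lebesgue"
      by (rule measurable_If[OF u(2) v(2)]) (auto simp: Collect_mono_iff lessThan_def[symmetric] atMost_def[symmetric])
    show "negligible (insert c (N \<union> N'))" using u(3) v(3) by simp
    fix t assume t: "t \<in> {a<..<b} - insert c (N \<union> N')"
    show "((\<lambda>t. if t \<le> c then h t else g t) has_real_derivative ?u t) (at t)"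
    proof (cases "t < c")
      case True
      then have "(h has_real_derivative u t) (at t)" using u(4) t by auto
      then have "((\<lambda>t. if t \<le> c then h t else g t) has_real_derivative u t) (at t)"
        by (rule has_field_derivative_transform_within_open[where S = "{..<c}"]) (use True in auto)
      then show ?thesis using True by simp
    next
      case False
      then have ct: "c < t" and "(g has_real_derivative v t) (at t)" using v(4) t by auto
      from this(2) have "((\<lambda>t. if t \<le> c then h t else g t) has_real_derivative v t) (at t)"
        by (rule has_field_derivative_transform_within_open[where S = "{c<..}"]) (use ct in auto)
      then show ?thesis using ct by simp
    qed
  next
    have "((\<lambda>t. (?u t)\<^sup>2) has_integral e1) {a..c}"
      by (rule has_integral_eq[OF _ u(5)]) auto
    moreover have "((\<lambda>t. (?u t)\<^sup>2) has_integral e2) {c..b}"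
      by (rule has_integral_spike[OF negligible_sing[of c] _ v(5)]) auto
    ultimately show "((\<lambda>t. (?u t)\<^sup>2) has_integral e1 + e2) {a..b}"
      using c by (intro has_integral_combine)
  qed
qed

lemma has_energy_shift:
  assumes h: "has_energy a b h e"
  shows "has_energy (a + s) (b + s) (\<lambda>t. h (t - s) + k) e"
proof -
  obtain u N where u: "absolutely_continuous_on a b h" "u \<in> borel_measurable lebesgue" "negligible N"
    "\<And>t. t \<in> {a<..<b} - N \<Longrightarrow> (h has_real_derivative u t) (at t)"
    "((\<lambda>t. (u t)\<^sup>2) has_integral e) {a..b}" by (rule has_energyE[OF h]) (rule that)
  show ?thesis
  proof (rule has_energyI[where u = "\<lambda>t. u (t - s)" and N = "(+) s ` N"])
    have "absolutely_continuous_on (a + s) (b + s) (\<lambda>t. h (t - s))"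
      by (rule absolutely_continuous_on_reparametrize[OF u(1)]) auto
    then show "absolutely_continuous_on (a + s) (b + s) (\<lambda>t. h (t - s) + k)"
      by (rule absolutely_continuous_on_dominated[OF _ absolutely_continuous_on_const[of _ _ 0], of _ _ _ 1]) auto
    have "(\<lambda>t. - s + t) \<in> lebesgue \<rightarrow>\<^sub>M lebesgue"
      using lebesgue_affine_measurable[of "\<lambda>_. 1" "- s"] by (simp add: euclidean_representation)
    from measurable_compose[OF this u(2)]
    show "(\<lambda>t. u (t - s)) \<in> borel_measurable lebesgue" by simp
    show "negligible ((+) s ` N)" using u(3) by (rule negligible_translation)
    fix t assume t: "t \<in> {a + s<..<b + s} - (+) s ` N"
    have "t - s \<notin> N"
    proof
      assume "t - s \<in> N"
      then have "s + (t - s) \<in> (+) s ` N" by (rule imageI)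
      then show False using t by simp
    qed
    then have "(h has_real_derivative u (t - s)) (at (t - s))" using u(4) t by auto
    then have "((\<lambda>t. h (t - s)) has_real_derivative u (t - s) * 1) (at t)"
      by (intro DERIV_chain2[where f = h and g = "\<lambda>t. t - s"]) (auto intro!: derivative_eq_intros)
    then show "((\<lambda>t. h (t - s) + k) has_real_derivative u (t - s)) (at t)"
      by (auto intro!: derivative_eq_intros)
  next
    have "((\<lambda>x. (u (1 * x + - s))\<^sup>2) has_integral e) {a + s..b + s}"
      using has_integral_affinity[OF u(5)[folded cbox_interval], of 1 "- s"]
      by (simp add: image_affinity_interval add.commute)
    then show "((\<lambda>t. (u (t - s))\<^sup>2) has_integral e) {a + s..b + s}" by simp
  qed
qed

text \<open>The mixture has derivative \<open>(1 - \<phi>) h' + \<phi> g' + \<kappa> (g - h)\<close>. The hypothesis \<open>bound\<close> leaves open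
  how its square is split, because constant and moving weights call for different estimates.\<close>

lemma has_energy_affine_mixture:
  assumes h: "has_energy a b h e1" and g: "has_energy a b g e2" and ab: "a \<le> b"
    and \<phi>: "\<And>t. \<phi> t = \<alpha> + \<kappa> * t" and \<phi>01: "\<And>t. t \<in> {a..b} \<Longrightarrow> 0 \<le> \<phi> t \<and> \<phi> t \<le> 1"
    and bound: "\<And>t x y. t \<in> {a..b} \<Longrightarrow>
      ((1 - \<phi> t) * x + \<phi> t * y + \<kappa> * (g t - h t))\<^sup>2 \<le> A * x\<^sup>2 + B * y\<^sup>2 + C"
  shows "\<exists>e. has_energy a b (\<lambda>t. (1 - \<phi> t) * h t + \<phi> t * g t) e \<and> e \<le> A * e1 + B * e2 + C * (b - a)"
proof -
  obtain u N where u: "absolutely_continuous_on a b h" "u \<in> borel_measurable lebesgue" "negligible N"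
    "\<And>t. t \<in> {a<..<b} - N \<Longrightarrow> (h has_real_derivative u t) (at t)"
    "((\<lambda>t. (u t)\<^sup>2) has_integral e1) {a..b}" by (rule has_energyE[OF h]) (rule that)
  obtain v N' where v: "absolutely_continuous_on a b g" "v \<in> borel_measurable lebesgue" "negligible N'"
    "\<And>t. t \<in> {a<..<b} - N' \<Longrightarrow> (g has_real_derivative v t) (at t)"
    "((\<lambda>t. (v t)\<^sup>2) has_integral e2) {a..b}" by (rule has_energyE[OF g]) (rule that)
  have cont: "continuous_on {a..b} h" "continuous_on {a..b} g"
    using u(1) v(1) by (auto intro: absolutely_continuous_on_imp_continuous_on)
  let ?m = "\<lambda>t. (1 - \<phi> t) * h t + \<phi> t * g t"
  define d where "d t = g (max a (min b t)) - h (max a (min b t))" for t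
  have d: "d t = g t - h t" if "t \<in> {a..b}" for t using that by (simp add: d_def)
  define w where "w t = (1 - \<phi> t) * u t + \<phi> t * v t + \<kappa> * d t" for t
  have "continuous_on UNIV d"
    unfolding d_def using ab
    by (intro continuous_on_diff continuous_on_compose2[OF cont(1)] continuous_on_compose2[OF cont(2)]
        continuous_intros) auto
  then have "d \<in> borel_measurable lebesgue"
    by (intro measurable_completion) (simp add: borel_measurable_continuous_onI)
  moreover have "\<phi> \<in> borel_measurable lebesgue"
    by (intro measurable_completion) (simp add: \<phi>[abs_def])
  ultimately have wm: "w \<in> borel_measurable lebesgue"
    unfolding w_def using u(2) v(2) by measurable
  have der: "(?m has_real_derivative w t) (at t)" if t: "t \<in> {a<..<b} - (N \<union> N')" for t
  proof -
    have 1: "(h has_real_derivative u t) (at t)" "(g has_real_derivative v t) (at t)" using u(4) v(4) t by auto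
    have 2: "(\<phi> has_real_derivative \<kappa>) (at t)"
      unfolding \<phi>[abs_def] by (auto intro!: derivative_eq_intros)
    show ?thesis unfolding w_def using t
      by (auto simp: d algebra_simps intro!: derivative_eq_intros 1 2)
  qed
  obtain D where D: "0 \<le> D" "\<And>t. t \<in> {a..b} \<Longrightarrow> \<bar>d t\<bar> \<le> D"
  proof -
    have "compact (d ` {a..b})"
      by (intro compact_continuous_image continuous_on_subset[OF \<open>continuous_on UNIV d\<close>]) auto
    then obtain D where D: "\<forall>x\<in>d ` {a..b}. norm x \<le> D" using compact_imp_bounded bounded_iff by blast
    show ?thesis
    proof (rule that[of "\<bar>D\<bar>"])
      fix t assume "t \<in> {a..b}"
      then have "norm (d t) \<le> D" using D by blast
      then show "\<bar>d t\<bar> \<le> \<bar>D\<bar>" by simp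
    qed simp
  qed
  have ac: "absolutely_continuous_on a b ?m"
  proof (rule absolutely_continuous_on_dominated[OF u(1) v(1)])
    show "0 \<le> 1 + \<bar>\<kappa>\<bar> * D" using D by simp
    fix x y assume xy: "a \<le> x" "x \<le> y" "y \<le> b"
    then have \<phi>x: "0 \<le> \<phi> x" "\<phi> x \<le> 1" using \<phi>01[of x] by auto
    have "?m y - ?m x = (1 - \<phi> x) * (h y - h x) + \<phi> x * (g y - g x) + \<kappa> * (y - x) * (g y - h y)"
      by (simp add: \<phi> algebra_simps)
    also have "\<bar>\<dots>\<bar> \<le> \<bar>(1 - \<phi> x) * (h y - h x)\<bar> + \<bar>\<phi> x * (g y - g x)\<bar> + \<bar>\<kappa> * (y - x) * (g y - h y)\<bar>"
      by linarith
    also have "\<dots> = (1 - \<phi> x) * \<bar>h y - h x\<bar> + \<phi> x * \<bar>g y - g x\<bar> + \<bar>\<kappa>\<bar> * \<bar>d y\<bar> * (y - x)"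
      using \<phi>x xy d[of y] by (simp add: abs_mult)
    also have "\<dots> \<le> 1 * \<bar>h y - h x\<bar> + 1 * \<bar>g y - g x\<bar> + \<bar>\<kappa>\<bar> * D * (y - x)"
      using \<phi>x xy D(2)[of y] by (intro add_mono mult_right_mono mult_left_mono) auto
    also have "\<dots> \<le> (1 + \<bar>\<kappa>\<bar> * D) * (\<bar>h y - h x\<bar> + \<bar>g y - g x\<bar> + (y - x))"
    proof -
      have "0 \<le> (y - x) + \<bar>\<kappa>\<bar> * D * (\<bar>h y - h x\<bar> + \<bar>g y - g x\<bar>)" using D xy by simp
      then show ?thesis by (simp add: distrib_left distrib_right)
    qed
    finally show "\<bar>?m y - ?m x\<bar> \<le> (1 + \<bar>\<kappa>\<bar> * D) * (\<bar>h y - h x\<bar> + \<bar>g y - g x\<bar> + (y - x))" .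
  qed
  have int: "((\<lambda>t. A * (u t)\<^sup>2 + B * (v t)\<^sup>2 + C) has_integral (A * e1 + B * e2 + C * (b - a))) {a..b}"
    using has_integral_const_real[of C a b] ab
    by (intro has_integral_add has_integral_mult_right u v) (simp add: mult.commute)
  have le: "(w t)\<^sup>2 \<le> A * (u t)\<^sup>2 + B * (v t)\<^sup>2 + C" if "t \<in> {a..b}" for t
    using bound[OF that] d[OF that] by (simp add: w_def)
  have "(\<lambda>t. (w t)\<^sup>2) integrable_on {a..b}"
  proof (rule measurable_bounded_by_integrable_imp_integrable)
    show "(\<lambda>t. (w t)\<^sup>2) \<in> borel_measurable (lebesgue_on {a..b})"
      using wm by (intro measurable_restrict_space1) measurable
    show "(\<lambda>t. A * (u t)\<^sup>2 + B * (v t)\<^sup>2 + C) integrable_on {a..b}" using int by auto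
  qed (use le in auto)
  then have w2: "((\<lambda>t. (w t)\<^sup>2) has_integral integral {a..b} (\<lambda>t. (w t)\<^sup>2)) {a..b}" by auto
  have "integral {a..b} (\<lambda>t. (w t)\<^sup>2) \<le> A * e1 + B * e2 + C * (b - a)"
    by (rule has_integral_le[OF w2 int le])
  moreover have "has_energy a b ?m (integral {a..b} (\<lambda>t. (w t)\<^sup>2))"
    by (rule has_energyI[OF ac wm negligible_Un[OF u(3) v(3)] der w2])
  ultimately show ?thesis by blast
qed

lemma square_convex_le:
  fixes x y p :: real
  assumes "0 \<le> p" "p \<le> 1"
  shows "((1 - p) * x + p * y)\<^sup>2 \<le> (1 - p) * x\<^sup>2 + p * y\<^sup>2"
proof -
  have "(1 - p) * x\<^sup>2 + p * y\<^sup>2 - ((1 - p) * x + p * y)\<^sup>2 = p * (1 - p) * (x - y)\<^sup>2"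
    by (simp add: power2_eq_square algebra_simps)
  also have "\<dots> \<ge> 0" using assms by simp
  finally show ?thesis by simp
qed

lemma square_add_le:
  fixes x y \<eta> :: real
  assumes "0 < \<eta>"
  shows "(x + y)\<^sup>2 \<le> (1 + \<eta>) * x\<^sup>2 + (1 + 1 / \<eta>) * y\<^sup>2"
proof -
  have "(1 + \<eta>) * x\<^sup>2 + (1 + 1 / \<eta>) * y\<^sup>2 - (x + y)\<^sup>2 = (\<eta> * x - y)\<^sup>2 / \<eta>"
    using assms by (simp add: power2_eq_square field_simps)
  also have "\<dots> \<ge> 0" using assms by simp
  finally show ?thesis by simp
qed

lemma has_energy_convex:
  assumes h: "has_energy a b h e1" and g: "has_energy a b g e2" and "a \<le> b" "0 \<le> \<theta>" "\<theta> \<le> 1"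
  shows "\<exists>e. has_energy a b (\<lambda>t. (1 - \<theta>) * h t + \<theta> * g t) e \<and> e \<le> (1 - \<theta>) * e1 + \<theta> * e2"
  using has_energy_affine_mixture[OF h g, of "\<lambda>_. \<theta>" \<theta> 0 "1 - \<theta>" \<theta> 0] square_convex_le[of \<theta>] assms
  by auto

text \<open>The weight moves from one string to the other at speed \<open>1 / (b - a)\<close>. The derivative of the mixture is
  a convex combination of the two derivatives plus a term of size \<open>D / (b - a)\<close>; splitting the square with
  parameter \<open>\<eta>\<close> charges the factor \<open>1 + \<eta>\<close> to the energies and the large factor \<open>1 + 1 / \<eta>\<close> to the
  distance \<open>D\<close> of the two strings.\<close>

lemma has_energy_crossfade:
  assumes h: "has_energy a b h e1" and g: "has_energy a b g e2" and ab: "a < b" and \<eta>: "0 < \<eta>"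
    and \<phi>: "\<And>t. \<phi> t = \<alpha> + \<kappa> * t" and \<phi>01: "\<And>t. t \<in> {a..b} \<Longrightarrow> 0 \<le> \<phi> t \<and> \<phi> t \<le> 1"
    and \<kappa>: "\<bar>\<kappa>\<bar> = 1 / (b - a)"
    and D: "\<And>t. t \<in> {a..b} \<Longrightarrow> \<bar>g t - h t\<bar> \<le> D"
  shows "\<exists>e. has_energy a b (\<lambda>t. (1 - \<phi> t) * h t + \<phi> t * g t) e \<and>
    e \<le> (1 + \<eta>) * (e1 + e2) + (1 + 1 / \<eta>) * D\<^sup>2 / (b - a)"
proof -
  have "\<exists>e. has_energy a b (\<lambda>t. (1 - \<phi> t) * h t + \<phi> t * g t) e \<and>
      e \<le> (1 + \<eta>) * e1 + (1 + \<eta>) * e2 + ((1 + 1 / \<eta>) * (D / (b - a))\<^sup>2) * (b - a)"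
  proof (rule has_energy_affine_mixture[OF h g _ \<phi> \<phi>01])
    fix t x y assume t: "t \<in> {a..b}"
    have "((1 - \<phi> t) * x + \<phi> t * y + \<kappa> * (g t - h t))\<^sup>2
        \<le> (1 + \<eta>) * ((1 - \<phi> t) * x + \<phi> t * y)\<^sup>2 + (1 + 1 / \<eta>) * (\<kappa> * (g t - h t))\<^sup>2"
      by (rule square_add_le[OF \<eta>])
    also have "\<dots> \<le> (1 + \<eta>) * (x\<^sup>2 + y\<^sup>2) + (1 + 1 / \<eta>) * (D / (b - a))\<^sup>2"
    proof (intro add_mono mult_left_mono)
      have "((1 - \<phi> t) * x + \<phi> t * y)\<^sup>2 \<le> (1 - \<phi> t) * x\<^sup>2 + \<phi> t * y\<^sup>2"
        using \<phi>01[OF t] by (intro square_convex_le) auto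
      also have "\<dots> \<le> 1 * x\<^sup>2 + 1 * y\<^sup>2" using \<phi>01[OF t] by (intro add_mono mult_right_mono) auto
      finally show "((1 - \<phi> t) * x + \<phi> t * y)\<^sup>2 \<le> x\<^sup>2 + y\<^sup>2" by simp
      have "\<bar>\<kappa> * (g t - h t)\<bar> \<le> D / (b - a)"
        using D[OF t] ab by (simp add: abs_mult \<kappa> divide_right_mono)
      then show "(\<kappa> * (g t - h t))\<^sup>2 \<le> (D / (b - a))\<^sup>2"
        by (metis abs_ge_zero power2_abs power_mono)
    qed (use \<eta> in auto)
    finally show "((1 - \<phi> t) * x + \<phi> t * y + \<kappa> * (g t - h t))\<^sup>2
        \<le> (1 + \<eta>) * x\<^sup>2 + (1 + \<eta>) * y\<^sup>2 + (1 + 1 / \<eta>) * (D / (b - a))\<^sup>2"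
      by (simp add: algebra_simps)
  qed (use ab in auto)
  moreover have "((1 + 1 / \<eta>) * (D / (b - a))\<^sup>2) * (b - a) = (1 + 1 / \<eta>) * D\<^sup>2 / (b - a)"
    using ab by (simp add: power2_eq_square)
  ultimately show ?thesis by (simp add: distrib_left)
qed

lemma has_energy_continuously_differentiable:
  fixes p p' :: "real \<Rightarrow> real"
  assumes der: "\<And>t. (p has_real_derivative p' t) (at t)" and cont: "continuous_on UNIV p'"
  shows "\<exists>e. has_energy a b p e"
proof -
  have "compact (p' ` {a..b})" by (intro compact_continuous_image continuous_on_subset[OF cont]) auto
  then obtain K where K: "\<forall>x\<in>p' ` {a..b}. norm x \<le> K" using compact_imp_bounded bounded_iff by blast
  have "absolutely_continuous_on a b p"
  proof (rule absolutely_continuous_on_dominated[OF absolutely_continuous_on_const absolutely_continuous_on_const])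
    show "0 \<le> \<bar>K\<bar>" by simp
    fix x y assume xy: "a \<le> x" "x \<le> y" "y \<le> b"
    have "norm (p y - p x) \<le> \<bar>K\<bar> * norm (y - x)"
    proof (rule field_differentiable_bound[where S = "{x..y}" and f' = p'])
      show "(p has_field_derivative p' z) (at z within {x..y})" for z
        using der has_field_derivative_at_within by blast
      show "norm (p' z) \<le> \<bar>K\<bar>" if "z \<in> {x..y}" for z
      proof -
        have "norm (p' z) \<le> K" using K that xy by auto
        then show ?thesis by linarith
      qed
    qed (use xy in auto)
    then show "\<bar>p y - p x\<bar> \<le> \<bar>K\<bar> * (\<bar>0 - 0\<bar> + \<bar>0 - 0\<bar> + (y - x))" using xy by simp
  qed
  moreover have "p' \<in> borel_measurable lebesgue"
    using cont by (intro measurable_completion) (simp add: borel_measurable_continuous_onI)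
  moreover have "(\<lambda>t. (p' t)\<^sup>2) integrable_on {a..b}"
    by (intro integrable_continuous_interval continuous_intros continuous_on_subset[OF cont]) auto
  ultimately show ?thesis
    using der by (intro exI has_energyI[where u = p' and N = "{}"]) auto
qed

text \<open>The unspecified values of \<^const>\<open>deriv\<close> live on a null set, by almost everywhere differentiability.
  The \<^const>\<open>energy_norm\<close> therefore takes only values that \<^const>\<open>has_energy\<close> describes, apart from \<open>\<infinity>\<close>.\<close>

lemma energy_norm_cases:
  assumes ac: "absolutely_continuous_on 0 T h" and T: "0 \<le> T"
  shows "energy_norm T h = \<top> \<or> (\<exists>e. has_energy 0 T h e \<and> energy_norm T h = ennreal (sqrt e))"
    and "has_energy 0 T h e \<Longrightarrow> energy_norm T h = ennreal (sqrt e)"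
proof -
  have *: "(\<integral>\<^sup>+t\<in>{0..T}. ennreal ((deriv h t)\<^sup>2) \<partial>lebesgue) = (\<integral>\<^sup>+t. ennreal (indicator {0..T} t * (u t)\<^sup>2) \<partial>lebesgue)"
    if N: "negligible N" and der: "\<And>t. t \<in> {0<..<T} - N \<Longrightarrow> (h has_real_derivative u t) (at t)" for u N
  proof (rule nn_integral_cong_AE)
    have "negligible (N \<union> {0, T})" using N by simp
    then have "AE t in lebesgue. t \<notin> N \<union> {0, T}"
      by (intro AE_not_in) (simp add: negligible_iff_null_sets)
    then show "AE t in lebesgue. ennreal ((deriv h t)\<^sup>2) * indicator {0..T} t = ennreal (indicator {0..T} t * (u t)\<^sup>2)"
    proof eventually_elim
      case (elim t)
      show ?case
      proof (cases "t \<in> {0..T}")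
        case True
        then have "deriv h t = u t" using der[of t] elim by (intro DERIV_imp_deriv) auto
        then show ?thesis using True by simp
      qed simp
    qed
  qed
  have root: "ennreal_power (ennreal e) (1/2) = ennreal (sqrt e)" if "0 \<le> e" for e
    using that by (simp add: ennreal_power_def powr_half_sqrt)
  show 1: "energy_norm T h = ennreal (sqrt e)" if h: "has_energy 0 T h e" for e
  proof -
    obtain u N where u: "absolutely_continuous_on 0 T h" "u \<in> borel_measurable lebesgue" "negligible N"
      "\<And>t. t \<in> {0<..<T} - N \<Longrightarrow> (h has_real_derivative u t) (at t)"
      "((\<lambda>t. (u t)\<^sup>2) has_integral e) {0..T}" by (rule has_energyE[OF h]) (rule that)
    have "(\<integral>\<^sup>+t. ennreal (indicator {0..T} t * (u t)\<^sup>2) \<partial>lebesgue) = ennreal e"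
      using nn_integral_has_integral_lebesgue[OF _ u(5)] by (simp add: nn_integral_completion)
    then have "(\<integral>\<^sup>+t\<in>{0..T}. ennreal ((deriv h t)\<^sup>2) \<partial>lebesgue) = ennreal e"
      using *[OF u(3,4)] by simp
    then show ?thesis
      unfolding energy_norm_def using has_energy_nonneg[OF h] by (simp only: root)
  qed
  obtain N u where u: "negligible N" "u \<in> borel_measurable lebesgue"
    "\<And>t. t \<in> {0<..<T} - N \<Longrightarrow> (h has_real_derivative u t) (at t)"
    by (rule absolutely_continuous_on_measurable_derivative[OF ac]) (rule that)
  let ?I = "\<integral>\<^sup>+t. ennreal (indicator {0..T} t * (u t)\<^sup>2) \<partial>lebesgue"
  show "energy_norm T h = \<top> \<or> (\<exists>e. has_energy 0 T h e \<and> energy_norm T h = ennreal (sqrt e))"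
  proof (cases "?I = \<top>")
    case True
    then have "(\<integral>\<^sup>+t\<in>{0..T}. ennreal ((deriv h t)\<^sup>2) \<partial>lebesgue) = \<top>"
      using *[OF u(1,3)] by simp
    then show ?thesis unfolding energy_norm_def by (simp add: ennreal_power_def)
  next
    case False
    then obtain e where e: "0 \<le> e" "?I = ennreal e" by (cases ?I) auto
    have "(\<lambda>t. indicator {0..T} t * (u t)\<^sup>2) \<in> borel_measurable lebesgue"
      by (rule borel_measurable_times[OF borel_measurable_indicator borel_measurable_power[OF u(2)]]) simp
    then have "((\<lambda>t. indicator {0..T} t * (u t)\<^sup>2) has_integral e) UNIV"
      using e by (subst has_integral_iff_nn_integral_lebesgue) auto
    then have "((\<lambda>t. if t \<in> {0..T} then (u t)\<^sup>2 else 0) has_integral e) UNIV"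
      by (rule has_integral_eq[rotated]) (auto simp: indicator_def)
    then have int: "((\<lambda>t. (u t)\<^sup>2) has_integral e) {0..T}" by (simp only: has_integral_restrict_UNIV)
    have "has_energy 0 T h e" by (rule has_energyI[OF ac u(2,1,3) int])
    then show ?thesis using 1 by blast
  qed
qed

section \<open>Minimal energies of strings in a tube around a path\<close>

definition in_tube :: "real \<Rightarrow> real \<Rightarrow> (real \<Rightarrow> real) \<Rightarrow> real \<Rightarrow> (real \<Rightarrow> real) \<Rightarrow> bool" where
  "in_tube a b w \<rho> h \<longleftrightarrow> (\<forall>t\<in>{a..b}. \<bar>h t - w t\<bar> \<le> \<rho>)"

text \<open>The square of \<^const>\<open>I_free\<close> for paths that are continuous and start at \<open>0\<close>; the infimum is then taken
  over a nonempty set.\<close>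

definition min_energy :: "(real \<Rightarrow> real) \<Rightarrow> real \<Rightarrow> real \<Rightarrow> real" where
  "min_energy w T \<rho> = Inf {e. \<exists>h. has_energy 0 T h e \<and> in_tube 0 T w \<rho> h \<and> h 0 = 0}"

definition min_energy_fixed :: "(real \<Rightarrow> real) \<Rightarrow> real \<Rightarrow> real \<Rightarrow> real" where
  "min_energy_fixed w T \<rho> = Inf {e. \<exists>h. has_energy 0 T h e \<and> in_tube 0 T w \<rho> h \<and> h 0 = 0 \<and> h T = w T}"

definition path_from :: "(real \<Rightarrow> real) \<Rightarrow> real \<Rightarrow> real \<Rightarrow> real" where
  "path_from w a t = w (a + t) - w a"

text \<open>The Bernstein polynomial on \<open>[0, T]\<close> with value \<open>x k\<close> at the node \<open>k T / n\<close>. These polynomials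
  approximate continuous paths uniformly, have finite energy, and depend continuously on finitely many
  numbers; the first two properties give admissible strings, all three give measurability.\<close>

definition bernstein_path :: "nat \<Rightarrow> real \<Rightarrow> (nat \<Rightarrow> real) \<Rightarrow> real \<Rightarrow> real" where
  "bernstein_path n T x t = (\<Sum>k\<le>n. x k * Bernstein n k (t / T))"

lemma bernstein_path_0: "bernstein_path n T x 0 = x 0"
proof -
  have "bernstein_path n T x 0 = (\<Sum>k\<le>n. if k = 0 then x 0 else 0)"
    unfolding bernstein_path_def by (intro sum.cong) (auto simp: Bernstein_def)
  then show ?thesis by simp
qed

lemma has_energy_bernstein_path: "\<exists>e. has_energy a b (bernstein_path n T x) e"
proof -
  have "real_polynomial_function (\<lambda>t. t / T :: real)"
    unfolding divide_inverse by (intro real_polynomial_function.intros bounded_linear_ident)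
  then have "real_polynomial_function (bernstein_path n T x)"
    unfolding bernstein_path_def[abs_def] Bernstein_def
    by (intro real_polynomial_function_sum real_polynomial_function.intros(2,4)
        real_polynomial_function_diff real_polynomial_function_power) auto
  then obtain p' where p': "real_polynomial_function p'"
    "\<And>t. (bernstein_path n T x has_real_derivative p' t) (at t)"
    using has_real_derivative_polynomial_function by blast
  then show ?thesis
    by (intro has_energy_continuously_differentiable[of _ p'])
      (auto intro: continuous_on_polymonial_function simp: real_polynomial_function_eq)
qed

lemma bernstein_path_uniform_limit:
  assumes w: "continuous_on {0..T} w" and T: "0 < T"
  shows "uniform_limit {0..T} (\<lambda>n. bernstein_path n T (\<lambda>k. w (T * real k / real n))) w sequentially"
  unfolding uniform_limit_iff
proof (intro allI impI)
  fix e :: real assume e: "0 < e"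
  have "continuous_on {0..1} (\<lambda>s. w (T * s))"
    by (rule continuous_on_compose2[OF w]) (use T in \<open>auto intro!: continuous_intros mult_left_le\<close>)
  from Bernstein_Weierstrass[OF this e] obtain N where
    N: "\<And>n s. N \<le> n \<Longrightarrow> s \<in> {0..1} \<Longrightarrow> \<bar>w (T * s) - (\<Sum>k\<le>n. w (T * (real k / real n)) * Bernstein n k s)\<bar> < e"
    by blast
  show "\<forall>\<^sub>F n in sequentially. \<forall>t\<in>{0..T}. dist (bernstein_path n T (\<lambda>k. w (T * real k / real n)) t) (w t) < e"
    using eventually_ge_at_top[of N]
  proof (eventually_elim, intro ballI)
    fix n t assume nt: "N \<le> n" "t \<in> {0..T}"
    then have "t / T \<in> {0..1}" using T by simp
    from N[OF nt(1) this] show "dist (bernstein_path n T (\<lambda>k. w (T * real k / real n)) t) (w t) < e"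
      using T by (simp add: bernstein_path_def dist_real_def abs_minus_commute)
  qed
qed

lemma feasible_string_exists:
  assumes w: "continuous_on {0..T} w" and w0: "w 0 = 0" and T: "0 < T" and \<rho>: "0 < \<rho>"
  shows "\<exists>h e. has_energy 0 T h e \<and> in_tube 0 T w \<rho> h \<and> h 0 = 0"
proof -
  have "\<forall>\<^sub>F n in sequentially. \<forall>t\<in>{0..T}. dist (bernstein_path n T (\<lambda>k. w (T * real k / real n)) t) (w t) < \<rho>"
    using bernstein_path_uniform_limit[OF w T] \<rho> by (auto simp: uniform_limit_iff)
  then obtain n where n: "\<forall>t\<in>{0..T}. dist (bernstein_path n T (\<lambda>k. w (T * real k / real n)) t) (w t) < \<rho>"
    using eventually_happens'[OF sequentially_bot] by blast
  obtain e where "has_energy 0 T (bernstein_path n T (\<lambda>k. w (T * real k / real n))) e"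
    using has_energy_bernstein_path by blast
  moreover have "in_tube 0 T w \<rho> (bernstein_path n T (\<lambda>k. w (T * real k / real n)))"
    using n by (auto simp: in_tube_def dist_real_def less_imp_le)
  ultimately show ?thesis using w0 by (auto simp: bernstein_path_0)
qed

lemma min_energy_le:
  assumes "has_energy 0 T h e" "in_tube 0 T w \<rho> h" "h 0 = 0"
  shows "min_energy w T \<rho> \<le> e"
  unfolding min_energy_def
  by (rule cInf_lower) (use assms has_energy_nonneg in \<open>auto intro!: bdd_belowI[of _ 0]\<close>)

lemma min_energy_fixed_le:
  assumes "has_energy 0 T h e" "in_tube 0 T w \<rho> h" "h 0 = 0" "h T = w T"
  shows "min_energy_fixed w T \<rho> \<le> e"
  unfolding min_energy_fixed_def
  by (rule cInf_lower) (use assms has_energy_nonneg in \<open>auto intro!: bdd_belowI[of _ 0]\<close>)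

lemma min_energy_approx:
  assumes "continuous_on {0..T} w" "w 0 = 0" "0 < T" "0 < \<rho>" "0 < \<delta>"
  obtains h e where "has_energy 0 T h e" "in_tube 0 T w \<rho> h" "h 0 = 0" "e < min_energy w T \<rho> + \<delta>"
proof -
  have "{e. \<exists>h. has_energy 0 T h e \<and> in_tube 0 T w \<rho> h \<and> h 0 = 0} \<noteq> {}"
    using feasible_string_exists[OF assms(1-4)] by blast
  from cInf_lessD[OF this, of "min_energy w T \<rho> + \<delta>"] show ?thesis
    using that assms(5) by (auto simp: min_energy_def)
qed

lemma min_energy_nonneg:
  assumes "continuous_on {0..T} w" "w 0 = 0" "0 < T" "0 < \<rho>"
  shows "0 \<le> min_energy w T \<rho>"
  unfolding min_energy_def
  by (rule cInf_greatest) (use feasible_string_exists[OF assms] has_energy_nonneg in auto)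

lemma path_from_0: "path_from w a 0 = 0"
  by (simp add: path_from_def)

lemma continuous_on_path_from:
  assumes "continuous_on {0..} w" "0 \<le> a"
  shows "continuous_on {0..} (path_from w a)"
  unfolding path_from_def[abs_def]
  by (intro continuous_intros continuous_on_compose2[OF assms(1)]) (use assms(2) in auto)

text \<open>Strings over \<open>[a, b]\<close> correspond to strings over \<open>[0, b - a]\<close> for the path restarted at time \<open>a\<close>, with heights
  measured from \<open>w a\<close>.\<close>

lemma has_energy_restart:
  assumes "has_energy a b h e" "in_tube a b w \<rho> h"
  shows "has_energy 0 (b - a) (\<lambda>t. h (t + a) - w a) e"
    and "in_tube 0 (b - a) (path_from w a) \<rho> (\<lambda>t. h (t + a) - w a)"
  using has_energy_shift[OF assms(1), of "- a" "- w a"] assms(2)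
  by (auto simp: in_tube_def path_from_def add.commute)

lemma has_energy_continue:
  assumes "has_energy 0 l f e" "in_tube 0 l (path_from w a) \<rho> f"
  shows "has_energy a (a + l) (\<lambda>t. f (t - a) + w a) e"
    and "in_tube a (a + l) w \<rho> (\<lambda>t. f (t - a) + w a)"
proof -
  show "has_energy a (a + l) (\<lambda>t. f (t - a) + w a) e"
    using has_energy_shift[OF assms(1), of a "w a"] by (simp add: add.commute)
  show "in_tube a (a + l) w \<rho> (\<lambda>t. f (t - a) + w a)"
    unfolding in_tube_def
  proof
    fix t assume "t \<in> {a..a + l}"
    then have "\<bar>f (t - a) - path_from w a (t - a)\<bar> \<le> \<rho>" using assms(2) by (auto simp: in_tube_def)
    then show "\<bar>f (t - a) + w a - w t\<bar> \<le> \<rho>" by (simp add: path_from_def)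
  qed
qed

lemma in_tube_crossfade:
  assumes h: "in_tube a b w \<rho> h" and g: "in_tube a b w \<rho> g"
    and \<phi>: "\<And>t. t \<in> {a..b} \<Longrightarrow> 0 \<le> \<phi> t \<and> \<phi> t \<le> 1"
  shows "in_tube a b w \<rho> (\<lambda>t. (1 - \<phi> t) * h t + \<phi> t * g t)"
  unfolding in_tube_def
proof
  fix t assume t: "t \<in> {a..b}"
  have "(1 - \<phi> t) * h t + \<phi> t * g t - w t = (1 - \<phi> t) * (h t - w t) + \<phi> t * (g t - w t)"
    by (simp add: algebra_simps)
  also have "\<bar>\<dots>\<bar> \<le> (1 - \<phi> t) * \<bar>h t - w t\<bar> + \<phi> t * \<bar>g t - w t\<bar>"
    using \<phi>[OF t] abs_triangle_ineq[of "(1 - \<phi> t) * (h t - w t)" "\<phi> t * (g t - w t)"] by (simp add: abs_mult)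
  also have "\<dots> \<le> (1 - \<phi> t) * \<rho> + \<phi> t * \<rho>"
    using h g \<phi>[OF t] t by (intro add_mono mult_left_mono) (auto simp: in_tube_def)
  finally show "\<bar>(1 - \<phi> t) * h t + \<phi> t * g t - w t\<bar> \<le> \<rho>" by (simp add: algebra_simps)
qed

lemma in_tube_apart:
  assumes "in_tube a b w \<rho> h" "in_tube a b w \<rho>' g" "t \<in> {a..b}"
  shows "\<bar>g t - h t\<bar> \<le> \<rho> + \<rho>'"
proof -
  have "\<bar>h t - w t\<bar> \<le> \<rho>" "\<bar>g t - w t\<bar> \<le> \<rho>'" using assms by (auto simp: in_tube_def)
  then show ?thesis by linarith
qed

lemma in_tube_glue:
  assumes "in_tube a c w \<rho> h" "in_tube c b w \<rho> g"
  shows "in_tube a b w \<rho> (\<lambda>t. if t \<le> c then h t else g t)"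
  using assms by (auto simp: in_tube_def)

lemma in_tube_subinterval: "in_tube a b w \<rho> h \<Longrightarrow> a \<le> c \<Longrightarrow> d \<le> b \<Longrightarrow> in_tube c d w \<rho> h"
  by (auto simp: in_tube_def)

lemma min_energy_mono:
  assumes w: "continuous_on {0..T'} w" "w 0 = 0" and "0 < T" "T \<le> T'" and \<rho>: "0 < \<rho>"
  shows "min_energy w T \<rho> \<le> min_energy w T' \<rho>"
proof (rule field_le_epsilon)
  fix \<delta> :: real assume "0 < \<delta>"
  then obtain h e where h: "has_energy 0 T' h e" "in_tube 0 T' w \<rho> h" "h 0 = 0" "e < min_energy w T' \<rho> + \<delta>"
    using min_energy_approx[OF w _ \<rho>] assms by (metis less_le_trans)
  obtain e1 e2 where e: "has_energy 0 T h e1" "has_energy T T' h e2" "e = e1 + e2"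
    by (rule has_energy_split[OF h(1), of T]) (use assms in auto)
  have "min_energy w T \<rho> \<le> e1"
    by (rule min_energy_le[OF e(1) _ h(3)]) (use h(2) assms in \<open>auto intro: in_tube_subinterval\<close>)
  then show "min_energy w T \<rho> \<le> min_energy w T' \<rho> + \<delta>" using h(4) e has_energy_nonneg[OF e(2)] by simp
qed

lemma min_energy_antimono_radius:
  assumes w: "continuous_on {0..T} w" "w 0 = 0" and T: "0 < T" and \<rho>: "0 < \<rho>'" "\<rho>' \<le> \<rho>"
  shows "min_energy w T \<rho> \<le> min_energy w T \<rho>'"
proof (rule field_le_epsilon)
  fix \<delta> :: real assume "0 < \<delta>"
  obtain h e where h: "has_energy 0 T h e" "in_tube 0 T w \<rho>' h" "h 0 = 0" "e < min_energy w T \<rho>' + \<delta>"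
    using min_energy_approx[OF w T \<rho>(1) \<open>0 < \<delta>\<close>] .
  have "in_tube 0 T w \<rho> h" using h(2) \<rho>(2) by (force simp: in_tube_def)
  then show "min_energy w T \<rho> \<le> min_energy w T \<rho>' + \<delta>" using min_energy_le[OF h(1) _ h(3)] h(4) by force
qed

text \<open>The string \<open>h\<close> may start anywhere in the tube. Crossfading on \<open>[0, S]\<close> from a string that starts at
  \<open>0\<close> repairs the start at a cost independent of \<open>L\<close>.\<close>

lemma min_energy_anchor:
  assumes w: "continuous_on {0..L} w" "w 0 = 0" and S: "0 < S" "S \<le> L" and \<rho>: "0 < \<rho>" and \<eta>: "0 < \<eta>"
    and h: "has_energy 0 L h e" "in_tube 0 L w \<rho> h"
  shows "min_energy w L \<rho> \<le> (1 + \<eta>) * (e + min_energy w S \<rho>) + (1 + 1 / \<eta>) * (2 * \<rho>)\<^sup>2 / S"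
proof (rule field_le_epsilon)
  fix \<delta>' :: real assume \<delta>': "0 < \<delta>'"
  define \<delta> where "\<delta> = \<delta>' / (1 + \<eta>)"
  have \<delta>: "0 < \<delta>" using \<delta>' \<eta> by (simp add: \<delta>_def)
  have wS: "continuous_on {0..S} w" using w(1) S by (auto intro: continuous_on_subset)
  obtain g e' where g: "has_energy 0 S g e'" "in_tube 0 S w \<rho> g" "g 0 = 0" "e' < min_energy w S \<rho> + \<delta>"
    by (rule min_energy_approx[OF wS w(2) S(1) \<rho> \<delta>])
  obtain e1 e2 where e: "has_energy 0 S h e1" "has_energy S L h e2" "e = e1 + e2"
    by (rule has_energy_split[OF h(1), of S]) (use S in auto)
  have hS: "in_tube 0 S w \<rho> h" "in_tube S L w \<rho> h" using h(2) S by (auto intro: in_tube_subinterval)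
  define \<phi> where "\<phi> t = 0 + 1 / S * t" for t
  have \<phi>01: "0 \<le> \<phi> t \<and> \<phi> t \<le> 1" if "t \<in> {0..S}" for t using that S by (auto simp: \<phi>_def)
  have "\<exists>e. has_energy 0 S (\<lambda>t. (1 - \<phi> t) * g t + \<phi> t * h t) e \<and>
      e \<le> (1 + \<eta>) * (e' + e1) + (1 + 1 / \<eta>) * (\<rho> + \<rho>)\<^sup>2 / (S - 0)"
    by (rule has_energy_crossfade[OF g(1) e(1) S(1) \<eta> \<phi>_def \<phi>01 _ in_tube_apart[OF g(2) hS(1)]]) (use S in auto)
  then obtain e3 where e3: "has_energy 0 S (\<lambda>t. (1 - \<phi> t) * g t + \<phi> t * h t) e3"
      "e3 \<le> (1 + \<eta>) * (e' + e1) + (1 + 1 / \<eta>) * (2 * \<rho>)\<^sup>2 / S" by auto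
  have "\<phi> S = 1" "\<phi> 0 = 0" using S by (auto simp: \<phi>_def)
  then have "has_energy 0 L (\<lambda>t. if t \<le> S then (1 - \<phi> t) * g t + \<phi> t * h t else h t) (e3 + e2)"
    by (intro has_energy_glue[OF e3(1) e(2)]) (use S in auto)
  then have "min_energy w L \<rho> \<le> e3 + e2"
    by (rule min_energy_le[OF _ in_tube_glue[OF in_tube_crossfade[OF g(2) hS(1) \<phi>01] hS(2)]])
      (use S g(3) \<open>\<phi> 0 = 0\<close> in auto)
  also have "\<dots> \<le> (1 + \<eta>) * (e' + e1) + (1 + 1 / \<eta>) * (2 * \<rho>)\<^sup>2 / S + (1 + \<eta>) * e2"
    using e3(2) mult_nonneg_nonneg[OF less_imp_le[OF \<eta>] has_energy_nonneg[OF e(2)]] by (simp add: algebra_simps)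
  also have "\<dots> = (1 + \<eta>) * (e + e') + (1 + 1 / \<eta>) * (2 * \<rho>)\<^sup>2 / S" by (simp add: e(3) algebra_simps)
  also have "\<dots> \<le> (1 + \<eta>) * (e + (min_energy w S \<rho> + \<delta>)) + (1 + 1 / \<eta>) * (2 * \<rho>)\<^sup>2 / S"
    using g(4) \<eta> by (intro add_mono mult_left_mono) auto
  also have "\<dots> = (1 + \<eta>) * (e + min_energy w S \<rho>) + (1 + 1 / \<eta>) * (2 * \<rho>)\<^sup>2 / S + (1 + \<eta>) * \<delta>"
    by (simp add: algebra_simps)
  also have "(1 + \<eta>) * \<delta> = \<delta>'" using \<eta> by (simp add: \<delta>_def)
  finally show "min_energy w L \<rho> \<le> (1 + \<eta>) * (e + min_energy w S \<rho>) + (1 + 1 / \<eta>) * (2 * \<rho>)\<^sup>2 / S + \<delta>'" .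
qed

text \<open>On \<open>[a, T]\<close> one crossfades into a string that ends on the path. It comes from a string with
  half the radius on the longer interval \<open>[a, b]\<close>. Its energy thus bounds the cost for all end
  times \<open>T\<close> up to \<open>b\<close> simultaneously, which is what handles a continuum of times \<open>T\<close> almost surely.\<close>

lemma fixed_string_from_free:
  assumes w: "continuous_on {0..} w" "w 0 = 0" and a: "0 \<le> a" "a < T" "T \<le> b" and \<rho>: "0 < \<rho>" and \<eta>: "0 < \<eta>"
    and \<delta>': "0 < \<delta>'"
  shows "\<exists>h e. has_energy 0 T h e \<and> in_tube 0 T w \<rho> h \<and> h 0 = 0 \<and> h T = w T \<and>
    e \<le> (1 + \<eta>) * (min_energy w T \<rho> + min_energy (path_from w a) (b - a) (\<rho> / 2))
      + (1 + 1 / \<eta>) * (2 * \<rho>)\<^sup>2 / (T - a) + \<delta>'"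
proof -
  define \<delta> where "\<delta> = \<delta>' / (2 * (1 + \<eta>))"
  have \<delta>: "0 < \<delta>" using \<delta>' \<eta> by (simp add: \<delta>_def)
  have wT: "continuous_on {0..T} w" using w(1) by (auto intro: continuous_on_subset)
  have wa: "continuous_on {0..b - a} (path_from w a)"
    using continuous_on_path_from[OF w(1) a(1)] by (auto intro: continuous_on_subset)
  obtain h e where h: "has_energy 0 T h e" "in_tube 0 T w \<rho> h" "h 0 = 0" "e < min_energy w T \<rho> + \<delta>"
    by (rule min_energy_approx[OF wT w(2) _ \<rho> \<delta>]) (use a in auto)
  obtain f ef where f: "has_energy 0 (b - a) f ef" "in_tube 0 (b - a) (path_from w a) (\<rho> / 2) f" "f 0 = 0"
    "ef < min_energy (path_from w a) (b - a) (\<rho> / 2) + \<delta>"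
    by (rule min_energy_approx[OF wa path_from_0 _ _ \<delta>, of "\<rho> / 2"]) (use a \<rho> in auto)
  obtain e1 e2 where e: "has_energy 0 a h e1" "has_energy a T h e2" "e = e1 + e2"
    by (rule has_energy_split[OF h(1), of a]) (use a in auto)
  have ha: "in_tube 0 a w \<rho> h" "in_tube a T w \<rho> h" using h(2) a by (auto intro: in_tube_subinterval)
  define f' where "f' t = f (t - a) + w a" for t
  have "has_energy a b f' ef" and f't: "in_tube a b w (\<rho> / 2) f'"
    using has_energy_continue[OF f(1,2)] by (simp_all add: f'_def[abs_def])
  then obtain e4 e5 where e4: "has_energy a T f' e4" "has_energy T b f' e5" "ef = e4 + e5"
    using has_energy_split[of a b f' ef T] a by auto
  \<comment> \<open>The second half of the radius absorbs the vertical translation that makes the end value exact.\<close>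
  define g where "g t = f' t + (w T - f' T)" for t
  have g: "has_energy a T g e4" using has_energy_shift[OF e4(1), of 0 "w T - f' T"] by (simp add: g_def[abs_def])
  have "\<bar>f' T - w T\<bar> \<le> \<rho> / 2" using f't a by (auto simp: in_tube_def)
  then have gt: "in_tube a T w \<rho> g"
    unfolding in_tube_def g_def
  proof (intro ballI)
    fix t assume "\<bar>f' T - w T\<bar> \<le> \<rho> / 2" "t \<in> {a..T}"
    moreover have "\<bar>f' t - w t\<bar> \<le> \<rho> / 2" using f't a \<open>t \<in> {a..T}\<close> by (auto simp: in_tube_def)
    ultimately show "\<bar>f' t + (w T - f' T) - w t\<bar> \<le> \<rho>" by linarith
  qed
  define \<phi> where "\<phi> t = - a / (T - a) + 1 / (T - a) * t" for t
  have \<phi>': "\<phi> t = (t - a) / (T - a)" for t by (simp add: \<phi>_def diff_divide_distrib)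
  have \<phi>01: "0 \<le> \<phi> t \<and> \<phi> t \<le> 1" if "t \<in> {a..T}" for t using that a by (auto simp: \<phi>')
  have "\<exists>e. has_energy a T (\<lambda>t. (1 - \<phi> t) * h t + \<phi> t * g t) e \<and>
      e \<le> (1 + \<eta>) * (e2 + e4) + (1 + 1 / \<eta>) * (\<rho> + \<rho>)\<^sup>2 / (T - a)"
    by (rule has_energy_crossfade[OF e(2) g a(2) \<eta> \<phi>_def \<phi>01 _ in_tube_apart[OF ha(2) gt]]) (use a in auto)
  then obtain e3 where e3: "has_energy a T (\<lambda>t. (1 - \<phi> t) * h t + \<phi> t * g t) e3"
      "e3 \<le> (1 + \<eta>) * (e2 + e4) + (1 + 1 / \<eta>) * (2 * \<rho>)\<^sup>2 / (T - a)" by auto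
  have \<phi>aT: "\<phi> a = 0" "\<phi> T = 1" using a by (auto simp: \<phi>')
  let ?m = "\<lambda>t. if t \<le> a then h t else (1 - \<phi> t) * h t + \<phi> t * g t"
  have "has_energy 0 T ?m (e1 + e3)"
    by (rule has_energy_glue[OF e(1) e3(1)]) (use a \<phi>aT in auto)
  moreover have "in_tube 0 T w \<rho> ?m"
    by (rule in_tube_glue[OF ha(1) in_tube_crossfade[OF ha(2) gt \<phi>01]])
  moreover have "?m 0 = 0" "?m T = w T" using a h(3) \<phi>aT by (auto simp: g_def)
  moreover have "e1 + e3 \<le> (1 + \<eta>) * (min_energy w T \<rho> + min_energy (path_from w a) (b - a) (\<rho> / 2))
      + (1 + 1 / \<eta>) * (2 * \<rho>)\<^sup>2 / (T - a) + \<delta>'"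
  proof -
    have "e1 + e3 \<le> (1 + \<eta>) * e1 + ((1 + \<eta>) * (e2 + e4) + (1 + 1 / \<eta>) * (2 * \<rho>)\<^sup>2 / (T - a))"
      using e3(2) has_energy_nonneg[OF e(1)] \<eta> by (intro add_mono) (auto simp: distrib_right)
    also have "\<dots> = (1 + \<eta>) * (e + e4) + (1 + 1 / \<eta>) * (2 * \<rho>)\<^sup>2 / (T - a)"
      by (simp add: e(3) algebra_simps)
    also have "\<dots> \<le> (1 + \<eta>) * ((min_energy w T \<rho> + \<delta>) + (min_energy (path_from w a) (b - a) (\<rho> / 2) + \<delta>))
        + (1 + 1 / \<eta>) * (2 * \<rho>)\<^sup>2 / (T - a)"
      using h(4) f(4) e4(3) has_energy_nonneg[OF e4(2)] \<eta> by (intro add_mono mult_left_mono) auto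
    also have "\<dots> = (1 + \<eta>) * (min_energy w T \<rho> + min_energy (path_from w a) (b - a) (\<rho> / 2))
        + (1 + 1 / \<eta>) * (2 * \<rho>)\<^sup>2 / (T - a) + (2 * (1 + \<eta>)) * \<delta>"
      by (simp add: algebra_simps)
    also have "(2 * (1 + \<eta>)) * \<delta> = \<delta>'" using \<eta> by (simp add: \<delta>_def)
    finally show ?thesis .
  qed
  ultimately show ?thesis by blast
qed

lemma min_energy_fixed_le_free:
  assumes "continuous_on {0..} w" "w 0 = 0" "0 \<le> a" "a < T" "T \<le> b" "0 < \<rho>" "0 < \<eta>"
  shows "min_energy_fixed w T \<rho> \<le> (1 + \<eta>) * (min_energy w T \<rho> + min_energy (path_from w a) (b - a) (\<rho> / 2))
      + (1 + 1 / \<eta>) * (2 * \<rho>)\<^sup>2 / (T - a)"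
proof (rule field_le_epsilon)
  fix \<delta> :: real assume "0 < \<delta>"
  from fixed_string_from_free[OF assms this]
  show "min_energy_fixed w T \<rho> \<le> (1 + \<eta>) * (min_energy w T \<rho> + min_energy (path_from w a) (b - a) (\<rho> / 2))
      + (1 + 1 / \<eta>) * (2 * \<rho>)\<^sup>2 / (T - a) + \<delta>"
    using min_energy_fixed_le by (meson order_trans)
qed

lemma feasible_fixed_string_exists:
  assumes w: "continuous_on {0..} w" "w 0 = 0" and "0 < T" "0 < \<rho>"
  shows "\<exists>h e. has_energy 0 T h e \<and> in_tube 0 T w \<rho> h \<and> h 0 = 0 \<and> h T = w T"
  using fixed_string_from_free[OF w order_refl assms(3) order_refl assms(4) zero_less_one zero_less_one] by blast

lemma min_energy_fixed_approx:
  assumes "continuous_on {0..} w" "w 0 = 0" "0 < T" "0 < \<rho>" "0 < \<delta>"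
  obtains h e where "has_energy 0 T h e" "in_tube 0 T w \<rho> h" "h 0 = 0" "h T = w T"
    "e < min_energy_fixed w T \<rho> + \<delta>"
proof -
  have "{e. \<exists>h. has_energy 0 T h e \<and> in_tube 0 T w \<rho> h \<and> h 0 = 0 \<and> h T = w T} \<noteq> {}"
    using feasible_fixed_string_exists[OF assms(1-4)] by blast
  from cInf_lessD[OF this, of "min_energy_fixed w T \<rho> + \<delta>"] show ?thesis
    using that assms(5) by (auto simp: min_energy_fixed_def)
qed

lemma min_energy_le_fixed:
  assumes "continuous_on {0..} w" "w 0 = 0" "0 < T" "0 < \<rho>"
  shows "min_energy w T \<rho> \<le> min_energy_fixed w T \<rho>"
proof (rule field_le_epsilon)
  fix \<delta> :: real assume "0 < \<delta>"
  from min_energy_fixed_approx[OF assms this] obtain h e where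
    h: "has_energy 0 T h e" "in_tube 0 T w \<rho> h" "h 0 = 0" "e < min_energy_fixed w T \<rho> + \<delta>" by metis
  show "min_energy w T \<rho> \<le> min_energy_fixed w T \<rho> + \<delta>" using min_energy_le[OF h(1-3)] h(4) by simp
qed

text \<open>Strings that start and end on the path can be glued.\<close>

lemma min_energy_fixed_subadditive:
  assumes w: "continuous_on {0..} w" "w 0 = 0" and ab: "0 < a" "0 < b" and \<rho>: "0 < \<rho>"
  shows "min_energy_fixed w (a + b) \<rho> \<le> min_energy_fixed w a \<rho> + min_energy_fixed (path_from w a) b \<rho>"
proof (rule field_le_epsilon)
  fix \<delta> :: real assume "0 < \<delta>"
  then have \<delta>: "0 < \<delta> / 2" by simp
  obtain h e where h: "has_energy 0 a h e" "in_tube 0 a w \<rho> h" "h 0 = 0" "h a = w a"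
    "e < min_energy_fixed w a \<rho> + \<delta> / 2"
    by (rule min_energy_fixed_approx[OF w ab(1) \<rho> \<delta>])
  obtain g e' where g: "has_energy 0 b g e'" "in_tube 0 b (path_from w a) \<rho> g" "g 0 = 0" "g b = path_from w a b"
    "e' < min_energy_fixed (path_from w a) b \<rho> + \<delta> / 2"
    by (rule min_energy_fixed_approx[OF continuous_on_path_from[OF w(1), of a] path_from_0 ab(2) \<rho> \<delta>])
      (use ab in auto)
  note g' = has_energy_continue[OF g(1,2)]
  let ?m = "\<lambda>t. if t \<le> a then h t else g (t - a) + w a"
  have "has_energy 0 (a + b) ?m (e + e')"
    by (rule has_energy_glue[OF h(1) g'(1)]) (use ab h(4) g(3) in auto)
  then have "min_energy_fixed w (a + b) \<rho> \<le> e + e'"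
    by (rule min_energy_fixed_le[OF _ in_tube_glue[OF h(2) g'(2)]])
      (use ab h(3) g(4) in \<open>auto simp: path_from_def\<close>)
  then show "min_energy_fixed w (a + b) \<rho> \<le> min_energy_fixed w a \<rho> + min_energy_fixed (path_from w a) b \<rho> + \<delta>"
    using h(5) g(5) by simp
qed

lemma min_energy_fixed_sum_blocks:
  assumes w: "continuous_on {0..} w" "w 0 = 0" and L: "0 < L" and \<rho>: "0 < \<rho>"
  shows "min_energy_fixed w (real (Suc n) * L) \<rho> \<le> (\<Sum>i<Suc n. min_energy_fixed (path_from w (real i * L)) L \<rho>)"
proof (induction n)
  case 0
  have "path_from w 0 = w" using w(2) by (auto simp: path_from_def)
  then show ?case by simp
next
  case (Suc n)
  have "min_energy_fixed w (real (Suc n) * L + L) \<rho>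
      \<le> min_energy_fixed w (real (Suc n) * L) \<rho> + min_energy_fixed (path_from w (real (Suc n) * L)) L \<rho>"
    by (rule min_energy_fixed_subadditive[OF w _ L \<rho>]) (use L in simp)
  moreover have "real (Suc n) * L + L = real (Suc (Suc n)) * L" by (simp add: algebra_simps)
  ultimately show ?case using Suc by simp
qed

text \<open>The restriction of \<open>h\<close> to each block has no prescribed start; anchoring the pieces costs a bounded
  amount per block.\<close>

lemma sum_blocks_min_energy:
  assumes w: "continuous_on {0..} w" and S: "0 < S" "S \<le> L" and \<rho>: "0 < \<rho>" and \<eta>: "0 < \<eta>"
    and h: "has_energy 0 (real n * L) h e" "in_tube 0 (real n * L) w \<rho> h"
  shows "(\<Sum>i<n. min_energy (path_from w (real i * L)) L \<rho>)
    \<le> (1 + \<eta>) * (e + (\<Sum>i<n. min_energy (path_from w (real i * L)) S \<rho>)) + real n * ((1 + 1 / \<eta>) * (2 * \<rho>)\<^sup>2 / S)"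
  using h
proof (induction n arbitrary: e)
  case 0
  then show ?case using has_energy_nonneg[OF 0(1)] \<eta> by simp
next
  case (Suc n)
  have L: "0 < L" using S by simp
  let ?a = "real n * L" and ?b = "real (Suc n) * L"
  have ab: "0 \<le> ?a" "?a \<le> ?b" "?b - ?a = L" using L by (auto simp: algebra_simps)
  obtain e1 e2 where e: "has_energy 0 ?a h e1" "has_energy ?a ?b h e2" "e = e1 + e2"
    by (rule has_energy_split[OF Suc.prems(1) ab(1,2)])
  have t: "in_tube 0 ?a w \<rho> h" "in_tube ?a ?b w \<rho> h" using Suc.prems(2) ab by (auto intro: in_tube_subinterval)
  have wa: "continuous_on {0..L} (path_from w ?a)"
    using continuous_on_path_from[OF w ab(1)] by (auto intro: continuous_on_subset)
  have "min_energy (path_from w ?a) L \<rho>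
      \<le> (1 + \<eta>) * (e2 + min_energy (path_from w ?a) S \<rho>) + (1 + 1 / \<eta>) * (2 * \<rho>)\<^sup>2 / S"
    using has_energy_restart[OF e(2) t(2)]
    unfolding ab(3) by (rule min_energy_anchor[OF wa path_from_0 S \<rho> \<eta>])
  then show ?case using Suc.IH[OF e(1) t(1)] by (simp add: e(3) distrib_left distrib_right add_divide_distrib)
qed

lemma sum_blocks_le_min_energy:
  assumes w: "continuous_on {0..} w" "w 0 = 0" and S: "0 < S" "S \<le> L" and \<rho>: "0 < \<rho>" and \<eta>: "0 < \<eta>" and n: "0 < n"
  shows "(\<Sum>i<n. min_energy (path_from w (real i * L)) L \<rho>)
    \<le> (1 + \<eta>) * (min_energy w (real n * L) \<rho> + (\<Sum>i<n. min_energy (path_from w (real i * L)) S \<rho>))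
      + real n * ((1 + 1 / \<eta>) * (2 * \<rho>)\<^sup>2 / S)"
proof (rule field_le_epsilon)
  fix \<delta>' :: real assume \<delta>': "0 < \<delta>'"
  have \<delta>: "0 < \<delta>' / (1 + \<eta>)" using \<delta>' \<eta> by simp
  have wn: "continuous_on {0..real n * L} w" using w(1) by (auto intro: continuous_on_subset)
  obtain h e where h: "has_energy 0 (real n * L) h e" "in_tube 0 (real n * L) w \<rho> h" "h 0 = 0"
    "e < min_energy w (real n * L) \<rho> + \<delta>' / (1 + \<eta>)"
    by (rule min_energy_approx[OF wn w(2) _ \<rho> \<delta>]) (use S n in auto)
  have "(1 + \<eta>) * e \<le> (1 + \<eta>) * (min_energy w (real n * L) \<rho> + \<delta>' / (1 + \<eta>))"
    using h(4) \<eta> by (intro mult_left_mono) auto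
  also have "\<dots> = (1 + \<eta>) * min_energy w (real n * L) \<rho> + \<delta>'" using \<eta> by (simp add: distrib_left)
  finally show "(\<Sum>i<n. min_energy (path_from w (real i * L)) L \<rho>)
    \<le> (1 + \<eta>) * (min_energy w (real n * L) \<rho> + (\<Sum>i<n. min_energy (path_from w (real i * L)) S \<rho>))
      + real n * ((1 + 1 / \<eta>) * (2 * \<rho>)\<^sup>2 / S) + \<delta>'"
    using sum_blocks_min_energy[OF w(1) S \<rho> \<eta> h(1,2)] by (simp add: distrib_left)
qed

text \<open>Mixing in the proportion \<open>\<epsilon>\<close> of a string of half the radius narrows the tube by \<open>\<epsilon> * \<rho> / 2\<close>, which is
  room for a perturbation of the path.\<close>

lemma min_energy_perturb:
  assumes w: "continuous_on {0..T} w" "w 0 = 0" and w': "continuous_on {0..T} w'" "w' 0 = 0"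
    and T: "0 < T" and \<rho>: "0 < \<rho>" and \<epsilon>: "0 < \<epsilon>" "\<epsilon> \<le> 1"
    and close: "\<And>t. t \<in> {0..T} \<Longrightarrow> \<bar>w' t - w t\<bar> \<le> \<epsilon> * \<rho> / 2"
  shows "min_energy w' T \<rho> \<le> min_energy w T \<rho> + \<epsilon> * min_energy w T (\<rho> / 2)"
proof (rule field_le_epsilon)
  fix \<delta> :: real assume \<delta>: "0 < \<delta>"
  have \<rho>2: "0 < \<rho> / 2" using \<rho> by simp
  have \<delta>2: "0 < \<delta> / 2" using \<delta> by simp
  obtain h e where h: "has_energy 0 T h e" "in_tube 0 T w \<rho> h" "h 0 = 0" "e < min_energy w T \<rho> + \<delta> / 2"
    by (rule min_energy_approx[OF w T \<rho> \<delta>2])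
  obtain g e' where g: "has_energy 0 T g e'" "in_tube 0 T w (\<rho> / 2) g" "g 0 = 0" "e' < min_energy w T (\<rho> / 2) + \<delta> / 2"
    by (rule min_energy_approx[OF w T \<rho>2 \<delta>2])
  obtain e'' where e'': "has_energy 0 T (\<lambda>t. (1 - \<epsilon>) * h t + \<epsilon> * g t) e''" "e'' \<le> (1 - \<epsilon>) * e + \<epsilon> * e'"
    using has_energy_convex[OF h(1) g(1), of \<epsilon>] T \<epsilon> by auto
  have "in_tube 0 T w' \<rho> (\<lambda>t. (1 - \<epsilon>) * h t + \<epsilon> * g t)"
    unfolding in_tube_def
  proof
    fix t assume t: "t \<in> {0..T}"
    have "(1 - \<epsilon>) * h t + \<epsilon> * g t - w' t = (1 - \<epsilon>) * (h t - w t) + \<epsilon> * (g t - w t) + (w t - w' t)"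
      by (simp add: algebra_simps)
    also have "\<bar>\<dots>\<bar> \<le> \<bar>(1 - \<epsilon>) * (h t - w t)\<bar> + \<bar>\<epsilon> * (g t - w t)\<bar> + \<bar>w t - w' t\<bar>" by linarith
    also have "\<dots> = (1 - \<epsilon>) * \<bar>h t - w t\<bar> + \<epsilon> * \<bar>g t - w t\<bar> + \<bar>w t - w' t\<bar>"
      using \<epsilon> by (simp add: abs_mult)
    also have "\<dots> \<le> (1 - \<epsilon>) * \<rho> + \<epsilon> * (\<rho> / 2) + \<epsilon> * \<rho> / 2"
      using h(2) g(2) close[OF t] t \<epsilon> by (intro add_mono mult_left_mono) (auto simp: in_tube_def abs_minus_commute)
    finally show "\<bar>(1 - \<epsilon>) * h t + \<epsilon> * g t - w' t\<bar> \<le> \<rho>" by (simp add: algebra_simps)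
  qed
  then have "min_energy w' T \<rho> \<le> e''" by (rule min_energy_le[OF e''(1)]) (use h g in simp)
  also have "\<dots> \<le> (1 - \<epsilon>) * e + \<epsilon> * e'" by fact
  also have "\<dots> \<le> e + \<epsilon> * e'" using \<epsilon> has_energy_nonneg[OF h(1)] by (simp add: algebra_simps)
  also have "\<dots> \<le> (min_energy w T \<rho> + \<delta> / 2) + \<epsilon> * (min_energy w T (\<rho> / 2) + \<delta> / 2)"
    using h(4) g(4) \<epsilon> by (intro add_mono mult_left_mono) auto
  also have "\<dots> \<le> (min_energy w T \<rho> + \<delta> / 2) + (\<epsilon> * min_energy w T (\<rho> / 2) + 1 * (\<delta> / 2))"
    unfolding distrib_left using mult_right_mono[OF \<epsilon>(2), of "\<delta> / 2"] \<delta> by (intro add_mono) simp_all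
  finally show "min_energy w' T \<rho> \<le> min_energy w T \<rho> + \<epsilon> * min_energy w T (\<rho> / 2) + \<delta>" by simp
qed

text \<open>Applying the perturbation bound in both directions needs an energy bound for \<open>w'\<close> at radius \<open>\<rho> / 2\<close>; a
  string of radius \<open>\<rho> / 4\<close> around \<open>w\<close> provides it.\<close>

lemma min_energy_close:
  assumes w: "continuous_on {0..T} w" "w 0 = 0" and w': "continuous_on {0..T} w'" "w' 0 = 0"
    and T: "0 < T" and \<rho>: "0 < \<rho>" and \<epsilon>: "0 < \<epsilon>" "\<epsilon> \<le> 1 / 2"
    and close: "\<And>t. t \<in> {0..T} \<Longrightarrow> \<bar>w' t - w t\<bar> \<le> \<epsilon> * \<rho> / 2"
  shows "\<bar>min_energy w' T \<rho> - min_energy w T \<rho>\<bar> \<le> \<epsilon> * min_energy w T (\<rho> / 4)"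
proof -
  have close': "\<bar>w t - w' t\<bar> \<le> \<epsilon> * \<rho> / 2" if "t \<in> {0..T}" for t
    using close[OF that] by (simp add: abs_minus_commute)
  have r4: "min_energy w T (\<rho> / 2) \<le> min_energy w T (\<rho> / 4)"
    by (rule min_energy_antimono_radius[OF w T]) (use \<rho> in auto)
  have r4': "min_energy w' T (\<rho> / 2) \<le> min_energy w T (\<rho> / 4)"
  proof (rule field_le_epsilon)
    fix \<delta> :: real assume \<delta>: "0 < \<delta>"
    obtain h e where h: "has_energy 0 T h e" "in_tube 0 T w (\<rho> / 4) h" "h 0 = 0" "e < min_energy w T (\<rho> / 4) + \<delta>"
      by (rule min_energy_approx[OF w T _ \<delta>, of "\<rho> / 4"]) (use \<rho> in auto)
    have "in_tube 0 T w' (\<rho> / 2) h"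
      unfolding in_tube_def
    proof
      fix t assume t: "t \<in> {0..T}"
      have "\<bar>h t - w t\<bar> \<le> \<rho> / 4" using h(2) t by (auto simp: in_tube_def)
      moreover have "\<epsilon> * \<rho> / 2 \<le> \<rho> / 4" using \<epsilon> \<rho> by simp
      ultimately show "\<bar>h t - w' t\<bar> \<le> \<rho> / 2" using close[OF t] by linarith
    qed
    then have "min_energy w' T (\<rho> / 2) \<le> e" by (rule min_energy_le[OF h(1) _ h(3)])
    then show "min_energy w' T (\<rho> / 2) \<le> min_energy w T (\<rho> / 4) + \<delta>" using h(4) by simp
  qed
  have "min_energy w' T \<rho> \<le> min_energy w T \<rho> + \<epsilon> * min_energy w T (\<rho> / 2)"
    by (rule min_energy_perturb[OF w w' T \<rho> _ _ close]) (use \<epsilon> in auto)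
  moreover have "min_energy w T \<rho> \<le> min_energy w' T \<rho> + \<epsilon> * min_energy w' T (\<rho> / 2)"
    by (rule min_energy_perturb[OF w' w T \<rho> _ _ close']) (use \<epsilon> in auto)
  moreover have "\<epsilon> * min_energy w T (\<rho> / 2) \<le> \<epsilon> * min_energy w T (\<rho> / 4)"
    "\<epsilon> * min_energy w' T (\<rho> / 2) \<le> \<epsilon> * min_energy w T (\<rho> / 4)"
    using r4 r4' \<epsilon> by (auto intro: mult_left_mono)
  ultimately show ?thesis by linarith
qed

lemma tendsto_min_energy:
  assumes lim: "uniform_limit {0..T} v w F"
    and v: "\<And>n. continuous_on {0..T} (v n)" "\<And>n. v n 0 = 0"
    and w: "continuous_on {0..T} w" "w 0 = 0" and T: "0 < T" and \<rho>: "0 < \<rho>"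
  shows "((\<lambda>n. min_energy (v n) T \<rho>) \<longlongrightarrow> min_energy w T \<rho>) F"
proof (rule tendstoI)
  fix e :: real assume e: "0 < e"
  define K where "K = min_energy w T (\<rho> / 4)"
  have K: "0 \<le> K" unfolding K_def by (rule min_energy_nonneg[OF w T]) (use \<rho> in simp)
  define \<epsilon> where "\<epsilon> = min (1 / 2) (e / (2 * (K + 1)))"
  have \<epsilon>: "0 < \<epsilon>" "\<epsilon> \<le> 1 / 2" "\<epsilon> * K < e"
  proof -
    show "0 < \<epsilon>" using e K by (auto simp: \<epsilon>_def)
    show "\<epsilon> \<le> 1 / 2" unfolding \<epsilon>_def by (rule min.cobounded1)
    have "\<epsilon> * K \<le> e / (2 * (K + 1)) * K" using K by (intro mult_right_mono) (auto simp: \<epsilon>_def)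
    also have "\<dots> < e"
    proof -
      have "e * K < e * (2 * (K + 1))" using e K by (intro mult_strict_left_mono) auto
      then show ?thesis using e K by (simp add: field_simps)
    qed
    finally show "\<epsilon> * K < e" .
  qed
  have "0 < \<epsilon> * \<rho> / 2" using \<epsilon> \<rho> by simp
  then have "\<forall>\<^sub>F n in F. \<forall>t\<in>{0..T}. dist (v n t) (w t) < \<epsilon> * \<rho> / 2"
    using lim unfolding uniform_limit_iff by blast
  then show "\<forall>\<^sub>F n in F. dist (min_energy (v n) T \<rho>) (min_energy w T \<rho>) < e"
  proof eventually_elim
    case (elim n)
    have "\<bar>min_energy (v n) T \<rho> - min_energy w T \<rho>\<bar> \<le> \<epsilon> * K"
      unfolding K_def
      by (rule min_energy_close[OF w v T \<rho> \<epsilon>(1,2)]) (use elim in \<open>auto simp: dist_real_def less_imp_le\<close>)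
    then show ?case using \<epsilon>(3) by (simp add: dist_real_def)
  qed
qed

lemma sup_norm_le_iff_in_tube:
  assumes "continuous_on {0..T} h" "continuous_on {0..T} w" "0 \<le> T"
  shows "sup_norm T (\<lambda>t. h t - w t) \<le> \<rho> \<longleftrightarrow> in_tube 0 T w \<rho> h"
proof -
  have "compact ((\<lambda>t. \<bar>h t - w t\<bar>) ` {0..T})"
    by (intro compact_continuous_image continuous_intros assms) auto
  then have "bdd_above ((\<lambda>t. \<bar>h t - w t\<bar>) ` {0..T})" by (intro bounded_imp_bdd_above compact_imp_bounded)
  then show ?thesis
    unfolding sup_norm_def in_tube_def using assms(3) by (subst cSUP_le_iff) auto
qed

lemma INF_energy_norm:
  assumes T: "0 \<le> T" and ac: "\<And>h. h \<in> H \<Longrightarrow> absolutely_continuous_on 0 T h"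
    and ne: "\<exists>h\<in>H. \<exists>e. has_energy 0 T h e"
  shows "(INF h\<in>H. energy_norm T h) = ennreal (sqrt (Inf {e. \<exists>h. has_energy 0 T h e \<and> h \<in> H}))"
    (is "_ = ennreal (sqrt (Inf ?E))")
proof (rule antisym)
  have bdd: "bdd_below ?E" using has_energy_nonneg by (intro bdd_belowI[of _ 0]) auto
  have E: "?E \<noteq> {}" using ne by blast
  have "0 \<le> Inf ?E" by (rule cInf_greatest[OF E]) (use has_energy_nonneg in auto)
  show "ennreal (sqrt (Inf ?E)) \<le> (INF h\<in>H. energy_norm T h)"
  proof (rule INF_greatest)
    fix h assume h: "h \<in> H"
    consider "energy_norm T h = \<top>" | e where "has_energy 0 T h e" "energy_norm T h = ennreal (sqrt e)"
      using energy_norm_cases(1)[OF ac[OF h] T] by blast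
    then show "ennreal (sqrt (Inf ?E)) \<le> energy_norm T h"
    proof cases
      case 2
      then have "Inf ?E \<le> e" using h by (intro cInf_lower bdd) auto
      then show ?thesis using 2(2) by (simp add: ennreal_leI)
    qed simp
  qed
  show "(INF h\<in>H. energy_norm T h) \<le> ennreal (sqrt (Inf ?E))"
  proof (rule dense_ge)
    fix y assume "ennreal (sqrt (Inf ?E)) < y"
    show "(INF h\<in>H. energy_norm T h) \<le> y"
    proof (cases "y = \<top>")
      case False
      then obtain z where z: "0 \<le> z" "y = ennreal z" by (cases y) auto
      then have "sqrt (Inf ?E) < z" using \<open>ennreal (sqrt (Inf ?E)) < y\<close> \<open>0 \<le> Inf ?E\<close>
        by (simp add: ennreal_less_iff)
      then have "Inf ?E < z\<^sup>2" using z real_sqrt_less_iff[of "Inf ?E" "z\<^sup>2"] by (simp add: real_sqrt_unique)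
      from cInf_lessD[OF E this] obtain e h where e: "has_energy 0 T h e" "h \<in> H" "e < z\<^sup>2"
        by auto
      have "sqrt e \<le> z" using e(3) z by (intro real_le_lsqrt) (auto simp: less_imp_le has_energy_nonneg[OF e(1)])
      then have "energy_norm T h \<le> y"
        using energy_norm_cases(2)[OF ac[OF e(2)] T e(1)] z by (simp add: ennreal_leI)
      then show ?thesis using e(2) by (meson INF_lower order_trans)
    qed simp
  qed
qed

lemma I_free_eq_min_energy:
  assumes w: "continuous_on {0..T} w" "w 0 = 0" and T: "0 < T" and \<rho>: "0 < \<rho>"
  shows "I_free w T \<rho> = ennreal (sqrt (min_energy w T \<rho>))"
proof -
  let ?H = "{h. absolutely_continuous_on 0 T h \<and> sup_norm T (\<lambda>t. h t - w t) \<le> \<rho> \<and> h 0 = 0}"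
  have iff: "h \<in> ?H \<longleftrightarrow> absolutely_continuous_on 0 T h \<and> in_tube 0 T w \<rho> h \<and> h 0 = 0" for h
    using sup_norm_le_iff_in_tube[OF _ w(1)] T absolutely_continuous_on_imp_continuous_on by auto
  have ac: "has_energy 0 T h e \<Longrightarrow> absolutely_continuous_on 0 T h" for h e by (simp add: has_energy_def)
  have "I_free w T \<rho> = ennreal (sqrt (Inf {e. \<exists>h. has_energy 0 T h e \<and> h \<in> ?H}))"
    unfolding I_free_def
    by (rule INF_energy_norm) (use T feasible_string_exists[OF w T \<rho>] ac iff in auto)
  also have "{e. \<exists>h. has_energy 0 T h e \<and> h \<in> ?H} = {e. \<exists>h. has_energy 0 T h e \<and> in_tube 0 T w \<rho> h \<and> h 0 = 0}"
    unfolding iff using ac by blast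
  finally show ?thesis by (simp add: min_energy_def)
qed

lemma I_fixed_eq_min_energy_fixed:
  assumes w: "continuous_on {0..} w" "w 0 = 0" and T: "0 < T" and \<rho>: "0 < \<rho>"
  shows "I_fixed w T \<rho> = ennreal (sqrt (min_energy_fixed w T \<rho>))"
proof -
  let ?H = "{h. absolutely_continuous_on 0 T h \<and> sup_norm T (\<lambda>t. h t - w t) \<le> \<rho> \<and> h 0 = 0 \<and> h T = w T}"
  have wT: "continuous_on {0..T} w" using w(1) by (auto intro: continuous_on_subset)
  have iff: "h \<in> ?H \<longleftrightarrow> absolutely_continuous_on 0 T h \<and> in_tube 0 T w \<rho> h \<and> h 0 = 0 \<and> h T = w T" for h
    using sup_norm_le_iff_in_tube[OF _ wT] T absolutely_continuous_on_imp_continuous_on by auto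
  have ac: "has_energy 0 T h e \<Longrightarrow> absolutely_continuous_on 0 T h" for h e by (simp add: has_energy_def)
  have "I_fixed w T \<rho> = ennreal (sqrt (Inf {e. \<exists>h. has_energy 0 T h e \<and> h \<in> ?H}))"
    unfolding I_fixed_def
    by (rule INF_energy_norm) (use T feasible_fixed_string_exists[OF w T \<rho>] ac iff in auto)
  also have "{e. \<exists>h. has_energy 0 T h e \<and> h \<in> ?H} =
      {e. \<exists>h. has_energy 0 T h e \<and> in_tube 0 T w \<rho> h \<and> h 0 = 0 \<and> h T = w T}"
    unfolding iff using ac by blast
  finally show ?thesis by (simp add: min_energy_fixed_def)
qed

lemma path_from_path_from: "path_from (path_from w s) a = path_from w (s + a)"
  by (rule ext) (simp add: path_from_def add.assoc)

text \<open>Each block string is bent onto the path during the last stretch of length \<open>S\<close> of its block, and then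
  the strings are glued.\<close>

lemma min_energy_le_sum_blocks:
  assumes w: "continuous_on {0..} w" "w 0 = 0" and S: "0 < S" "S \<le> L" and \<rho>: "0 < \<rho>" and \<eta>: "0 < \<eta>" and n: "0 < n"
  shows "min_energy w (real n * L) \<rho> \<le>
    (1 + \<eta>) * ((\<Sum>i<n. min_energy (path_from w (real i * L)) L \<rho>)
      + (\<Sum>i<n. min_energy (path_from w (real i * L + (L - S))) S (\<rho> / 2)))
    + real n * ((1 + 1 / \<eta>) * (2 * \<rho>)\<^sup>2 / S)"
proof -
  have L: "0 < L" using S by simp
  obtain n' where n': "n = Suc n'" using n by (cases n) auto
  have "min_energy w (real n * L) \<rho> \<le> min_energy_fixed w (real n * L) \<rho>"
    by (rule min_energy_le_fixed[OF w _ \<rho>]) (use n L in simp)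
  also have "\<dots> \<le> (\<Sum>i<n. min_energy_fixed (path_from w (real i * L)) L \<rho>)"
    unfolding n' by (rule min_energy_fixed_sum_blocks[OF w L \<rho>])
  also have "\<dots> \<le> (\<Sum>i<n. (1 + \<eta>) * (min_energy (path_from w (real i * L)) L \<rho>
      + min_energy (path_from w (real i * L + (L - S))) S (\<rho> / 2)) + (1 + 1 / \<eta>) * (2 * \<rho>)\<^sup>2 / S)"
  proof (rule sum_mono)
    fix i assume "i \<in> {..<n}"
    have wi: "continuous_on {0..} (path_from w (real i * L))"
      by (rule continuous_on_path_from[OF w(1)]) (use L in simp)
    have eq: "L - (L - S) = S" by simp
    have "min_energy_fixed (path_from w (real i * L)) L \<rho>
        \<le> (1 + \<eta>) * (min_energy (path_from w (real i * L)) L \<rho>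
          + min_energy (path_from (path_from w (real i * L)) (L - S)) (L - (L - S)) (\<rho> / 2))
        + (1 + 1 / \<eta>) * (2 * \<rho>)\<^sup>2 / (L - (L - S))"
      by (rule min_energy_fixed_le_free[OF wi path_from_0]) (use S \<rho> \<eta> in auto)
    then show "min_energy_fixed (path_from w (real i * L)) L \<rho> \<le> (1 + \<eta>) * (min_energy (path_from w (real i * L)) L \<rho>
      + min_energy (path_from w (real i * L + (L - S))) S (\<rho> / 2)) + (1 + 1 / \<eta>) * (2 * \<rho>)\<^sup>2 / S"
      unfolding path_from_path_from eq .
  qed
  also have "\<dots> = (1 + \<eta>) * ((\<Sum>i<n. min_energy (path_from w (real i * L)) L \<rho>)
      + (\<Sum>i<n. min_energy (path_from w (real i * L + (L - S))) S (\<rho> / 2)))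
    + real n * ((1 + 1 / \<eta>) * (2 * \<rho>)\<^sup>2 / S)"
    by (simp add: sum.distrib sum_distrib_left[symmetric])
  finally show ?thesis .
qed

section \<open>Minimal energies over blocks of a Wiener process\<close>

text \<open>The arguments \<open>x j\<close> are the increments of a path over the cells of the equidistant grid with \<open>n\<close> cells on
  \<open>[0, T]\<close>; increments, unlike values, are independent for the Wiener process.\<close>

definition energy_of_increments :: "nat \<Rightarrow> real \<Rightarrow> real \<Rightarrow> (nat \<Rightarrow> real) \<Rightarrow> real" where
  "energy_of_increments n T \<rho> x = min_energy (bernstein_path n T (\<lambda>k. \<Sum>j<k. x j)) T \<rho>"

lemma continuous_on_bernstein_path: "continuous_on S (bernstein_path n T x)"
  unfolding bernstein_path_def[abs_def] Bernstein_def divide_inverse by (intro continuous_intros)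

lemma bernstein_path_diff_le:
  assumes "0 < T" "t \<in> {0..T}"
  shows "\<bar>bernstein_path n T x t - bernstein_path n T y t\<bar> \<le> (\<Sum>k\<le>n. \<bar>x k - y k\<bar>)"
proof -
  have s: "0 \<le> t / T" "t / T \<le> 1" using assms by auto
  have B0: "0 \<le> Bernstein n k (t / T)" for k by (rule Bernstein_nonneg[OF s])
  have B1: "Bernstein n k (t / T) \<le> 1" if "k \<le> n" for k
  proof -
    have "Bernstein n k (t / T) \<le> (\<Sum>k\<le>n. Bernstein n k (t / T))"
      by (rule member_le_sum) (use that B0 in auto)
    then show ?thesis by simp
  qed
  have "bernstein_path n T x t - bernstein_path n T y t = (\<Sum>k\<le>n. (x k - y k) * Bernstein n k (t / T))"
    by (simp add: bernstein_path_def sum_subtractf left_diff_distrib)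
  also have "\<bar>\<dots>\<bar> \<le> (\<Sum>k\<le>n. \<bar>(x k - y k) * Bernstein n k (t / T)\<bar>)" by (rule sum_abs)
  also have "\<dots> \<le> (\<Sum>k\<le>n. \<bar>x k - y k\<bar>)"
    using B0 B1 by (intro sum_mono) (auto simp: abs_mult intro!: mult_left_le)
  finally show ?thesis .
qed

lemma continuous_energy_of_increments:
  assumes T: "0 < T" and \<rho>: "0 < \<rho>"
  shows "continuous_on UNIV (energy_of_increments n T \<rho>)"
  unfolding continuous_on_def
proof
  fix x :: "nat \<Rightarrow> real"
  define G where "G y = (\<Sum>k\<le>n. \<bar>(\<Sum>j<k. y j) - (\<Sum>j<k. x j)\<bar>)" for y :: "nat \<Rightarrow> real"
  have "continuous_on UNIV G"
    unfolding G_def by (intro continuous_intros continuous_on_product_coordinates)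
  then have "(G \<longlongrightarrow> G x) (at x within UNIV)" by (simp add: continuous_on_def)
  then have G: "(G \<longlongrightarrow> 0) (at x within UNIV)" by (simp add: G_def)
  show "(energy_of_increments n T \<rho> \<longlongrightarrow> energy_of_increments n T \<rho> x) (at x within UNIV)"
    unfolding energy_of_increments_def[abs_def]
  proof (rule tendsto_min_energy[OF _ _ _ _ _ T \<rho>])
    show "uniform_limit {0..T} (\<lambda>y. bernstein_path n T (\<lambda>k. \<Sum>j<k. y j)) (bernstein_path n T (\<lambda>k. \<Sum>j<k. x j))
      (at x within UNIV)"
      unfolding uniform_limit_iff
    proof (intro allI impI)
      fix e :: real assume "0 < e"
      then have "\<forall>\<^sub>F y in at x within UNIV. G y < e" using order_tendstoD(2)[OF G] by simp
      then show "\<forall>\<^sub>F y in at x within UNIV. \<forall>t\<in>{0..T}.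
          dist (bernstein_path n T (\<lambda>k. \<Sum>j<k. y j) t) (bernstein_path n T (\<lambda>k. \<Sum>j<k. x j) t) < e"
      proof (eventually_elim, intro ballI)
        fix y t assume "G y < e" "t \<in> {0..T}"
        then show "dist (bernstein_path n T (\<lambda>k. \<Sum>j<k. y j) t) (bernstein_path n T (\<lambda>k. \<Sum>j<k. x j) t) < e"
          using bernstein_path_diff_le[OF T, of t n "\<lambda>k. \<Sum>j<k. y j" "\<lambda>k. \<Sum>j<k. x j"]
          by (simp add: dist_real_def G_def)
      qed
    qed
  qed (auto simp: bernstein_path_0 continuous_on_bernstein_path)
qed

lemma measurable_energy_of_increments:
  fixes s :: "nat \<Rightarrow> 'i"
  assumes T: "0 < T" and \<rho>: "0 < \<rho>" and I: "\<And>j. j < n \<Longrightarrow> s j \<in> I"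
  shows "(\<lambda>x. energy_of_increments n T \<rho> (\<lambda>j. x (s j))) \<in> borel_measurable (PiM I (\<lambda>_. borel))"
proof -
  define ext where "ext x j = (if j < n then x (s j) else 0)" for x :: "'i \<Rightarrow> real" and j
  have "ext \<in> PiM I (\<lambda>_. borel) \<rightarrow>\<^sub>M PiM UNIV (\<lambda>_. borel)"
  proof (rule measurable_PiM_single')
    show "(\<lambda>x. ext x j) \<in> PiM I (\<lambda>_. borel) \<rightarrow>\<^sub>M borel" for j
      using I by (cases "j < n") (auto simp: ext_def intro!: measurable_component_singleton)
  qed auto
  then have "ext \<in> PiM I (\<lambda>_. borel) \<rightarrow>\<^sub>M borel"
    using measurable_cong_sets[OF refl sets_PiM_equal_borel] by blast
  moreover have "energy_of_increments n T \<rho> \<in> borel_measurable borel"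
    by (rule borel_measurable_continuous_onI[OF continuous_energy_of_increments[OF T \<rho>]])
  ultimately have "(\<lambda>x. energy_of_increments n T \<rho> (ext x)) \<in> borel_measurable (PiM I (\<lambda>_. borel))"
    by (rule measurable_compose)
  moreover have "energy_of_increments n T \<rho> (ext x) = energy_of_increments n T \<rho> (\<lambda>j. x (s j))" for x
  proof -
    have "(\<Sum>k\<le>n. (\<Sum>j<k. ext x j) * Bernstein n k (t / T)) = (\<Sum>k\<le>n. (\<Sum>j<k. x (s j)) * Bernstein n k (t / T))" for t
      by (intro sum.cong refl arg_cong2[where f = "(*)"]) (auto simp: ext_def)
    then show ?thesis by (simp add: energy_of_increments_def bernstein_path_def[abs_def])
  qed
  ultimately show ?thesis by simp
qed

context wiener_process
begin

definition increment :: "real \<Rightarrow> real \<Rightarrow> nat \<Rightarrow> 'a \<Rightarrow> real" where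
  "increment a \<delta> j \<omega> = W (a + real (Suc j) * \<delta>) \<omega> - W (a + real j * \<delta>) \<omega>"

definition block_energy :: "real \<Rightarrow> real \<Rightarrow> real \<Rightarrow> 'a \<Rightarrow> real" where
  "block_energy a T \<rho> \<omega> = min_energy (path_from (\<lambda>t. W t \<omega>) a) T \<rho>"

definition block_approx :: "nat \<Rightarrow> real \<Rightarrow> real \<Rightarrow> real \<Rightarrow> 'a \<Rightarrow> real" where
  "block_approx n a T \<rho> \<omega> = energy_of_increments (Suc n) T \<rho> (\<lambda>j. increment a (T / real (Suc n)) j \<omega>)"

lemma measurable_increment: "0 \<le> a \<Longrightarrow> 0 < \<delta> \<Longrightarrow> increment a \<delta> j \<in> borel_measurable M"
  unfolding increment_def[abs_def] by (intro borel_measurable_diff measurable_W) auto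

lemma indep_increments: "0 \<le> a \<Longrightarrow> 0 < \<delta> \<Longrightarrow> indep_vars (\<lambda>_. borel) (increment a \<delta>) {..<n}"
  unfolding increment_def[abs_def]
  by (rule independent_increments[where u = "\<lambda>j. a + real j * \<delta>"]) auto

lemma distr_increment:
  assumes "0 \<le> a" "0 < \<delta>"
  shows "distr M borel (increment a \<delta> j) = density lborel (\<lambda>x. ennreal (normal_density 0 (sqrt \<delta>) x))"
proof -
  have "distributed M lborel (increment a \<delta> j)
      (normal_density 0 (sqrt ((a + real (Suc j) * \<delta>) - (a + real j * \<delta>))))"
    unfolding increment_def[abs_def] by (rule normal_increments) (use assms in auto)
  moreover have "(a + real (Suc j) * \<delta>) - (a + real j * \<delta>) = \<delta>" by (simp add: algebra_simps)
  ultimately have "distributed M lborel (increment a \<delta> j) (normal_density 0 (sqrt \<delta>))" by simp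
  from distributed_distr_eq_density[OF this]
  have "distr M lborel (increment a \<delta> j) = density lborel (\<lambda>x. ennreal (normal_density 0 (sqrt \<delta>) x))" .
  moreover have "distr M lborel (increment a \<delta> j) = distr M borel (increment a \<delta> j)"
    by (rule distr_cong) auto
  ultimately show ?thesis by simp
qed

lemma distr_increments:
  assumes "0 \<le> a" "0 < \<delta>" "0 < n"
  shows "distr M (PiM {..<n} (\<lambda>_. borel)) (\<lambda>\<omega>. \<lambda>j\<in>{..<n}. increment a \<delta> j \<omega>) =
    PiM {..<n} (\<lambda>_. density lborel (\<lambda>x. ennreal (normal_density 0 (sqrt \<delta>) x)))"
proof -
  have "distr M (PiM {..<n} (\<lambda>_. borel)) (\<lambda>\<omega>. \<lambda>j\<in>{..<n}. increment a \<delta> j \<omega>) =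
      PiM {..<n} (\<lambda>j. distr M borel (increment a \<delta> j))"
    using indep_vars_iff_distr_eq_PiM[where I = "{..<n}" and M' = "\<lambda>_. borel" and X = "increment a \<delta>"]
      indep_increments[OF assms(1,2), of n] measurable_increment[OF assms(1,2)] assms(3) by blast
  then show ?thesis by (simp add: distr_increment[OF assms(1,2)])
qed

lemma block_approx_eq_path:
  "block_approx n a T \<rho> \<omega> =
    min_energy (bernstein_path (Suc n) T (\<lambda>k. path_from (\<lambda>t. W t \<omega>) a (T * real k / real (Suc n)))) T \<rho>"
proof -
  have "(\<Sum>j<k. increment a (T / real (Suc n)) j \<omega>) = path_from (\<lambda>t. W t \<omega>) a (T * real k / real (Suc n))" for k
    using sum_lessThan_telescope[of "\<lambda>j. W (a + real j * (T / real (Suc n))) \<omega>" k]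
    by (simp add: increment_def path_from_def mult.commute)
  then show ?thesis unfolding block_approx_def energy_of_increments_def by simp
qed

lemma continuous_path_from:
  assumes "\<omega> \<in> space M" "0 \<le> a"
  shows "continuous_on {0..T} (path_from (\<lambda>t. W t \<omega>) a)"
  using continuous_on_path_from[OF continuous_paths[OF assms(1)] assms(2)] by (auto intro: continuous_on_subset)

lemma block_approx_tendsto:
  assumes \<omega>: "\<omega> \<in> space M" and a: "0 \<le> a" and T: "0 < T" and \<rho>: "0 < \<rho>"
  shows "(\<lambda>n. block_approx n a T \<rho> \<omega>) \<longlonglongrightarrow> block_energy a T \<rho> \<omega>"
proof -
  let ?w = "path_from (\<lambda>t. W t \<omega>) a"
  have "(\<lambda>n. min_energy (bernstein_path n T (\<lambda>k. ?w (T * real k / real n))) T \<rho>) \<longlonglongrightarrow> min_energy ?w T \<rho>"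
    by (rule tendsto_min_energy[OF bernstein_path_uniform_limit _ _ _ _ T \<rho>])
      (use T continuous_path_from[OF \<omega> a] in
        \<open>auto simp: bernstein_path_0 path_from_0 continuous_on_bernstein_path\<close>)
  from LIMSEQ_Suc[OF this] show ?thesis by (simp only: block_approx_eq_path block_energy_def)
qed

lemma measurable_block_approx:
  assumes a: "0 \<le> a" and T: "0 < T" and \<rho>: "0 < \<rho>"
  shows "block_approx n a T \<rho> \<in> borel_measurable M"
proof -
  have \<delta>: "0 < T / real (Suc n)" using T by simp
  have "(\<lambda>\<omega>. \<lambda>j\<in>{..<Suc n}. increment a (T / real (Suc n)) j \<omega>) \<in> M \<rightarrow>\<^sub>M PiM {..<Suc n} (\<lambda>_. borel)"
    by (rule measurable_restrict) (rule measurable_increment[OF a \<delta>])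
  from measurable_compose[OF this measurable_energy_of_increments[OF T \<rho>, of "Suc n" "\<lambda>j. j"]]
  have "(\<lambda>\<omega>. energy_of_increments (Suc n) T \<rho> (\<lambda>j. (\<lambda>j\<in>{..<Suc n}. increment a (T / real (Suc n)) j \<omega>) j))
      \<in> borel_measurable M" by simp
  moreover have "energy_of_increments (Suc n) T \<rho> (\<lambda>j. (\<lambda>j\<in>{..<Suc n}. increment a (T / real (Suc n)) j \<omega>) j)
      = block_approx n a T \<rho> \<omega>" for \<omega>
    unfolding block_approx_def energy_of_increments_def bernstein_path_def
    by (intro arg_cong[where f = "\<lambda>w. min_energy w T \<rho>"] ext sum.cong refl arg_cong2[where f = "(*)"]) auto
  ultimately show ?thesis by simp
qed

lemma measurable_block_energy:
  assumes "0 \<le> a" "0 < T" "0 < \<rho>"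
  shows "block_energy a T \<rho> \<in> borel_measurable M"
  by (rule borel_measurable_LIMSEQ_real[OF block_approx_tendsto measurable_block_approx]) (use assms in auto)

text \<open>Increments over cells of the same length are independent and equally distributed, wherever
  the block starts.\<close>

lemma distr_block_approx:
  assumes "0 \<le> a" "0 \<le> b" "0 < T" "0 < \<rho>"
  shows "distr M borel (block_approx n a T \<rho>) = distr M borel (block_approx n b T \<rho>)"
proof -
  let ?\<delta> = "T / real (Suc n)"
  let ?\<Phi> = "\<lambda>x. energy_of_increments (Suc n) T \<rho> (\<lambda>j. x j)"
  have \<delta>: "0 < ?\<delta>" using assms by simp
  have eq: "block_approx n c T \<rho> = ?\<Phi> \<circ> (\<lambda>\<omega>. \<lambda>j\<in>{..<Suc n}. increment c ?\<delta> j \<omega>)" for c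
    unfolding block_approx_def[abs_def] energy_of_increments_def bernstein_path_def comp_def
    by (intro ext arg_cong[where f = "\<lambda>w. min_energy w T \<rho>"] sum.cong refl arg_cong2[where f = "(*)"]) auto
  have "distr M borel (block_approx n c T \<rho>) =
      distr (PiM {..<Suc n} (\<lambda>_. density lborel (\<lambda>x. ennreal (normal_density 0 (sqrt ?\<delta>) x)))) borel ?\<Phi>"
    if c: "0 \<le> c" for c
    unfolding eq distr_increments[OF c \<delta> zero_less_Suc, symmetric]
    by (rule distr_distr[symmetric])
      (use measurable_energy_of_increments[OF assms(3,4), of "Suc n" "\<lambda>j. j" "{..<Suc n}"]
         measurable_increment[OF c \<delta>] in \<open>auto intro!: measurable_restrict\<close>)
  then show ?thesis using assms by simp
qed

lemma char_distr_block_energy: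
  assumes "0 \<le> a" "0 < T" "0 < \<rho>"
  shows "(\<lambda>n. char (distr M borel (block_approx n a T \<rho>)) s) \<longlonglongrightarrow> char (distr M borel (block_energy a T \<rho>)) s"
proof -
  note [measurable] = measurable_block_energy[OF assms] measurable_block_approx[OF assms]
  have "(\<lambda>n. CLINT \<omega>|M. iexp (s * block_approx n a T \<rho> \<omega>)) \<longlonglongrightarrow> (CLINT \<omega>|M. iexp (s * block_energy a T \<rho> \<omega>))"
    by (rule integral_dominated_convergence[where w = "\<lambda>_. 1"])
      (auto intro!: tendsto_intros AE_I2 block_approx_tendsto assms)
  then show ?thesis by (simp add: char_def integral_distr)
qed

text \<open>Stationarity of the approximations passes to the limit through characteristic functions.\<close>

lemma distr_block_energy:
  assumes "0 \<le> a" "0 \<le> b" "0 < T" "0 < \<rho>"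
  shows "distr M borel (block_energy a T \<rho>) = distr M borel (block_energy b T \<rho>)"
proof (rule Levy_uniqueness)
  show "real_distribution (distr M borel (block_energy a T \<rho>))" "real_distribution (distr M borel (block_energy b T \<rho>))"
    using assms by (auto intro!: real_distribution_distr measurable_block_energy)
  show "char (distr M borel (block_energy a T \<rho>)) = char (distr M borel (block_energy b T \<rho>))"
  proof
    fix s
    show "char (distr M borel (block_energy a T \<rho>)) s = char (distr M borel (block_energy b T \<rho>)) s"
      using char_distr_block_energy[of a T \<rho> s] char_distr_block_energy[of b T \<rho> s] assms
      unfolding distr_block_approx[OF assms] by (intro LIMSEQ_unique)
  qed
qed

text \<open>Since the second block starts at a multiple of the block length, the cells of both blocks belong to one
  common grid, and the two energies are functions of disjoint sets of independent increments.\<close>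

lemma indep_block_approx:
  assumes a: "0 \<le> a" and m: "1 \<le> m" and T: "0 < T" and \<rho>: "0 < \<rho>"
  shows "indep_var borel (block_approx n a T \<rho>) borel (block_approx n (a + real m * T) T \<rho>)"
proof -
  let ?N = "Suc n" and ?\<delta> = "T / real (Suc n)"
  let ?A = "{..<?N}" and ?B = "{m * ?N..<m * ?N + ?N}"
  have \<delta>: "0 < ?\<delta>" using T by simp
  have disj: "?A \<inter> ?B = {}"
  proof -
    have N: "?N \<le> m * ?N" using mult_le_mono1[OF m, of ?N] unfolding mult_1 .
    have "x < m * ?N" if "x < ?N" for x by (rule less_le_trans[OF that N])
    then show ?thesis unfolding disjoint_iff by (metis atLeastLessThan_iff lessThan_iff not_le)
  qed
  have shift: "increment (a + real m * T) ?\<delta> j \<omega> = increment a ?\<delta> (m * ?N + j) \<omega>" for j \<omega>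
  proof -
    have "real ?N * ?\<delta> = T" by (simp only: times_divide_eq_right nonzero_mult_div_cancel_left of_nat_eq_0_iff nat.distinct not_False_eq_True)
    then have T': "real m * T = real (m * ?N) * ?\<delta>" by (simp only: of_nat_mult mult.assoc)
    have "a + real m * T + real i * ?\<delta> = a + real (m * ?N + i) * ?\<delta>" for i
      unfolding T' of_nat_add distrib_right by (simp only: add.assoc)
    then show ?thesis unfolding increment_def by (simp only: add_Suc_right[symmetric])
  qed
  have "indep_var (PiM ?A (\<lambda>_. borel)) (\<lambda>\<omega>. restrict (\<lambda>j. increment a ?\<delta> j \<omega>) ?A)
      (PiM ?B (\<lambda>_. borel)) (\<lambda>\<omega>. restrict (\<lambda>j. increment a ?\<delta> j \<omega>) ?B)"
    by (rule indep_var_restrict[OF indep_increments[OF a \<delta>, of "m * ?N + ?N"] disj]) auto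
  from indep_var_compose[OF this
      measurable_energy_of_increments[OF T \<rho>, of ?N "\<lambda>j. j"]
      measurable_energy_of_increments[OF T \<rho>, of ?N "\<lambda>j. m * ?N + j"]]
  have "indep_var borel ((\<lambda>x. energy_of_increments ?N T \<rho> (\<lambda>j. x j)) \<circ> (\<lambda>\<omega>. restrict (\<lambda>j. increment a ?\<delta> j \<omega>) ?A))
      borel ((\<lambda>x. energy_of_increments ?N T \<rho> (\<lambda>j. x (m * ?N + j))) \<circ> (\<lambda>\<omega>. restrict (\<lambda>j. increment a ?\<delta> j \<omega>) ?B))"
    by simp
  moreover have "(\<lambda>x. energy_of_increments ?N T \<rho> (\<lambda>j. x j)) \<circ> (\<lambda>\<omega>. restrict (\<lambda>j. increment a ?\<delta> j \<omega>) ?A)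
      = block_approx n a T \<rho>"
    unfolding block_approx_def[abs_def] energy_of_increments_def bernstein_path_def comp_def
    by (intro ext arg_cong[where f = "\<lambda>w. min_energy w T \<rho>"] sum.cong refl arg_cong2[where f = "(*)"]) auto
  moreover have "(\<lambda>x. energy_of_increments ?N T \<rho> (\<lambda>j. x (m * ?N + j))) \<circ> (\<lambda>\<omega>. restrict (\<lambda>j. increment a ?\<delta> j \<omega>) ?B)
      = block_approx n (a + real m * T) T \<rho>"
    unfolding block_approx_def[abs_def] energy_of_increments_def bernstein_path_def comp_def shift
    by (intro ext arg_cong[where f = "\<lambda>w. min_energy w T \<rho>"] sum.cong refl arg_cong2[where f = "(*)"]) auto
  ultimately show ?thesis by simp
qed

lemma block_energy_nonneg: "\<omega> \<in> space M \<Longrightarrow> 0 \<le> a \<Longrightarrow> 0 < T \<Longrightarrow> 0 < \<rho> \<Longrightarrow> 0 \<le> block_energy a T \<rho> \<omega>"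
  unfolding block_energy_def by (rule min_energy_nonneg[OF continuous_path_from path_from_0])

lemma block_moments:
  assumes a: "0 \<le> a" and T: "0 < T" and \<rho>: "0 < \<rho>"
    and int: "integrable M (\<lambda>\<omega>. (block_energy 0 T \<rho> \<omega>)\<^sup>2)"
  shows "integrable M (\<lambda>\<omega>. (block_energy a T \<rho> \<omega>)\<^sup>2)"
    and "expectation (\<lambda>\<omega>. (block_energy a T \<rho> \<omega>)\<^sup>2) = expectation (\<lambda>\<omega>. (block_energy 0 T \<rho> \<omega>)\<^sup>2)"
    and "integrable M (block_energy a T \<rho>)"
    and "expectation (block_energy a T \<rho>) = expectation (block_energy 0 T \<rho>)"
proof -
  have m [measurable]: "block_energy a T \<rho> \<in> borel_measurable M" "block_energy 0 T \<rho> \<in> borel_measurable M"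
    using assms by (auto intro: measurable_block_energy)
  note eq = distr_block_energy[OF a order_refl T \<rho>]
  show 1: "integrable M (\<lambda>\<omega>. (block_energy a T \<rho> \<omega>)\<^sup>2)"
    using int integrable_distr_eq[OF m(1), of "\<lambda>x. x\<^sup>2"] integrable_distr_eq[OF m(2), of "\<lambda>x. x\<^sup>2"] eq by simp
  show "expectation (\<lambda>\<omega>. (block_energy a T \<rho> \<omega>)\<^sup>2) = expectation (\<lambda>\<omega>. (block_energy 0 T \<rho> \<omega>)\<^sup>2)"
    using integral_distr[OF m(1), of "\<lambda>x. x\<^sup>2"] integral_distr[OF m(2), of "\<lambda>x. x\<^sup>2"] eq by simp
  show "integrable M (block_energy a T \<rho>)" using 1 by (rule square_integrable_imp_integrable[rotated]) simp
  show "expectation (block_energy a T \<rho>) = expectation (block_energy 0 T \<rho>)"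
    using integral_distr[OF m(1), of "\<lambda>x. x"] integral_distr[OF m(2), of "\<lambda>x. x"] eq by simp
qed

lemma block_product_moment:
  assumes a: "0 \<le> a" and m: "1 \<le> m" and T: "0 < T" and \<rho>: "0 < \<rho>"
    and int: "integrable M (\<lambda>\<omega>. (block_energy 0 T \<rho> \<omega>)\<^sup>2)"
  shows "integrable M (\<lambda>\<omega>. block_energy a T \<rho> \<omega> * block_energy (a + real m * T) T \<rho> \<omega>)"
    and "expectation (\<lambda>\<omega>. block_energy a T \<rho> \<omega> * block_energy (a + real m * T) T \<rho> \<omega>)
      = (expectation (block_energy 0 T \<rho>))\<^sup>2"
proof -
  let ?b = "a + real m * T"
  have b: "0 \<le> ?b" using a T by simp
  let ?X = "block_energy a T \<rho>" and ?Y = "block_energy ?b T \<rho>"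
  let ?Xn = "\<lambda>n. block_approx n a T \<rho>" and ?Yn = "\<lambda>n. block_approx n ?b T \<rho>"
  note [measurable] = measurable_block_energy[OF a T \<rho>] measurable_block_energy[OF b T \<rho>]
    measurable_block_approx[OF a T \<rho>] measurable_block_approx[OF b T \<rho>]
  note X = block_moments[OF a T \<rho> int] and Y = block_moments[OF b T \<rho> int]
  have nn: "0 \<le> ?X \<omega>" "0 \<le> ?Y \<omega>" if "\<omega> \<in> space M" for \<omega>
    using block_energy_nonneg[OF that _ T \<rho>] a b by auto
  have int_prod: "integrable M (\<lambda>\<omega>. ?X \<omega> * ?Y \<omega>)"
  proof (rule Bochner_Integration.integrable_bound)
    show "integrable M (\<lambda>\<omega>. (?X \<omega>)\<^sup>2 + (?Y \<omega>)\<^sup>2)" using X(1) Y(1) by simp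
    have "\<bar>x * y\<bar> \<le> x\<^sup>2 + y\<^sup>2" for x y :: real
    proof -
      have "2 * \<bar>x * y\<bar> \<le> x\<^sup>2 + y\<^sup>2"
        using sum_squares_bound[of "\<bar>x\<bar>" "\<bar>y\<bar>"] by (simp add: abs_mult mult.assoc)
      then show ?thesis by linarith
    qed
    then show "AE \<omega> in M. norm (?X \<omega> * ?Y \<omega>) \<le> norm ((?X \<omega>)\<^sup>2 + (?Y \<omega>)\<^sup>2)" by simp
  qed simp
  then show "integrable M (\<lambda>\<omega>. ?X \<omega> * ?Y \<omega>)" .
  \<comment> \<open>Independence of the approximations passes to the limit through bounded continuous truncations.\<close>
  define c where "c K x = max (- real K) (min (real K) x)" for K and x :: real
  have c_bound: "\<bar>c K x\<bar> \<le> real K" for K x by (auto simp: c_def)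
  have [measurable]: "c K \<in> borel_measurable borel" for K unfolding c_def[abs_def] by measurable
  have c_tendsto: "(\<lambda>n. c K (f n)) \<longlonglongrightarrow> c K l" if "f \<longlonglongrightarrow> l" for K f l
    unfolding c_def by (intro tendsto_intros that)
  have c_int: "integrable M (\<lambda>\<omega>. c K (f \<omega>))" if [measurable]: "f \<in> borel_measurable M" for K f
    by (rule integrable_const_bound[where B = "real K"]) (use c_bound in auto)
  have trunc: "expectation (\<lambda>\<omega>. c K (?X \<omega>) * c K (?Y \<omega>)) = expectation (\<lambda>\<omega>. c K (?X \<omega>)) * expectation (\<lambda>\<omega>. c K (?Y \<omega>))" for K
  proof (rule LIMSEQ_unique)
    have prod_bound: "\<bar>c K x * c K y\<bar> \<le> real K * real K" for x y
      unfolding abs_mult by (intro mult_mono c_bound) auto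
    show "(\<lambda>n. expectation (\<lambda>\<omega>. c K (?Xn n \<omega>) * c K (?Yn n \<omega>))) \<longlonglongrightarrow> expectation (\<lambda>\<omega>. c K (?X \<omega>) * c K (?Y \<omega>))"
      by (rule integral_dominated_convergence[where w = "\<lambda>_. real K * real K"])
        (use prod_bound a b T \<rho> in \<open>auto intro!: AE_I2 tendsto_mult c_tendsto block_approx_tendsto\<close>)
    have "expectation (\<lambda>\<omega>. c K (?Xn n \<omega>) * c K (?Yn n \<omega>)) = expectation (\<lambda>\<omega>. c K (?Xn n \<omega>)) * expectation (\<lambda>\<omega>. c K (?Yn n \<omega>))" for n
    proof -
      have "indep_var borel (c K \<circ> ?Xn n) borel (c K \<circ> ?Yn n)"
        by (rule indep_var_compose[OF indep_block_approx[OF a m T \<rho>]]) auto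
      from indep_var_lebesgue_integral[OF this] c_int show ?thesis by (simp add: comp_def)
    qed
    moreover have "(\<lambda>n. expectation (\<lambda>\<omega>. c K (?Xn n \<omega>)) * expectation (\<lambda>\<omega>. c K (?Yn n \<omega>)))
        \<longlonglongrightarrow> expectation (\<lambda>\<omega>. c K (?X \<omega>)) * expectation (\<lambda>\<omega>. c K (?Y \<omega>))"
      by (intro tendsto_mult integral_dominated_convergence[where w = "\<lambda>_. real K"])
        (use c_bound a b T \<rho> in \<open>auto intro!: AE_I2 c_tendsto block_approx_tendsto\<close>)
    ultimately show "(\<lambda>n. expectation (\<lambda>\<omega>. c K (?Xn n \<omega>) * c K (?Yn n \<omega>)))
        \<longlonglongrightarrow> expectation (\<lambda>\<omega>. c K (?X \<omega>)) * expectation (\<lambda>\<omega>. c K (?Y \<omega>))" by simp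
  qed
  have c_eventually: "(\<lambda>K. c K x) \<longlonglongrightarrow> x" for x
  proof (rule tendsto_eventually)
    show "\<forall>\<^sub>F K in sequentially. c K x = x"
      using eventually_ge_at_top[of "nat \<lceil>\<bar>x\<bar>\<rceil>"]
    proof eventually_elim
      case (elim K)
      then have "\<bar>x\<bar> \<le> real K" by linarith
      then show ?case by (auto simp: c_def)
    qed
  qed
  have c_le: "\<bar>c K x\<bar> \<le> \<bar>x\<bar>" for K x by (auto simp: c_def)
  have "(\<lambda>K. expectation (\<lambda>\<omega>. c K (?X \<omega>) * c K (?Y \<omega>))) \<longlonglongrightarrow> expectation (\<lambda>\<omega>. ?X \<omega> * ?Y \<omega>)"
    by (rule integral_dominated_convergence[where w = "\<lambda>\<omega>. \<bar>?X \<omega> * ?Y \<omega>\<bar>"])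
      (use c_le integrable_abs[OF int_prod] in
        \<open>auto intro!: AE_I2 tendsto_mult c_eventually mult_mono simp: abs_mult\<close>)
  moreover have "(\<lambda>K. expectation (\<lambda>\<omega>. c K (?X \<omega>) * c K (?Y \<omega>))) \<longlonglongrightarrow> expectation ?X * expectation ?Y"
    unfolding trunc
    by (intro tendsto_mult integral_dominated_convergence[where w = "\<lambda>\<omega>. \<bar>?X \<omega>\<bar>"]
        integral_dominated_convergence[where w = "\<lambda>\<omega>. \<bar>?Y \<omega>\<bar>"])
      (use c_le X(3) Y(3) in \<open>auto intro!: AE_I2 c_eventually\<close>)
  ultimately have "expectation (\<lambda>\<omega>. ?X \<omega> * ?Y \<omega>) = expectation ?X * expectation ?Y"
    by (rule LIMSEQ_unique)
  then show "expectation (\<lambda>\<omega>. ?X \<omega> * ?Y \<omega>) = (expectation (block_energy 0 T \<rho>))\<^sup>2"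
    by (simp add: X(4) Y(4) power2_eq_square)
qed

end

section \<open>Laws of large numbers and moment limits\<close>

text \<open>Between two consecutive points of the sparse sequence a monotone function is caught between its values
  at these points.\<close>

lemma average_bounds_of_sparse:
  fixes f :: "real \<Rightarrow> real" and t :: "nat \<Rightarrow> real"
  assumes mono: "\<And>x y. 0 < x \<Longrightarrow> x \<le> y \<Longrightarrow> f x \<le> f y" and nn: "\<And>x. 0 < x \<Longrightarrow> 0 \<le> f x"
    and t: "\<And>k. 0 < t k" "incseq t" "filterlim t at_top sequentially"
    and low: "\<forall>\<^sub>F k in sequentially. lo < f (t k) / t (Suc k)"
    and high: "\<forall>\<^sub>F k in sequentially. f (t (Suc k)) / t k < hi"
  shows "\<forall>\<^sub>F T in at_top. lo < f T / T \<and> f T / T < hi"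
proof -
  obtain K where K: "\<And>k. K \<le> k \<Longrightarrow> lo < f (t k) / t (Suc k) \<and> f (t (Suc k)) / t k < hi"
    using eventually_conj[OF low high] by (auto simp: eventually_sequentially)
  show ?thesis
    using eventually_ge_at_top[of "t K"]
  proof eventually_elim
    case (elim T)
    have "\<exists>n. T < t n"
      using t(3) by (auto simp: filterlim_at_top_dense eventually_sequentially)
    then have n: "T < t (LEAST n. T < t n)" by (rule LeastI_ex)
    define n where "n = (LEAST n. T < t n)"
    have "K < n"
    proof (rule ccontr)
      assume "\<not> K < n"
      then have "t n \<le> t K" using t(2) by (simp add: incseq_def)
      then show False using n elim by (simp add: n_def)
    qed
    then obtain k where k: "n = Suc k" "K \<le> k" by (cases n) auto
    have "\<not> T < t k" using not_less_Least[of k "\<lambda>n. T < t n"] k by (simp add: n_def)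
    then have T: "t k \<le> T" "T \<le> t (Suc k)" using n k by (auto simp: n_def[symmetric])
    have pos: "0 < t k" "0 < t (Suc k)" "0 < T" using t(1)[of k] t(1)[of "Suc k"] T by auto
    have "lo < f (t k) / t (Suc k)" using K[OF k(2)] by simp
    also have "\<dots> \<le> f T / T" using pos T by (intro frac_le mono nn) auto
    finally have 1: "lo < f T / T" .
    have "f T / T \<le> f (t (Suc k)) / t k" using pos T by (intro frac_le mono nn) auto
    also have "\<dots> < hi" using K[OF k(2)] by simp
    finally show ?case using 1 by simp
  qed
qed

text \<open>Consecutive sparse times have ratio tending to \<open>1\<close>, so replacing one by the other in the
  denominator does not change the limit.\<close>

lemma tendsto_average_of_sparse:
  fixes f :: "real \<Rightarrow> real" and t :: "nat \<Rightarrow> real"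
  assumes mono: "\<And>x y. 0 < x \<Longrightarrow> x \<le> y \<Longrightarrow> f x \<le> f y" and nn: "\<And>x. 0 < x \<Longrightarrow> 0 \<le> f x"
    and t: "\<And>k. 0 < t k" "incseq t" "filterlim t at_top sequentially" "(\<lambda>k. t (Suc k) / t k) \<longlonglongrightarrow> 1"
    and lim: "(\<lambda>k. f (t k) / t k) \<longlonglongrightarrow> c"
  shows "((\<lambda>T. f T / T) \<longlongrightarrow> c) at_top"
proof (rule tendstoI)
  fix e :: real assume e: "0 < e"
  have "(\<lambda>k. f (t k) / t k / (t (Suc k) / t k)) \<longlonglongrightarrow> c / 1"
    by (intro tendsto_divide lim t) simp
  then have "(\<lambda>k. f (t k) / t (Suc k)) \<longlonglongrightarrow> c" using t(1) by (simp add: less_imp_neq[symmetric])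
  then have low: "\<forall>\<^sub>F k in sequentially. c - e < f (t k) / t (Suc k)" using e by (intro order_tendstoD) auto
  have "(\<lambda>k. f (t (Suc k)) / t (Suc k) * (t (Suc k) / t k)) \<longlonglongrightarrow> c * 1"
    by (intro tendsto_mult LIMSEQ_Suc[OF lim] t)
  then have "(\<lambda>k. f (t (Suc k)) / t k) \<longlonglongrightarrow> c" using t(1) by (simp add: less_imp_neq[symmetric])
  then have high: "\<forall>\<^sub>F k in sequentially. f (t (Suc k)) / t k < c + e" using e by (intro order_tendstoD) auto
  have "\<forall>\<^sub>F T in at_top. c - e < f T / T \<and> f T / T < c + e"
    by (rule average_bounds_of_sparse[OF mono nn t(1-3) low high])
  then show "\<forall>\<^sub>F T in at_top. dist (f T / T) c < e"
    by eventually_elim (simp add: dist_real_def abs_less_iff)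
qed

lemma (in prob_space) AE_tendsto_0_of_summable:
  assumes nn: "\<And>k \<omega>. 0 \<le> Y k \<omega>" and int: "\<And>k. integrable M (Y k)"
    and sum: "summable (\<lambda>k. expectation (Y k))"
  shows "AE \<omega> in M. (\<lambda>k. Y k \<omega>) \<longlonglongrightarrow> (0::real)"
proof -
  have [measurable]: "Y k \<in> borel_measurable M" for k using int by auto
  have "(\<integral>\<^sup>+\<omega>. (\<Sum>k. ennreal (Y k \<omega>)) \<partial>M) = (\<Sum>k. \<integral>\<^sup>+\<omega>. ennreal (Y k \<omega>) \<partial>M)"
    by (rule nn_integral_suminf) simp
  also have "\<dots> = (\<Sum>k. ennreal (expectation (Y k)))"
    using nn int by (intro suminf_cong nn_integral_eq_integral) auto
  also have "\<dots> = ennreal (\<Sum>k. expectation (Y k))"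
    by (rule suminf_ennreal2[OF _ sum]) (simp add: nn)
  finally have "(\<integral>\<^sup>+\<omega>. (\<Sum>k. ennreal (Y k \<omega>)) \<partial>M) \<noteq> \<infinity>" by simp
  then have "AE \<omega> in M. (\<Sum>k. ennreal (Y k \<omega>)) \<noteq> \<infinity>" by (intro nn_integral_PInf_AE) auto
  then show ?thesis
  proof eventually_elim
    case (elim \<omega>)
    then have "summable (\<lambda>k. Y k \<omega>)" using nn by (intro summable_suminf_not_top) auto
    then show ?case by (rule summable_LIMSEQ_zero)
  qed
qed

lemma summable_inverse_square: "summable (\<lambda>k. c / (real (Suc k))\<^sup>2)"
proof -
  have "summable (\<lambda>k. inverse ((real k)\<^sup>2))" by (rule inverse_power_summable) simp
  then have "summable (\<lambda>k. c * inverse ((real (Suc k))\<^sup>2))" using summable_Suc_iff[of "\<lambda>k. inverse ((real k)\<^sup>2)"]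
    by (intro summable_mult) blast
  then show ?thesis by (simp add: divide_inverse)
qed

text \<open>The second moments of \<open>X k / (k + 1)\<close> are summable. The estimate applies to the energies of
  overlapping blocks.\<close>

lemma (in prob_space) AE_sublinear_of_second_moment:
  fixes X :: "nat \<Rightarrow> 'a \<Rightarrow> real"
  assumes "\<And>i. integrable M (\<lambda>\<omega>. (X i \<omega>)\<^sup>2)" "\<And>i. expectation (\<lambda>\<omega>. (X i \<omega>)\<^sup>2) = v"
  shows "AE \<omega> in M. (\<lambda>k. X k \<omega> / real (Suc k)) \<longlonglongrightarrow> 0"
proof -
  have "AE \<omega> in M. (\<lambda>k. (X k \<omega> / real (Suc k))\<^sup>2) \<longlonglongrightarrow> 0"
  proof (rule AE_tendsto_0_of_summable)
    show "summable (\<lambda>k. expectation (\<lambda>\<omega>. (X k \<omega> / real (Suc k))\<^sup>2))"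
      using summable_inverse_square[of v] assms(2) by (simp add: power_divide del: of_nat_Suc)
  qed (use assms in \<open>auto simp: power_divide\<close>)
  then show ?thesis
  proof eventually_elim
    case (elim \<omega>)
    have "(\<lambda>k. \<bar>X k \<omega> / real (Suc k)\<bar>) \<longlonglongrightarrow> 0"
      using tendsto_real_sqrt[OF elim] by (simp del: of_nat_Suc)
    then show ?case by (simp only: tendsto_rabs_zero_iff)
  qed
qed

text \<open>Variance bounds settle the averages along the squares, and nonnegativity makes the partial
  sums monotone, which fills the gaps between consecutive squares.\<close>

lemma (in prob_space) strong_law_nonneg_uncorrelated:
  fixes X :: "nat \<Rightarrow> 'a \<Rightarrow> real"
  assumes nn: "\<And>i \<omega>. \<omega> \<in> space M \<Longrightarrow> 0 \<le> X i \<omega>"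
    and int: "\<And>i. integrable M (X i)" and mean: "\<And>i. expectation (X i) = \<mu>"
    and int2: "\<And>i. integrable M (\<lambda>\<omega>. (X i \<omega>)\<^sup>2)" and second: "\<And>i. expectation (\<lambda>\<omega>. (X i \<omega>)\<^sup>2) = v"
    and intp: "\<And>i j. i < j \<Longrightarrow> integrable M (\<lambda>\<omega>. X i \<omega> * X j \<omega>)"
    and uncorr: "\<And>i j. i < j \<Longrightarrow> expectation (\<lambda>\<omega>. X i \<omega> * X j \<omega>) = \<mu>\<^sup>2"
  shows "AE \<omega> in M. (\<lambda>n. (\<Sum>i<n. X i \<omega>) / real n) \<longlonglongrightarrow> \<mu>"
proof -
  have p_int: "integrable M (\<lambda>\<omega>. X i \<omega> * X j \<omega>)" for i j
    using intp[of i j] intp[of j i] int2[of i]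
    by (cases i j rule: linorder_cases) (auto simp: power2_eq_square mult.commute)
  have p_exp: "expectation (\<lambda>\<omega>. X i \<omega> * X j \<omega>) = (if i = j then v else \<mu>\<^sup>2)" for i j
    using uncorr[of i j] uncorr[of j i] second[of i]
    by (cases i j rule: linorder_cases) (auto simp: power2_eq_square mult.commute)
  have c_eq: "(X i \<omega> - \<mu>) * (X j \<omega> - \<mu>) = X i \<omega> * X j \<omega> - \<mu> * X i \<omega> - \<mu> * X j \<omega> + \<mu>\<^sup>2" for i j \<omega>
    by (simp add: algebra_simps power2_eq_square)
  have c_int: "integrable M (\<lambda>\<omega>. (X i \<omega> - \<mu>) * (X j \<omega> - \<mu>))" for i j
    unfolding c_eq using p_int int by auto
  have c_exp: "expectation (\<lambda>\<omega>. (X i \<omega> - \<mu>) * (X j \<omega> - \<mu>)) = (if i = j then v - \<mu>\<^sup>2 else 0)" for i j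
    unfolding c_eq using p_int int mean by (simp add: p_exp prob_space power2_eq_square)
  define D where "D n \<omega> = (\<Sum>i<n. X i \<omega> - \<mu>)" for n \<omega>
  have D2: "(D n \<omega>)\<^sup>2 = (\<Sum>i<n. \<Sum>j<n. (X i \<omega> - \<mu>) * (X j \<omega> - \<mu>))" for n \<omega>
    by (simp add: D_def power2_eq_square sum_product)
  have D_int: "integrable M (\<lambda>\<omega>. (D n \<omega>)\<^sup>2)" for n unfolding D2 using c_int by auto
  have D_exp: "expectation (\<lambda>\<omega>. (D n \<omega>)\<^sup>2) = real n * (v - \<mu>\<^sup>2)" for n
    unfolding D2 using c_int by (simp add: c_exp Bochner_Integration.integral_sum)
  \<comment> \<open>Chebyshev's variance bound is summable along the squares; monotonicity of the partial sums fills the gaps.\<close>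
  define sq where "sq k = (Suc k)\<^sup>2" for k
  have "AE \<omega> in M. (\<lambda>k. (D (sq k) \<omega> / real (sq k))\<^sup>2) \<longlonglongrightarrow> 0"
  proof (rule AE_tendsto_0_of_summable)
    have "expectation (\<lambda>\<omega>. (D (sq k) \<omega> / real (sq k))\<^sup>2) = (v - \<mu>\<^sup>2) / (real (Suc k))\<^sup>2" for k
    proof -
      have "expectation (\<lambda>\<omega>. (D (sq k) \<omega> / real (sq k))\<^sup>2) = real (sq k) * (v - \<mu>\<^sup>2) / (real (sq k))\<^sup>2"
        using D_exp[of "sq k"] by (simp add: power_divide)
      also have "\<dots> = (v - \<mu>\<^sup>2) / real (sq k)" by (simp add: power2_eq_square)
      finally show ?thesis by (simp add: sq_def del: of_nat_Suc)
    qed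
    then show "summable (\<lambda>k. expectation (\<lambda>\<omega>. (D (sq k) \<omega> / real (sq k))\<^sup>2))"
      using summable_inverse_square[of "v - \<mu>\<^sup>2"] by simp
  qed (use D_int in \<open>auto simp: power_divide\<close>)
  then show ?thesis
    using AE_space
  proof eventually_elim
    case (elim \<omega>)
    have "(\<lambda>k. \<bar>D (sq k) \<omega> / real (sq k)\<bar>) \<longlonglongrightarrow> 0"
      using tendsto_real_sqrt[OF elim(1)] by simp
    then have "(\<lambda>k. D (sq k) \<omega> / real (sq k) + \<mu>) \<longlonglongrightarrow> 0 + \<mu>"
      by (intro tendsto_add tendsto_const) (simp only: tendsto_rabs_zero_iff)
    moreover have "D (sq k) \<omega> / real (sq k) + \<mu> = (\<Sum>i<sq k. X i \<omega>) / real (sq k)" for k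
    proof -
      have "0 < real (sq k)" by (simp add: sq_def)
      then show ?thesis by (simp add: D_def sum_subtractf field_simps)
    qed
    ultimately have lim: "(\<lambda>k. (\<Sum>i<sq k. X i \<omega>) / real (sq k)) \<longlonglongrightarrow> \<mu>" by simp
    define f where "f T = (\<Sum>i<nat \<lfloor>T\<rfloor>. X i \<omega>)" for T :: real
    have "((\<lambda>T. f T / T) \<longlongrightarrow> \<mu>) at_top"
    proof (rule tendsto_average_of_sparse[where t = "\<lambda>k. real (sq k)"])
      show "f x \<le> f y" if "x \<le> y" for x y
        unfolding f_def using that nn[OF elim(2)] by (intro sum_mono2) (auto intro: nat_mono floor_mono)
      show "0 \<le> f x" for x unfolding f_def using nn[OF elim(2)] by (intro sum_nonneg) auto
      show "0 < real (sq k)" for k by (simp add: sq_def)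
      show "incseq (\<lambda>k. real (sq k))" unfolding incseq_def sq_def by (auto intro: power_mono)
      show "filterlim (\<lambda>k. real (sq k)) at_top sequentially" unfolding sq_def by real_asymp
      show "(\<lambda>k. real (sq (Suc k)) / real (sq k)) \<longlonglongrightarrow> 1" unfolding sq_def by real_asymp
      show "(\<lambda>k. f (real (sq k)) / real (sq k)) \<longlonglongrightarrow> \<mu>" using lim by (simp add: f_def)
    qed
    from filterlim_compose[OF this filterlim_real_sequentially]
    show ?case by (simp add: f_def)
  qed
qed

lemma abs_diff_power_ennreal:
  assumes "0 \<le> z"
  shows "abs_diff_power (ennreal z) c q = ennreal (\<bar>z - c\<bar> powr q)"
proof -
  have "e2ennreal \<bar>enn2ereal (ennreal z) - ereal c\<bar> = ennreal \<bar>z - c\<bar>"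
    using assms by (simp add: enn2ereal_ennreal e2ennreal_ereal)
  then show ?thesis unfolding abs_diff_power_def by (simp add: ennreal_power_def)
qed

lemma small_ratio_fixed_radius:
  assumes "0 < \<rho>"
  shows "filterlim (\<lambda>T. (T, \<rho>)) small_ratio at_top"
  unfolding small_ratio_def filterlim_inf filterlim_principal filterlim_filtercomap_iff
proof
  show "filterlim ((\<lambda>(T, r). r / sqrt T) \<circ> (\<lambda>T. (T, \<rho>))) (nhds 0) at_top"
    unfolding comp_def prod.case by real_asymp
  show "\<forall>\<^sub>F T :: real in at_top. (T, \<rho>) \<in> {0<..} \<times> {0<..}"
    using eventually_gt_at_top[of "0::real"] by eventually_elim (use assms in simp)
qed

context wiener_process
begin

text \<open>The normalized minimal energy \<open>(\<rho> / \<surd>T) I\<^sub>W(T, \<rho>)\<close> as a real random variable.\<close>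

definition scaled_energy :: "real \<Rightarrow> real \<Rightarrow> 'a \<Rightarrow> real" where
  "scaled_energy \<rho> T \<omega> = \<rho> / sqrt T * sqrt (block_energy 0 T \<rho> \<omega>)"

lemma block_energy_0: "\<omega> \<in> space M \<Longrightarrow> block_energy 0 T \<rho> \<omega> = min_energy (\<lambda>t. W t \<omega>) T \<rho>"
  using start_zero by (simp add: block_energy_def path_from_def[abs_def])

lemma scaled_energy_nonneg: "\<omega> \<in> space M \<Longrightarrow> 0 < T \<Longrightarrow> 0 < \<rho> \<Longrightarrow> 0 \<le> scaled_energy \<rho> T \<omega>"
  by (simp add: scaled_energy_def block_energy_nonneg)

lemma continuous_W: "\<omega> \<in> space M \<Longrightarrow> continuous_on {0..T} (\<lambda>t. W t \<omega>)"
  by (rule continuous_on_subset[OF continuous_paths]) auto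

lemma I_free_eq_scaled_energy:
  assumes "\<omega> \<in> space M" "0 < T" "0 < \<rho>"
  shows "ennreal (\<rho> / sqrt T) * I_free (\<lambda>t. W t \<omega>) T \<rho> = ennreal (scaled_energy \<rho> T \<omega>)"
  using I_free_eq_min_energy[OF continuous_W[OF assms(1)] start_zero[OF assms(1)] assms(2,3)] assms
    min_energy_nonneg[OF continuous_W[OF assms(1)] start_zero[OF assms(1)] assms(2,3)]
  by (simp add: scaled_energy_def block_energy_0 ennreal_mult[symmetric])

lemma measurable_scaled_energy:
  assumes "0 < T" "0 < \<rho>"
  shows "scaled_energy \<rho> T \<in> borel_measurable M"
proof -
  note [measurable] = measurable_block_energy[OF order_refl assms]
  show ?thesis unfolding scaled_energy_def[abs_def] by measurable
qed

lemma scaled_energy_Lq: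
  assumes C: "taut_string_constant M W C" and \<rho>: "0 < \<rho>" and q: "0 < q"
  shows "((\<lambda>T. \<integral>\<^sup>+\<omega>. ennreal (\<bar>scaled_energy \<rho> T \<omega> - C\<bar> powr q) \<partial>M) \<longlongrightarrow> 0) at_top"
proof -
  have "((\<lambda>(T, r). \<integral>\<^sup>+\<omega>. abs_diff_power (ennreal (r / sqrt T) * I_free (\<lambda>t. W t \<omega>) T r) C q \<partial>M) \<longlongrightarrow> 0) small_ratio"
    using C q unfolding taut_string_constant_def by blast
  from filterlim_compose[OF this small_ratio_fixed_radius[OF \<rho>]]
  have "((\<lambda>T. \<integral>\<^sup>+\<omega>. abs_diff_power (ennreal (\<rho> / sqrt T) * I_free (\<lambda>t. W t \<omega>) T \<rho>) C q \<partial>M) \<longlongrightarrow> 0) at_top"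
    by simp
  then show ?thesis
  proof (rule Lim_transform_eventually)
    show "\<forall>\<^sub>F T in at_top. (\<integral>\<^sup>+\<omega>. abs_diff_power (ennreal (\<rho> / sqrt T) * I_free (\<lambda>t. W t \<omega>) T \<rho>) C q \<partial>M) =
        (\<integral>\<^sup>+\<omega>. ennreal (\<bar>scaled_energy \<rho> T \<omega> - C\<bar> powr q) \<partial>M)"
      using eventually_gt_at_top[of "0::real"]
      by eventually_elim
        (intro nn_integral_cong, simp add: I_free_eq_scaled_energy \<rho> abs_diff_power_ennreal scaled_energy_nonneg)
  qed
qed

lemma block_energy_eq_scaled:
  assumes "\<omega> \<in> space M" "0 < T" "0 < \<rho>"
  shows "(scaled_energy \<rho> T \<omega>)\<^sup>2 = \<rho>\<^sup>2 / T * block_energy 0 T \<rho> \<omega>"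
  using assms block_energy_nonneg[OF assms(1) order_refl assms(2,3)]
  by (simp add: scaled_energy_def power_mult_distrib power_divide)

text \<open>Convergence in \<open>L\<^sup>4\<close> to a constant makes the fourth moment finite for large \<open>T\<close>; the fourth power of
  the normalized energy is the square of the block energy, up to a factor.\<close>

lemma eventually_integrable_scaled_energy:
  assumes C: "taut_string_constant M W C" and \<rho>: "0 < \<rho>"
  shows "\<forall>\<^sub>F T in at_top. integrable M (\<lambda>\<omega>. (scaled_energy \<rho> T \<omega>)^4)"
proof -
  have "\<forall>\<^sub>F T in at_top. (\<integral>\<^sup>+\<omega>. ennreal (\<bar>scaled_energy \<rho> T \<omega> - C\<bar> powr 4) \<partial>M) < 1"
    using scaled_energy_Lq[OF C \<rho>, of 4] by (intro order_tendstoD) auto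
  then show ?thesis using eventually_gt_at_top[of "0::real"]
  proof eventually_elim
    case (elim T)
    note [measurable] = measurable_scaled_energy[OF elim(2) \<rho>]
    have p4: "\<bar>x\<bar> powr 4 = norm (x^4)" for x :: real by (cases "x = 0") (simp_all add: powr_numeral)
    have "integrable M (\<lambda>\<omega>. (scaled_energy \<rho> T \<omega> - C)^4)"
    proof (rule integrableI_bounded)
      show "(\<integral>\<^sup>+\<omega>. ennreal (norm ((scaled_energy \<rho> T \<omega> - C)^4)) \<partial>M) < \<infinity>"
        using less_trans[OF elim(1) ennreal_one_less_top] unfolding p4 by simp
    qed simp
    then have bound: "integrable M (\<lambda>\<omega>. 8 * ((scaled_energy \<rho> T \<omega> - C)^4 + C^4))" by simp
    have ineq: "z^4 \<le> 8 * ((z - C)^4 + C^4)" for z :: real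
    proof -
      have sq: "(x + y)\<^sup>2 \<le> 2 * (x\<^sup>2 + y\<^sup>2)" for x y :: real
        using sum_squares_bound[of x y] by (simp add: power2_sum)
      have "z^4 = (((z - C) + C)\<^sup>2)\<^sup>2" by simp
      also have "\<dots> \<le> (2 * ((z - C)\<^sup>2 + C\<^sup>2))\<^sup>2" by (intro power_mono sq) simp
      also have "\<dots> \<le> 4 * (2 * (((z - C)\<^sup>2)\<^sup>2 + (C\<^sup>2)\<^sup>2))"
        unfolding power_mult_distrib using sq[of "(z - C)\<^sup>2" "C\<^sup>2"] by simp
      finally show ?thesis by simp
    qed
    show ?case
      by (rule Bochner_Integration.integrable_bound[OF bound])
        (use ineq in \<open>auto intro!: AE_I2 intro: order_trans\<close>)
  qed
qed

lemma eventually_square_integrable_block_energy: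
  assumes C: "taut_string_constant M W C" and \<rho>: "0 < \<rho>"
  shows "\<forall>\<^sub>F T in at_top. integrable M (\<lambda>\<omega>. (block_energy 0 T \<rho> \<omega>)\<^sup>2)"
  using eventually_integrable_scaled_energy[OF C \<rho>] eventually_gt_at_top[of "0::real"]
proof eventually_elim
  case (elim T)
  have "integrable M (\<lambda>\<omega>. (T / \<rho>\<^sup>2)\<^sup>2 * (scaled_energy \<rho> T \<omega>)^4)" using elim by simp
  moreover have "(T / \<rho>\<^sup>2)\<^sup>2 * (scaled_energy \<rho> T \<omega>)^4 = (block_energy 0 T \<rho> \<omega>)\<^sup>2" if "\<omega> \<in> space M" for \<omega>
  proof -
    have "(scaled_energy \<rho> T \<omega>)^4 = ((scaled_energy \<rho> T \<omega>)\<^sup>2)\<^sup>2" by simp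
    also have "\<dots> = (\<rho>\<^sup>2 / T * block_energy 0 T \<rho> \<omega>)\<^sup>2" unfolding block_energy_eq_scaled[OF that elim(2) \<rho>] ..
    finally show ?thesis using elim(2) \<rho> by (simp add: power_mult_distrib[symmetric])
  qed
  ultimately show ?case by (simp cong: Bochner_Integration.integrable_cong)
qed

text \<open>With \<open>Z\<close> the normalized energy, \<open>Z\<^sup>2 - C\<^sup>2 = (Z - C)\<^sup>2 + 2 C (Z - C)\<close>, so convergence in \<open>L\<^sup>1\<close> and in
  \<open>L\<^sup>2\<close> gives convergence of the second moment of \<open>Z\<close>.\<close>

lemma expectation_block_energy_limit:
  assumes C: "taut_string_constant M W C" and \<rho>: "0 < \<rho>"
  shows "((\<lambda>T. expectation (block_energy 0 T \<rho>) / T) \<longlongrightarrow> C\<^sup>2 / \<rho>\<^sup>2) at_top"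
proof -
  have C0: "0 < C" using C by (simp add: taut_string_constant_def)
  define Z where "Z = scaled_energy \<rho>"
  have ev: "\<forall>\<^sub>F T in at_top. 0 < T \<and> integrable M (Z T) \<and> integrable M (\<lambda>\<omega>. (Z T \<omega>)\<^sup>2)"
    using eventually_integrable_scaled_energy[OF C \<rho>] eventually_gt_at_top[of "0::real"]
  proof eventually_elim
    case (elim T)
    note [measurable] = measurable_scaled_energy[OF elim(2) \<rho>]
    have "integrable M (\<lambda>\<omega>. ((scaled_energy \<rho> T \<omega>)\<^sup>2)\<^sup>2)" using elim(1) by simp
    then have 2: "integrable M (\<lambda>\<omega>. (scaled_energy \<rho> T \<omega>)\<^sup>2)"
      by (rule square_integrable_imp_integrable[rotated]) simp
    then have "integrable M (scaled_energy \<rho> T)" by (rule square_integrable_imp_integrable[rotated]) simp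
    then show ?case using 2 elim(2) by (simp add: Z_def)
  qed
  have 1: "((\<lambda>T. expectation (\<lambda>\<omega>. \<bar>Z T \<omega> - C\<bar>)) \<longlongrightarrow> 0) at_top"
  proof -
    have "((\<lambda>T. ennreal (expectation (\<lambda>\<omega>. \<bar>Z T \<omega> - C\<bar>))) \<longlongrightarrow> ennreal 0) at_top"
      unfolding ennreal_0
    proof (rule Lim_transform_eventually[OF scaled_energy_Lq[OF C \<rho> zero_less_one]])
      show "\<forall>\<^sub>F T in at_top. (\<integral>\<^sup>+\<omega>. ennreal (\<bar>scaled_energy \<rho> T \<omega> - C\<bar> powr 1) \<partial>M) = ennreal (expectation (\<lambda>\<omega>. \<bar>Z T \<omega> - C\<bar>))"
        using ev by eventually_elim (simp add: Z_def[symmetric] nn_integral_eq_integral)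
    qed
    then show ?thesis by (subst (asm) tendsto_ennreal_iff) auto
  qed
  have 2: "((\<lambda>T. expectation (\<lambda>\<omega>. (Z T \<omega> - C)\<^sup>2)) \<longlongrightarrow> 0) at_top"
  proof -
    have p2: "\<bar>x\<bar> powr 2 = x\<^sup>2" for x :: real by (cases "x = 0") (simp_all add: powr_numeral)
    have "((\<lambda>T. ennreal (expectation (\<lambda>\<omega>. (Z T \<omega> - C)\<^sup>2))) \<longlongrightarrow> ennreal 0) at_top"
      unfolding ennreal_0
    proof (rule Lim_transform_eventually[OF scaled_energy_Lq[OF C \<rho>, of 2]])
      show "\<forall>\<^sub>F T in at_top. (\<integral>\<^sup>+\<omega>. ennreal (\<bar>scaled_energy \<rho> T \<omega> - C\<bar> powr 2) \<partial>M) = ennreal (expectation (\<lambda>\<omega>. (Z T \<omega> - C)\<^sup>2))"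
        using ev
      proof eventually_elim
        case (elim T)
        then have "integrable M (\<lambda>\<omega>. (Z T \<omega> - C)\<^sup>2)" by (simp add: power2_diff)
        then show ?case by (simp add: p2 Z_def[symmetric] nn_integral_eq_integral)
      qed
    qed simp
    then show ?thesis by (subst (asm) tendsto_ennreal_iff) auto
  qed
  have "((\<lambda>T. expectation (\<lambda>\<omega>. (Z T \<omega>)\<^sup>2) - C\<^sup>2) \<longlongrightarrow> 0) at_top"
  proof (rule Lim_null_comparison)
    show "((\<lambda>T. expectation (\<lambda>\<omega>. (Z T \<omega> - C)\<^sup>2) + 2 * C * expectation (\<lambda>\<omega>. \<bar>Z T \<omega> - C\<bar>)) \<longlongrightarrow> 0) at_top"
      using tendsto_add[OF 2 tendsto_mult[OF tendsto_const 1, of "2 * C"]] by simp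
    show "\<forall>\<^sub>F T in at_top. norm (expectation (\<lambda>\<omega>. (Z T \<omega>)\<^sup>2) - C\<^sup>2)
        \<le> expectation (\<lambda>\<omega>. (Z T \<omega> - C)\<^sup>2) + 2 * C * expectation (\<lambda>\<omega>. \<bar>Z T \<omega> - C\<bar>)"
      using ev
    proof eventually_elim
      case (elim T)
      have i2: "integrable M (\<lambda>\<omega>. (Z T \<omega> - C)\<^sup>2)" using elim by (simp add: power2_diff)
      have "expectation (\<lambda>\<omega>. (Z T \<omega>)\<^sup>2) - C\<^sup>2 = expectation (\<lambda>\<omega>. (Z T \<omega>)\<^sup>2 - C\<^sup>2)"
        using elim by (simp add: prob_space)
      also have "\<dots> = expectation (\<lambda>\<omega>. (Z T \<omega> - C)\<^sup>2 + 2 * C * (Z T \<omega> - C))"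
        by (rule Bochner_Integration.integral_cong) (auto simp: power2_eq_square algebra_simps)
      also have "\<dots> = expectation (\<lambda>\<omega>. (Z T \<omega> - C)\<^sup>2) + 2 * C * expectation (\<lambda>\<omega>. Z T \<omega> - C)"
        using elim i2 by simp
      finally have eq: "expectation (\<lambda>\<omega>. (Z T \<omega>)\<^sup>2) - C\<^sup>2
          = expectation (\<lambda>\<omega>. (Z T \<omega> - C)\<^sup>2) + 2 * C * expectation (\<lambda>\<omega>. Z T \<omega> - C)" .
      have "\<bar>expectation (\<lambda>\<omega>. Z T \<omega> - C)\<bar> \<le> expectation (\<lambda>\<omega>. \<bar>Z T \<omega> - C\<bar>)"
        by (rule integral_abs_bound)
      then have "\<bar>2 * C * expectation (\<lambda>\<omega>. Z T \<omega> - C)\<bar> \<le> 2 * C * expectation (\<lambda>\<omega>. \<bar>Z T \<omega> - C\<bar>)"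
        unfolding abs_mult using C0 by (intro mult_mono) auto
      moreover have "0 \<le> expectation (\<lambda>\<omega>. (Z T \<omega> - C)\<^sup>2)" by simp
      ultimately show ?case unfolding eq real_norm_def by linarith
    qed
  qed
  then have "((\<lambda>T. expectation (\<lambda>\<omega>. (Z T \<omega>)\<^sup>2)) \<longlongrightarrow> C\<^sup>2) at_top" by (simp only: LIM_zero_iff)
  then have "((\<lambda>T. expectation (\<lambda>\<omega>. (Z T \<omega>)\<^sup>2) / \<rho>\<^sup>2) \<longlongrightarrow> C\<^sup>2 / \<rho>\<^sup>2) at_top"
    using \<rho> by (intro tendsto_divide) auto
  then show ?thesis
  proof (rule Lim_transform_eventually)
    show "\<forall>\<^sub>F T in at_top. expectation (\<lambda>\<omega>. (Z T \<omega>)\<^sup>2) / \<rho>\<^sup>2 = expectation (block_energy 0 T \<rho>) / T"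
      using eventually_gt_at_top[of "0::real"]
    proof eventually_elim
      case (elim T)
      have "expectation (\<lambda>\<omega>. (Z T \<omega>)\<^sup>2) = expectation (\<lambda>\<omega>. \<rho>\<^sup>2 / T * block_energy 0 T \<rho> \<omega>)"
        by (rule Bochner_Integration.integral_cong) (auto simp: Z_def block_energy_eq_scaled elim \<rho>)
      then show ?case using \<rho> by simp
    qed
  qed
qed

end

section \<open>Almost sure convergence\<close>

lemma tendsto_scaled_root:
  assumes r: "0 < r" and C: "0 < C" and lim: "((\<lambda>T. Q T / T) \<longlongrightarrow> C\<^sup>2 / r\<^sup>2) at_top"
    and I: "\<And>T. 0 < T \<Longrightarrow> I T = ennreal (sqrt (Q T))" and nn: "\<And>T. 0 < T \<Longrightarrow> 0 \<le> Q T"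
  shows "((\<lambda>T. ennreal (r / sqrt T) * I T) \<longlongrightarrow> ennreal C) at_top"
proof -
  have "((\<lambda>T. r * sqrt (Q T / T)) \<longlongrightarrow> r * sqrt (C\<^sup>2 / r\<^sup>2)) at_top"
    by (intro tendsto_mult tendsto_const tendsto_real_sqrt lim)
  moreover have "r * sqrt (C\<^sup>2 / r\<^sup>2) = C" using r C by (simp add: real_sqrt_divide)
  ultimately have "((\<lambda>T. ennreal (r * sqrt (Q T / T))) \<longlongrightarrow> ennreal C) at_top" by (intro tendsto_ennrealI) simp
  then show ?thesis
  proof (rule Lim_transform_eventually)
    show "\<forall>\<^sub>F T in at_top. ennreal (r * sqrt (Q T / T)) = ennreal (r / sqrt T) * I T"
      using eventually_gt_at_top[of "0::real"]
      by eventually_elim (use r I nn in \<open>simp add: real_sqrt_divide ennreal_mult[symmetric]\<close>)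
  qed
qed

context wiener_process
begin

text \<open>The spacing of the blocks is a multiple \<open>p * T\<close> of their length \<open>T\<close>: the choice \<open>p = 1\<close> tiles the
  time axis, larger \<open>p\<close> selects the short stretches that are used to repair one end of a longer block.\<close>

lemma block_energy_strong_law:
  assumes a: "0 \<le> a" and p: "1 \<le> p" and T: "0 < T" and \<rho>: "0 < \<rho>"
    and int: "integrable M (\<lambda>\<omega>. (block_energy 0 T \<rho> \<omega>)\<^sup>2)"
  shows "AE \<omega> in M. (\<lambda>n. (\<Sum>i<n. block_energy (real i * (real p * T) + a) T \<rho> \<omega>) / real n)
    \<longlonglongrightarrow> expectation (block_energy 0 T \<rho>)"
proof (rule strong_law_nonneg_uncorrelated)
  have nn: "0 \<le> real i * (real p * T) + a" for i using a T by simp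
  note mom = block_moments[OF nn T \<rho> int]
  show "0 \<le> block_energy (real i * (real p * T) + a) T \<rho> \<omega>" if "\<omega> \<in> space M" for i \<omega>
    by (rule block_energy_nonneg[OF that nn T \<rho>])
  show "integrable M (block_energy (real i * (real p * T) + a) T \<rho>)"
    "expectation (block_energy (real i * (real p * T) + a) T \<rho>) = expectation (block_energy 0 T \<rho>)"
    "integrable M (\<lambda>\<omega>. (block_energy (real i * (real p * T) + a) T \<rho> \<omega>)\<^sup>2)"
    "expectation (\<lambda>\<omega>. (block_energy (real i * (real p * T) + a) T \<rho> \<omega>)\<^sup>2)
      = expectation (\<lambda>\<omega>. (block_energy 0 T \<rho> \<omega>)\<^sup>2)" for i
    by (fact mom)+
  fix i j :: nat assume ij: "i < j"
  obtain d where d: "j = i + d" "1 \<le> d" using ij by (metis Suc_leI less_imp_add_positive One_nat_def)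
  have m: "1 \<le> d * p" using mult_le_mono[OF d(2) p] by simp
  have eq: "real j * (real p * T) + a = real i * (real p * T) + a + real (d * p) * T"
    unfolding d(1) of_nat_mult of_nat_add by (simp add: algebra_simps)
  note prod = block_product_moment[OF nn[of i] m T \<rho> int]
  show "integrable M (\<lambda>\<omega>. block_energy (real i * (real p * T) + a) T \<rho> \<omega> * block_energy (real j * (real p * T) + a) T \<rho> \<omega>)"
    "expectation (\<lambda>\<omega>. block_energy (real i * (real p * T) + a) T \<rho> \<omega> * block_energy (real j * (real p * T) + a) T \<rho> \<omega>)
      = (expectation (block_energy 0 T \<rho>))\<^sup>2"
    unfolding eq by (fact prod)+
qed

text \<open>The length \<open>S\<close> of the repair stretches is fixed once, large enough for finite second moments, while
  the block length \<open>len m\<close> is a multiple of \<open>S\<close> and grows. For fixed \<open>m\<close> the strong law gives the block averages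
  \<open>avA\<close> of long blocks and the averages \<open>avG\<close>, \<open>avH\<close> of the repair stretches at the start and at the end
  of the blocks; after division by \<open>len m\<close> the repairs become negligible for large \<open>m\<close>.\<close>

lemma AE_min_energy_average:
  assumes C: "taut_string_constant M W C" and r: "0 < r"
  shows "AE \<omega> in M. ((\<lambda>T. min_energy (\<lambda>t. W t \<omega>) T r / T) \<longlongrightarrow> C\<^sup>2 / r\<^sup>2) at_top"
proof -
  define \<kappa> where "\<kappa> = C\<^sup>2 / r\<^sup>2"
  have \<kappa>: "0 < \<kappa>" using C r by (simp add: \<kappa>_def taut_string_constant_def)
  have r2: "0 < r / 2" using r by simp
  have "\<forall>\<^sub>F T in at_top. integrable M (\<lambda>\<omega>. (block_energy 0 T r \<omega>)\<^sup>2) \<and> integrable M (\<lambda>\<omega>. (block_energy 0 T (r / 2) \<omega>)\<^sup>2)"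
    by (intro eventually_conj eventually_square_integrable_block_energy[OF C] r r2)
  then obtain S0 where S0: "\<And>T. S0 \<le> T \<Longrightarrow> integrable M (\<lambda>\<omega>. (block_energy 0 T r \<omega>)\<^sup>2)"
    "\<And>T. S0 \<le> T \<Longrightarrow> integrable M (\<lambda>\<omega>. (block_energy 0 T (r / 2) \<omega>)\<^sup>2)"
    by (auto simp: eventually_at_top_linorder)
  define S where "S = max 1 S0"
  have S: "0 < S" by (simp add: S_def)
  have int: "integrable M (\<lambda>\<omega>. (block_energy 0 T r \<omega>)\<^sup>2)" "integrable M (\<lambda>\<omega>. (block_energy 0 T (r / 2) \<omega>)\<^sup>2)"
    if "S \<le> T" for T using S0 that by (auto simp: S_def)
  define len where "len m = real (Suc m) * S" for m
  have len: "0 < len m" "S \<le> len m" for m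
    using S mult_right_mono[of 1 "real (Suc m)" S] by (auto simp: len_def simp del: of_nat_Suc)
  define q where "q T = expectation (block_energy 0 T r)" for T
  define q' where "q' = expectation (block_energy 0 S (r / 2))"
  define avA where "avA m n \<omega> = (\<Sum>i<n. block_energy (real i * len m) (len m) r \<omega>) / real n" for m n \<omega>
  define avG where "avG m n \<omega> = (\<Sum>i<n. block_energy (real i * len m) S r \<omega>) / real n" for m n \<omega>
  define avH where "avH m n \<omega> = (\<Sum>i<n. block_energy (real i * len m + (len m - S)) S (r / 2) \<omega>) / real n" for m n \<omega>
  have "AE \<omega> in M. (\<lambda>n. avA m n \<omega>) \<longlonglongrightarrow> q (len m)" for m
    using block_energy_strong_law[OF order_refl order_refl len(1) r int(1)[OF len(2)], of m]
    by (simp add: avA_def q_def)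
  moreover have "AE \<omega> in M. (\<lambda>n. avG m n \<omega>) \<longlonglongrightarrow> q S" for m
    using block_energy_strong_law[OF order_refl _ S r int(1)[OF order_refl], of "Suc m"]
    by (simp add: avG_def q_def len_def del: of_nat_Suc)
  moreover have "AE \<omega> in M. (\<lambda>n. avH m n \<omega>) \<longlonglongrightarrow> q'" for m
    using block_energy_strong_law[OF _ _ S r2 int(2)[OF order_refl], of "len m - S" "Suc m"] len(2)[of m]
    by (simp add: avH_def q'_def len_def del: of_nat_Suc)
  ultimately have "AE \<omega> in M. \<forall>m. (\<lambda>n. avA m n \<omega>) \<longlonglongrightarrow> q (len m) \<and> (\<lambda>n. avG m n \<omega>) \<longlonglongrightarrow> q S \<and> (\<lambda>n. avH m n \<omega>) \<longlonglongrightarrow> q'"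
    by (simp add: AE_all_countable)
  then show ?thesis
    using AE_space
  proof eventually_elim
    case (elim \<omega>)
    note \<omega> = elim(2)
    let ?w = "\<lambda>t. W t \<omega>"
    define Q where "Q T = min_energy ?w T r" for T
    note w = continuous_paths[OF \<omega>] start_zero[OF \<omega>]
    have Qmono: "Q x \<le> Q y" if "0 < x" "x \<le> y" for x y
      unfolding Q_def using that r by (intro min_energy_mono[OF continuous_W[OF \<omega>] w(2)]) auto
    have Qnn: "0 \<le> Q x" if "0 < x" for x
      unfolding Q_def using that r by (intro min_energy_nonneg[OF continuous_W[OF \<omega>] w(2)]) auto
    have "((\<lambda>T. Q T / T) \<longlongrightarrow> \<kappa>) at_top"
    proof (rule tendstoI)
      fix e :: real assume e: "0 < e"
      \<comment> \<open>With \<open>\<eta> * \<kappa> = e / 2\<close>, both \<open>(1 + \<eta>) * \<kappa>\<close> and \<open>\<kappa> / (1 + \<eta>)\<close> lie within \<open>e\<close> of \<open>\<kappa>\<close>.\<close>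
      define \<eta> where "\<eta> = e / (2 * \<kappa>)"
      have \<eta>: "0 < \<eta>" using e \<kappa> by (simp add: \<eta>_def)
      have \<eta>_bounds: "\<kappa> - e < \<kappa> / (1 + \<eta>)" "(1 + \<eta>) * \<kappa> < \<kappa> + e"
      proof -
        have "\<eta> * \<kappa> = e / 2" using \<kappa> by (simp add: \<eta>_def)
        then show "(1 + \<eta>) * \<kappa> < \<kappa> + e" using e by (simp add: algebra_simps)
        have "(\<kappa> - e) * (1 + \<eta>) = \<kappa> + \<eta> * \<kappa> - e - e * \<eta>" by (simp add: algebra_simps)
        also have "\<dots> < \<kappa>" using \<open>\<eta> * \<kappa> = e / 2\<close> mult_pos_pos[OF e \<eta>] e by simp
        finally show "\<kappa> - e < \<kappa> / (1 + \<eta>)" using \<eta> by (simp add: pos_less_divide_eq)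
      qed
      define c where "c = (1 + 1 / \<eta>) * (2 * r)\<^sup>2 / S"
      have len_top: "filterlim len at_top sequentially"
        unfolding len_def using S by real_asymp
      have q_lim: "(\<lambda>m. q (len m) / len m) \<longlonglongrightarrow> \<kappa>"
        using filterlim_compose[OF expectation_block_energy_limit[OF C r] len_top] by (simp add: q_def \<kappa>_def)
      have const: "(\<lambda>m. x / len m) \<longlonglongrightarrow> 0" for x
        by (rule real_tendsto_divide_at_top[OF tendsto_const len_top])
      have "(\<lambda>m. (q (len m) / len m - c / len m) / (1 + \<eta>) - q S / len m) \<longlonglongrightarrow> (\<kappa> - 0) / (1 + \<eta>) - 0"
        by (intro tendsto_intros q_lim const) (use \<eta> in simp)
      then have "\<forall>\<^sub>F m in sequentially. \<kappa> - e < (q (len m) / len m - c / len m) / (1 + \<eta>) - q S / len m"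
        using \<eta>_bounds(1) by (intro order_tendstoD) auto
      moreover have "(\<lambda>m. (1 + \<eta>) * (q (len m) / len m + q' / len m) + c / len m) \<longlonglongrightarrow> (1 + \<eta>) * (\<kappa> + 0) + 0"
        by (intro tendsto_intros q_lim const)
      then have "\<forall>\<^sub>F m in sequentially. (1 + \<eta>) * (q (len m) / len m + q' / len m) + c / len m < \<kappa> + e"
        using \<eta>_bounds(2) by (intro order_tendstoD) auto
      ultimately obtain m where
        m: "\<kappa> - e < (q (len m) / len m - c / len m) / (1 + \<eta>) - q S / len m"
          "(1 + \<eta>) * (q (len m) / len m + q' / len m) + c / len m < \<kappa> + e"
        using eventually_happens'[OF sequentially_bot eventually_conj] by blast
      let ?L = "len m"
      have lower: "(avA m n \<omega> - c) / (1 + \<eta>) - avG m n \<omega> \<le> Q (real n * ?L) / real n" if n: "0 < n" for n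
      proof -
        have "(\<Sum>i<n. block_energy (real i * ?L) ?L r \<omega>)
            \<le> (1 + \<eta>) * (Q (real n * ?L) + (\<Sum>i<n. block_energy (real i * ?L) S r \<omega>)) + real n * c"
          unfolding block_energy_def Q_def c_def by (rule sum_blocks_le_min_energy[OF w S len(2) r \<eta> n])
        then have "avA m n \<omega> \<le> (1 + \<eta>) * (Q (real n * ?L) / real n + avG m n \<omega>) + c"
          using n by (simp add: avA_def avG_def field_simps)
        then show ?thesis using \<eta> by (simp add: field_simps)
      qed
      have upper: "Q (real n * ?L) / real n \<le> (1 + \<eta>) * (avA m n \<omega> + avH m n \<omega>) + c" if n: "0 < n" for n
      proof -
        have "Q (real n * ?L) \<le> (1 + \<eta>) * ((\<Sum>i<n. block_energy (real i * ?L) ?L r \<omega>)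
            + (\<Sum>i<n. block_energy (real i * ?L + (?L - S)) S (r / 2) \<omega>)) + real n * c"
          unfolding block_energy_def Q_def c_def by (rule min_energy_le_sum_blocks[OF w S len(2) r \<eta> n])
        then show ?thesis using n by (simp add: avA_def avH_def field_simps)
      qed
      have av: "(\<lambda>n. avA m n \<omega>) \<longlonglongrightarrow> q ?L" "(\<lambda>n. avG m n \<omega>) \<longlonglongrightarrow> q S" "(\<lambda>n. avH m n \<omega>) \<longlonglongrightarrow> q'"
        using elim(1) by auto
      \<comment> \<open>Comparing a time with the next multiple of the block length changes the denominator by these ratios.\<close>
      have ratio: "(\<lambda>k. real (Suc k) / real (Suc (Suc k))) \<longlonglongrightarrow> 1" "(\<lambda>k. real (Suc (Suc k)) / real (Suc k)) \<longlonglongrightarrow> 1"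
        by real_asymp+
      let ?t = "\<lambda>k. real (Suc k) * ?L"
      have Lpos: "0 < ?L" by (rule len)
      have "\<forall>\<^sub>F T in at_top. \<kappa> - e < Q T / T \<and> Q T / T < \<kappa> + e"
      proof (rule average_bounds_of_sparse[where t = ?t])
        show "0 < ?t k" for k using Lpos by simp
        show "incseq ?t" using Lpos by (auto simp: incseq_def)
        show "filterlim ?t at_top sequentially" using Lpos by real_asymp
        have "(\<lambda>k. ((avA m (Suc k) \<omega> - c) / (1 + \<eta>) - avG m (Suc k) \<omega>) / ?L * (real (Suc k) / real (Suc (Suc k))))
            \<longlonglongrightarrow> ((q ?L - c) / (1 + \<eta>) - q S) / ?L * 1"
          by (intro tendsto_intros LIMSEQ_Suc[OF av(1)] LIMSEQ_Suc[OF av(2)] ratio) (use \<eta> Lpos in auto)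
        moreover have "((q ?L - c) / (1 + \<eta>) - q S) / ?L = (q ?L / ?L - c / ?L) / (1 + \<eta>) - q S / ?L"
          by (simp add: diff_divide_distrib divide_divide_eq_left mult.commute)
        ultimately have "\<forall>\<^sub>F k in sequentially. \<kappa> - e
            < ((avA m (Suc k) \<omega> - c) / (1 + \<eta>) - avG m (Suc k) \<omega>) / ?L * (real (Suc k) / real (Suc (Suc k)))"
          using m(1) by (intro order_tendstoD) auto
        then show "\<forall>\<^sub>F k in sequentially. \<kappa> - e < Q (?t k) / ?t (Suc k)"
        proof eventually_elim
          case (elim k)
          note elim
          also have "((avA m (Suc k) \<omega> - c) / (1 + \<eta>) - avG m (Suc k) \<omega>) / ?L * (real (Suc k) / real (Suc (Suc k)))
              \<le> (Q (?t k) / real (Suc k)) / ?L * (real (Suc k) / real (Suc (Suc k)))"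
            using Lpos lower[of "Suc k"] by (intro mult_right_mono divide_right_mono) auto
          also have "\<dots> = Q (?t k) / ?t (Suc k)" by (simp del: of_nat_Suc)
          finally show ?case .
        qed
        have "(\<lambda>k. ((1 + \<eta>) * (avA m (Suc (Suc k)) \<omega> + avH m (Suc (Suc k)) \<omega>) + c) / ?L * (real (Suc (Suc k)) / real (Suc k)))
            \<longlonglongrightarrow> ((1 + \<eta>) * (q ?L + q') + c) / ?L * 1"
          by (intro tendsto_intros LIMSEQ_Suc[OF LIMSEQ_Suc[OF av(1)]] LIMSEQ_Suc[OF LIMSEQ_Suc[OF av(3)]] ratio) (use Lpos in auto)
        moreover have "((1 + \<eta>) * (q ?L + q') + c) / ?L = (1 + \<eta>) * (q ?L / ?L + q' / ?L) + c / ?L"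
          by (simp add: add_divide_distrib[symmetric])
        ultimately have "\<forall>\<^sub>F k in sequentially.
            ((1 + \<eta>) * (avA m (Suc (Suc k)) \<omega> + avH m (Suc (Suc k)) \<omega>) + c) / ?L * (real (Suc (Suc k)) / real (Suc k)) < \<kappa> + e"
          using m(2) by (intro order_tendstoD) auto
        then show "\<forall>\<^sub>F k in sequentially. Q (?t (Suc k)) / ?t k < \<kappa> + e"
        proof eventually_elim
          case (elim k)
          have "Q (?t (Suc k)) / ?t k = (Q (?t (Suc k)) / real (Suc (Suc k))) / ?L * (real (Suc (Suc k)) / real (Suc k))"
            by (simp del: of_nat_Suc)
          also have "\<dots> \<le> ((1 + \<eta>) * (avA m (Suc (Suc k)) \<omega> + avH m (Suc (Suc k)) \<omega>) + c) / ?L * (real (Suc (Suc k)) / real (Suc k))"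
            using Lpos upper[of "Suc (Suc k)"] by (intro mult_right_mono divide_right_mono) auto
          also note elim
          finally show ?case .
        qed
      qed (use Qmono Qnn in auto)
      then show "\<forall>\<^sub>F T in at_top. dist (Q T / T) \<kappa> < e"
        by eventually_elim (simp add: dist_real_def abs_less_iff)
    qed
    then show ?case by (simp add: Q_def \<kappa>_def)
  qed
qed

text \<open>For \<open>T\<close> in \<open>[(k + 1) S, (k + 2) S]\<close> the end of the string is repaired after time \<open>k S\<close>, using a string
  over \<open>[k S, (k + 2) S]\<close>. The energies \<open>Y k\<close> of these strings are equally distributed with finite second
  moment, hence \<open>o(k)\<close> almost surely.\<close>

lemma AE_min_energy_fixed_average:
  assumes C: "taut_string_constant M W C" and r: "0 < r"
  shows "AE \<omega> in M. ((\<lambda>T. min_energy_fixed (\<lambda>t. W t \<omega>) T r / T) \<longlongrightarrow> C\<^sup>2 / r\<^sup>2) at_top"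
proof -
  have r2: "0 < r / 2" using r by simp
  obtain S0 where S0: "\<And>T. S0 \<le> T \<Longrightarrow> integrable M (\<lambda>\<omega>. (block_energy 0 T (r / 2) \<omega>)\<^sup>2)"
    using eventually_square_integrable_block_energy[OF C r2] by (auto simp: eventually_at_top_linorder)
  define S where "S = max 1 S0"
  have S: "0 < S" by (simp add: S_def)
  have int: "integrable M (\<lambda>\<omega>. (block_energy 0 (2 * S) (r / 2) \<omega>)\<^sup>2)" by (rule S0) (simp add: S_def)
  define Y where "Y k = block_energy (real k * S) (2 * S) (r / 2)" for k :: nat
  have "AE \<omega> in M. (\<lambda>k. Y k \<omega> / real (Suc k)) \<longlonglongrightarrow> 0"
    unfolding Y_def
    by (rule AE_sublinear_of_second_moment[OF block_moments(1,2)]) (use S r2 int in auto)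
  then show ?thesis
    using AE_min_energy_average[OF C r] AE_space
  proof eventually_elim
    case (elim \<omega>)
    note \<omega> = elim(3)
    note w = continuous_paths[OF \<omega>] start_zero[OF \<omega>]
    define Q where "Q T = min_energy (\<lambda>t. W t \<omega>) T r" for T
    define Q0 where "Q0 T = min_energy_fixed (\<lambda>t. W t \<omega>) T r" for T
    define k where "k T = nat \<lfloor>T / S\<rfloor> - 1" for T
    have kT: "real (Suc (k T)) * S \<le> T" "T \<le> real (k T + 2) * S" if "S \<le> T" for T
    proof -
      have "1 \<le> T / S" using that S by simp
      then have "1 \<le> \<lfloor>T / S\<rfloor>" by (simp add: le_floor_iff)
      then have eq: "real (Suc (k T)) = real_of_int \<lfloor>T / S\<rfloor>" by (simp add: k_def)
      have "real (Suc (k T)) \<le> T / S" unfolding eq by (rule of_int_floor_le)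
      then show "real (Suc (k T)) * S \<le> T" using S by (simp add: pos_le_divide_eq)
      have "T / S \<le> real (Suc (k T)) + 1" unfolding eq by linarith
      then have "T / S \<le> real (k T + 2)" by simp
      then show "T \<le> real (k T + 2) * S" using S by (simp add: pos_divide_le_eq)
    qed
    have k_top: "filterlim k at_top at_top"
      unfolding filterlim_at_top
    proof
      fix n
      show "\<forall>\<^sub>F T in at_top. n \<le> k T"
        using eventually_ge_at_top[of "real (n + 2) * S"]
      proof eventually_elim
        case (elim T)
        have "1 * S \<le> real (n + 2) * S" using S by (intro mult_right_mono) auto
        then have "real (n + 2) * S \<le> real (k T + 2) * S" using kT(2)[of T] elim by simp
        then show ?case using S by simp
      qed
    qed
    have Ylim: "((\<lambda>T. Y (k T) \<omega> / T) \<longlongrightarrow> 0) at_top"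
    proof (rule Lim_null_comparison)
      show "((\<lambda>T. Y (k T) \<omega> / real (Suc (k T)) / S) \<longlongrightarrow> 0) at_top"
        using tendsto_divide[OF filterlim_compose[OF elim(1) k_top] tendsto_const, of S] S by simp
      show "\<forall>\<^sub>F T in at_top. norm (Y (k T) \<omega> / T) \<le> Y (k T) \<omega> / real (Suc (k T)) / S"
        using eventually_ge_at_top[of S]
      proof eventually_elim
        case (elim T)
        have nn: "0 \<le> Y (k T) \<omega>" unfolding Y_def using S r2 by (intro block_energy_nonneg \<omega>) auto
        have "Y (k T) \<omega> / T \<le> Y (k T) \<omega> / (real (Suc (k T)) * S)"
          using nn kT(1)[OF elim] S elim by (intro divide_left_mono) auto
        then show ?case using nn S elim by simp
      qed
    qed
    have Qlim: "((\<lambda>T. Q T / T) \<longlongrightarrow> C\<^sup>2 / r\<^sup>2) at_top" using elim(2) by (simp add: Q_def)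
    \<comment> \<open>The weight \<open>\<eta> = 1 / \<surd>T\<close> makes the relative error and the crossfade cost vanish together.\<close>
    let ?U = "\<lambda>T. (1 + 1 / sqrt T) * (Q T / T + Y (k T) \<omega> / T) + (1 + sqrt T) / T * ((2 * r)\<^sup>2 / S)"
    have "(?U \<longlongrightarrow> (1 + 0) * (C\<^sup>2 / r\<^sup>2 + 0) + 0 * ((2 * r)\<^sup>2 / S)) at_top"
    proof (intro tendsto_add tendsto_mult tendsto_const Qlim Ylim)
      show "((\<lambda>T::real. 1 / sqrt T) \<longlongrightarrow> 0) at_top" by real_asymp
      show "((\<lambda>T::real. (1 + sqrt T) / T) \<longlongrightarrow> 0) at_top" by real_asymp
    qed
    then have Ulim: "(?U \<longlongrightarrow> C\<^sup>2 / r\<^sup>2) at_top" by simp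
    have "((\<lambda>T. Q0 T / T) \<longlongrightarrow> C\<^sup>2 / r\<^sup>2) at_top"
    proof (rule tendsto_sandwich[OF _ _ Qlim Ulim])
      show "\<forall>\<^sub>F T in at_top. Q T / T \<le> Q0 T / T"
        using eventually_gt_at_top[of "0::real"]
        by eventually_elim (simp add: Q_def Q0_def divide_right_mono min_energy_le_fixed[OF w _ r])
      show "\<forall>\<^sub>F T in at_top. Q0 T / T \<le> ?U T"
        using eventually_ge_at_top[of S]
      proof eventually_elim
        case (elim T)
        have T: "0 < T" using S elim by simp
        define a where "a = real (k T) * S"
        have a: "0 \<le> a" "a + S \<le> T" "T \<le> a + 2 * S"
          using kT[OF elim] S by (auto simp: a_def algebra_simps)
        have "Q0 T \<le> (1 + 1 / sqrt T) * (Q T + min_energy (path_from (\<lambda>t. W t \<omega>) a) (a + 2 * S - a) (r / 2))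
            + (1 + 1 / (1 / sqrt T)) * (2 * r)\<^sup>2 / (T - a)"
          unfolding Q_def Q0_def
          by (rule min_energy_fixed_le_free[OF w a(1) _ a(3) r]) (use a S T in auto)
        also have "min_energy (path_from (\<lambda>t. W t \<omega>) a) (a + 2 * S - a) (r / 2) = Y (k T) \<omega>"
          by (simp add: Y_def block_energy_def a_def)
        also have "(1 + 1 / (1 / sqrt T)) * (2 * r)\<^sup>2 / (T - a) \<le> (1 + sqrt T) * (2 * r)\<^sup>2 / S"
          using a S T by (simp, intro divide_left_mono) auto
        finally have "Q0 T / T \<le> ((1 + 1 / sqrt T) * (Q T + Y (k T) \<omega>) + (1 + sqrt T) * (2 * r)\<^sup>2 / S) / T"
          using T by (simp add: divide_right_mono)
        also have "\<dots> = ?U T" by (simp add: divide_inverse algebra_simps)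
        finally show ?case .
      qed
    qed
    then show ?case by (simp add: Q0_def)
  qed
qed

end

theorem theorem1p2:
  fixes M :: "'a measure" and W :: "real \<Rightarrow> 'a \<Rightarrow> real" and \<C> r :: real
  assumes "wiener_process M W"
    and "taut_string_constant M W \<C>"
    and "0 < r"
  shows "(AE \<omega> in M. ((\<lambda>T. ennreal (r / sqrt T) * I_free (\<lambda>t. W t \<omega>) T r) \<longlongrightarrow> ennreal \<C>) at_top) \<and>
    (AE \<omega> in M. ((\<lambda>T. ennreal (r / sqrt T) * I_fixed (\<lambda>t. W t \<omega>) T r) \<longlongrightarrow> ennreal \<C>) at_top)"
proof
  interpret wiener_process M W by fact
  have C: "0 < \<C>" using assms(2) by (simp add: taut_string_constant_def)
  show "AE \<omega> in M. ((\<lambda>T. ennreal (r / sqrt T) * I_free (\<lambda>t. W t \<omega>) T r) \<longlongrightarrow> ennreal \<C>) at_top"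
    using AE_min_energy_average[OF assms(2,3)] AE_space
  proof eventually_elim
    case (elim \<omega>)
    note w = continuous_W[OF elim(2)] start_zero[OF elim(2)]
    show ?case
      by (rule tendsto_scaled_root[OF assms(3) C elim(1)])
        (auto intro: I_free_eq_min_energy[OF w] min_energy_nonneg[OF w] assms)
  qed
  show "AE \<omega> in M. ((\<lambda>T. ennreal (r / sqrt T) * I_fixed (\<lambda>t. W t \<omega>) T r) \<longlongrightarrow> ennreal \<C>) at_top"
    using AE_min_energy_fixed_average[OF assms(2,3)] AE_space
  proof eventually_elim
    case (elim \<omega>)
    note w = continuous_paths[OF elim(2)] start_zero[OF elim(2)]
    have "0 \<le> min_energy_fixed (\<lambda>t. W t \<omega>) T r" if "0 < T" for T
      using min_energy_le_fixed[OF w that assms(3)]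
        min_energy_nonneg[OF continuous_W[OF elim(2)] start_zero[OF elim(2)] that assms(3)] by linarith
    then show ?case
      by (intro tendsto_scaled_root[OF assms(3) C elim(1)])
        (auto intro: I_fixed_eq_min_energy_fixed[OF w] assms)
  qed
qed

end
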